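(* Let $\Gamma$ be a finite graph and let $\mathcal{D}$ be its set of dimer coverings. For each $A_0\in\mathcal{D}$, the dimer group $\pi_1(X_{\mathcal{D}},A_0)$ is isomorphic to the group with generators $\{y_{A,B}\}_{A,B\in\mathcal{D}}$ (one for each ordered pair of dimer coverings) subject to the following relations: $y_{A,C}=y_{A,B}\,y_{B,C}$ for each flat triple $A,B,C\in\mathcal{D}$, and $y_{A_0,A}=1$ for all $A\in\mathcal{D}$.
   Context: A graph is a 1-dimensional CW-complex without loops (multiple edges are allowed); finite means finitely many vertices and edges. Let $E$ be the set of edges of $\Gamma$ and let $G=2^E$ be the power group of $E$: the set of subsets of $E$ with multiplication $AB=(A\cup B)\setminus(A\cap B)$. A dimer covering is a set of edges such that every vertex of $\Gamma$ is incident to exactly one edge in the set; $\mathcal{D}\subset G$ is the set of dimer coverings. For $A\in\mathcal{D}$ and a vertex $v$ of $\Gamma$, $A_v$ denotes the only edge of $A$ incident to $v$. A triple $A,B,C\in\mathcal{D}$ is flat if for any vertex $v$ of $\Gamma$, at least two of the edges $A_v,B_v,C_v$ are equal. The dimer complex $X_{\mathcal{D}}$ is defined as follows. A set $s\subset E$ is cyclic if it is finite and each vertex of $\Gamma$ is either incident to exactly two distinct edges belonging to $s$ or not incident to any edge belonging to $s$. A cyclic set is a cycle if the union of its edges is a single circle; a cycle is even if it has an even number of elements. Two sets of edges $s,t$ are independent if no edge in $s$ has a common vertex with an edge in $t$. For a finite set $S$ of pairwise independent even cycles, put $[S]=\prod_{s\in S}s\in G$, $[\emptyset]=\emptyset$.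 A based cube is a pair $(A,S)$ with $A\in G$ and $S$ a finite set of pairwise independent even cycles; its vertices are the elements $[T]A$, $T\subset S$, and its dimension is $\mathrm{card}(S)$. Based cubes $(A,S)$ and $([T]A,S)$ with $T\subset S$ are equivalent; equivalence classes of $k$-dimensional based cubes are called $k$-cubes. The cubed complex $X_G$ consists of triples $(A,S,x)$ with $(A,S)$ a based cube and $x:S\to[0,1]$, modulo the equivalence relation generated by: $(A,S,x)\sim(A,S',x')$ if $S\subset S'$, $x=x'|_S$, $x'(S'\setminus S)=0$; and $(A,S,x)\sim([T]A,S,x')$ if $T\subset S$, $x'=x$ on $S\setminus T$, $x'(t)=1-x(t)$ for $t\in T$. The dimer complex $X_{\mathcal{D}}\subset X_G$ is the subcomplex formed by the cubes all of whose vertices lie in $\mathcal{D}$; its $0$-skeleton is $\mathcal{D}$. It is connected, and its fundamental group is called the dimer group of $\Gamma$. *)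

theory Defs
  imports "HOL-Analysis.Analysis" "HOL-Algebra.FiniteProduct"
begin

section \<open>Graphs and dimer coverings\<close>

text \<open>
  A 1-dimensional CW-complex without loops is given by its vertices, its (open) edges and,
  for each edge, the set of its two distinct end points. Several edges may have the same ends.
\<close>

record ('v, 'e) multigraph =
  verts :: "'v set"
  edges :: "'e set"
  ends :: "'e \<Rightarrow> 'v set"

definition loopless_graph :: "('v, 'e) multigraph \<Rightarrow> bool" where
  "loopless_graph \<Gamma> \<longleftrightarrow> (\<forall>e\<in>edges \<Gamma>. ends \<Gamma> e \<subseteq> verts \<Gamma> \<and> card (ends \<Gamma> e) = 2)"

definition finite_graph :: "('v, 'e) multigraph \<Rightarrow> bool" where
  "finite_graph \<Gamma> \<longleftrightarrow> loopless_graph \<Gamma> \<and> finite (verts \<Gamma>) \<and> finite (edges \<Gamma>)"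

definition power_group :: "'e set \<Rightarrow> 'e set monoid" where
  "power_group E = \<lparr>carrier = Pow E, mult = (\<lambda>A B. (A \<union> B) - (A \<inter> B)), one = {}\<rparr>"

lemma comm_group_power_group: "comm_group (power_group E)"
proof (rule comm_groupI)
  fix A assume "A \<in> carrier (power_group E)"
  then show "\<exists>B\<in>carrier (power_group E). B \<otimes>\<^bsub>power_group E\<^esub> A = \<one>\<^bsub>power_group E\<^esub>"
    by (intro bexI[of _ A]) (auto simp: power_group_def)
qed (auto simp: power_group_def)

definition dimer_coverings :: "('v, 'e) multigraph \<Rightarrow> 'e set set" where
  "dimer_coverings \<Gamma> =
     {A. A \<subseteq> edges \<Gamma> \<and> (\<forall>v\<in>verts \<Gamma>. \<exists>!e. e \<in> A \<and> v \<in> ends \<Gamma> e)}"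

definition edge_at :: "('v, 'e) multigraph \<Rightarrow> 'e set \<Rightarrow> 'v \<Rightarrow> 'e" where
  "edge_at \<Gamma> A v = (THE e. e \<in> A \<and> v \<in> ends \<Gamma> e)"

definition flat :: "('v, 'e) multigraph \<Rightarrow> 'e set \<Rightarrow> 'e set \<Rightarrow> 'e set \<Rightarrow> bool" where
  "flat \<Gamma> A B C \<longleftrightarrow>
     (\<forall>v\<in>verts \<Gamma>. edge_at \<Gamma> A v = edge_at \<Gamma> B v \<or> edge_at \<Gamma> B v = edge_at \<Gamma> C v \<or>
                  edge_at \<Gamma> A v = edge_at \<Gamma> C v)"


section \<open>Cycles\<close>

definition cyclic_set :: "('v, 'e) multigraph \<Rightarrow> 'e set \<Rightarrow> bool" where
  "cyclic_set \<Gamma> s \<longleftrightarrow> s \<subseteq> edges \<Gamma> \<and> finite s \<and>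
     (\<forall>v\<in>verts \<Gamma>. card {e \<in> s. v \<in> ends \<Gamma> e} = 2 \<or> {e \<in> s. v \<in> ends \<Gamma> e} = {})"

text \<open>
  The union of the closed edges in \<open>s\<close> is a single circle iff the circle is traversed by
  distinct vertices \<open>v 0, \<dots>, v (n - 1)\<close> and distinct edges \<open>e 0, \<dots>, e (n - 1)\<close>, where \<open>e i\<close>
  joins \<open>v i\<close> to the next vertex. For \<open>n = 2\<close> this is a pair of parallel edges.
\<close>

definition single_circle :: "('v, 'e) multigraph \<Rightarrow> 'e set \<Rightarrow> bool" where
  "single_circle \<Gamma> s \<longleftrightarrow>
     (\<exists>n v e. 2 \<le> n \<and> inj_on v {..<n} \<and> inj_on e {..<n} \<and> s = e ` {..<n} \<and>
        (\<forall>i<n. ends \<Gamma> (e i) = {v i, v (Suc i mod n)}))"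

definition even_cycle :: "('v, 'e) multigraph \<Rightarrow> 'e set \<Rightarrow> bool" where
  "even_cycle \<Gamma> s \<longleftrightarrow> cyclic_set \<Gamma> s \<and> single_circle \<Gamma> s \<and> even (card s)"

definition indep_edge_sets :: "('v, 'e) multigraph \<Rightarrow> 'e set \<Rightarrow> 'e set \<Rightarrow> bool" where
  "indep_edge_sets \<Gamma> s t \<longleftrightarrow> (\<forall>e\<in>s. \<forall>f\<in>t. ends \<Gamma> e \<inter> ends \<Gamma> f = {})"

definition cycle_product :: "('v, 'e) multigraph \<Rightarrow> 'e set set \<Rightarrow> 'e set" where
  "cycle_product \<Gamma> S = (\<Otimes>\<^bsub>power_group (edges \<Gamma>)\<^esub>s\<in>S. s)"


section \<open>Quotient topology\<close>

definition quotient_topology :: "'a topology \<Rightarrow> ('a \<times> 'a) set \<Rightarrow> 'a set topology" where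
  "quotient_topology X r =
     topology (\<lambda>U. U \<subseteq> topspace X // r \<and> openin X {x \<in> topspace X. r `` {x} \<in> U})"

lemma openin_quotient_topology:
  "openin (quotient_topology X r) U \<longleftrightarrow>
     U \<subseteq> topspace X // r \<and> openin X {x \<in> topspace X. r `` {x} \<in> U}"
proof -
  have "istopology (\<lambda>U. U \<subseteq> topspace X // r \<and> openin X {x \<in> topspace X. r `` {x} \<in> U})"
    unfolding istopology_def
  proof (intro conjI allI impI)
    fix S T
    assume *: "S \<subseteq> topspace X // r \<and> openin X {x \<in> topspace X. r `` {x} \<in> S}"
      "T \<subseteq> topspace X // r \<and> openin X {x \<in> topspace X. r `` {x} \<in> T}"
    then show "S \<inter> T \<subseteq> topspace X // r" by blast
    have "{x \<in> topspace X. r `` {x} \<in> S \<inter> T} =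
        {x \<in> topspace X. r `` {x} \<in> S} \<inter> {x \<in> topspace X. r `` {x} \<in> T}" by auto
    with * show "openin X {x \<in> topspace X. r `` {x} \<in> S \<inter> T}" by auto
  next
    fix \<K>
    assume *: "\<forall>K\<in>\<K>. K \<subseteq> topspace X // r \<and> openin X {x \<in> topspace X. r `` {x} \<in> K}"
    then show "\<Union>\<K> \<subseteq> topspace X // r" by blast
    have "{x \<in> topspace X. r `` {x} \<in> \<Union>\<K>} = (\<Union>K\<in>\<K>. {x \<in> topspace X. r `` {x} \<in> K})"
      by auto
    with * show "openin X {x \<in> topspace X. r `` {x} \<in> \<Union>\<K>}" by auto
  qed
  then show ?thesis
    by (simp add: quotient_topology_def)
qed

lemma topspace_quotient_topology [simp]:
  "topspace (quotient_topology X r) = topspace X // r"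
proof -
  have "{x \<in> topspace X. r `` {x} \<in> topspace X // r} = topspace X"
    by (auto simp: quotient_def)
  then have "openin (quotient_topology X r) (topspace X // r)"
    by (simp add: openin_quotient_topology)
  then show ?thesis
    by (metis openin_quotient_topology openin_subset openin_topspace subset_antisym)
qed

lemma quotient_map_quotient_topology:
  "quotient_map X (quotient_topology X r) (\<lambda>x. r `` {x})"
  by (auto simp: quotient_map_def openin_quotient_topology quotient_def)


section \<open>The cubed complex and the dimer complex\<close>

type_synonym 'e based_cube = "'e set \<times> 'e set set"
type_synonym 'e cube_point = "'e based_cube \<times> ('e set \<Rightarrow> real)"

definition based_cubes :: "('v, 'e) multigraph \<Rightarrow> 'e based_cube set" where
  "based_cubes \<Gamma> = {(A, S). A \<in> carrier (power_group (edges \<Gamma>)) \<and> finite S \<and>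
     (\<forall>s\<in>S. even_cycle \<Gamma> s) \<and> pairwise (indep_edge_sets \<Gamma>) S}"

definition translate :: "('v, 'e) multigraph \<Rightarrow> 'e set set \<Rightarrow> 'e set \<Rightarrow> 'e set" where
  "translate \<Gamma> T A = cycle_product \<Gamma> T \<otimes>\<^bsub>power_group (edges \<Gamma>)\<^esub> A"

definition cube_vertices :: "('v, 'e) multigraph \<Rightarrow> 'e based_cube \<Rightarrow> 'e set set" where
  "cube_vertices \<Gamma> = (\<lambda>(A, S). {translate \<Gamma> T A | T. T \<subseteq> S})"

text \<open>
  The disjoint union of the cubes \<open>[0,1]\<^sup>S\<close>, one for each based cube \<open>(A, S)\<close>. Its points are
  the triples \<open>((A, S), x)\<close> with \<open>x \<in> S \<rightarrow>\<^sub>E {0..1}\<close>.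
\<close>

definition cube_sum :: "('v, 'e) multigraph \<Rightarrow> 'e cube_point topology" where
  "cube_sum \<Gamma> =
     sum_topology (\<lambda>(A, S). product_topology (\<lambda>_. top_of_set {0..1}) S) (based_cubes \<Gamma>)"

inductive cube_glue :: "('v, 'e) multigraph \<Rightarrow> 'e cube_point \<Rightarrow> 'e cube_point \<Rightarrow> bool"
  for \<Gamma> where
  face: "\<lbrakk>((A, S), x) \<in> topspace (cube_sum \<Gamma>); ((A, S'), x') \<in> topspace (cube_sum \<Gamma>);
      S \<subseteq> S'; \<forall>s\<in>S. x s = x' s; \<forall>s\<in>S' - S. x' s = 0\<rbrakk>
    \<Longrightarrow> cube_glue \<Gamma> ((A, S), x) ((A, S'), x')"
| flip: "\<lbrakk>((A, S), x) \<in> topspace (cube_sum \<Gamma>);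
      ((translate \<Gamma> T A, S), x') \<in> topspace (cube_sum \<Gamma>);
      T \<subseteq> S; \<forall>s\<in>S - T. x' s = x s; \<forall>t\<in>T. x' t = 1 - x t\<rbrakk>
    \<Longrightarrow> cube_glue \<Gamma> ((A, S), x) ((translate \<Gamma> T A, S), x')"

definition cube_equiv :: "('v, 'e) multigraph \<Rightarrow> ('e cube_point \<times> 'e cube_point) set" where
  "cube_equiv \<Gamma> = {(p, q). p \<in> topspace (cube_sum \<Gamma>) \<and> q \<in> topspace (cube_sum \<Gamma>) \<and>
     equivclp (cube_glue \<Gamma>) p q}"

lemma equiv_cube_equiv: "equiv (topspace (cube_sum \<Gamma>)) (cube_equiv \<Gamma>)"
proof (rule equivI)
  show "sym (cube_equiv \<Gamma>)"
    by (auto simp: cube_equiv_def sym_def intro: equivclp_sym)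
  show "trans (cube_equiv \<Gamma>)"
    unfolding cube_equiv_def trans_def using equivclp_trans by fast
qed (auto simp: cube_equiv_def refl_on_def)

definition cubed_complex :: "('v, 'e) multigraph \<Rightarrow> 'e cube_point set topology" where
  "cubed_complex \<Gamma> = quotient_topology (cube_sum \<Gamma>) (cube_equiv \<Gamma>)"

definition cube_class :: "('v, 'e) multigraph \<Rightarrow> 'e cube_point \<Rightarrow> 'e cube_point set" where
  "cube_class \<Gamma> p = cube_equiv \<Gamma> `` {p}"

definition dimer_complex :: "('v, 'e) multigraph \<Rightarrow> 'e cube_point set topology" where
  "dimer_complex \<Gamma> = subtopology (cubed_complex \<Gamma>)
     {cube_class \<Gamma> (c, x) | c x. (c, x) \<in> topspace (cube_sum \<Gamma>) \<and>
        cube_vertices \<Gamma> c \<subseteq> dimer_coverings \<Gamma>}"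

text \<open>The point of the 0-skeleton given by \<open>A\<close>, that is, the 0-cube \<open>(A, {})\<close>.\<close>

definition vertex_point :: "('v, 'e) multigraph \<Rightarrow> 'e set \<Rightarrow> 'e cube_point set" where
  "vertex_point \<Gamma> A = cube_class \<Gamma> ((A, {}), \<lambda>_. undefined)"


section \<open>The fundamental group of a topological space\<close>

definition loops :: "'a topology \<Rightarrow> 'a \<Rightarrow> (real \<Rightarrow> 'a) set" where
  "loops X a = {p. pathin X p \<and> p 0 = a \<and> p 1 = a}"

definition loop_homotopy :: "'a topology \<Rightarrow> 'a \<Rightarrow> ((real \<Rightarrow> 'a) \<times> (real \<Rightarrow> 'a)) set" where
  "loop_homotopy X a = {(p, q). p \<in> loops X a \<and> q \<in> loops X a \<and>
     homotopic_with (\<lambda>r. r 0 = a \<and> r 1 = a) (top_of_set {0..1}) X p q}"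

text \<open>\<^const>\<open>joinpaths\<close> is not available since its type requires a topological type class.\<close>

definition path_concat :: "(real \<Rightarrow> 'a) \<Rightarrow> (real \<Rightarrow> 'a) \<Rightarrow> real \<Rightarrow> 'a" where
  "path_concat p q = (\<lambda>t. if t \<le> 1/2 then p (2 * t) else q (2 * t - 1))"

definition fundamental_group :: "'a topology \<Rightarrow> 'a \<Rightarrow> (real \<Rightarrow> 'a) set monoid" where
  "fundamental_group X a =
     \<lparr>carrier = loops X a // loop_homotopy X a,
      mult = (\<lambda>P Q. \<Union>p\<in>P. \<Union>q\<in>Q. loop_homotopy X a `` {path_concat p q}),
      one = loop_homotopy X a `` {\<lambda>_. a}\<rparr>"


section \<open>Groups given by generators and relations\<close>

text \<open>
  Words in the letters \<open>(g, True)\<close> and \<open>(g, False)\<close>, which stand for a generator \<open>g\<close> and its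
  inverse. A relation \<open>u = v\<close> is the pair of words \<open>(u, v)\<close>.
\<close>

type_synonym 'g word = "('g \<times> bool) list"

definition words :: "'g set \<Rightarrow> 'g word set" where
  "words X = lists (X \<times> UNIV)"

inductive word_cong :: "'g set \<Rightarrow> ('g word \<times> 'g word) set \<Rightarrow> 'g word \<Rightarrow> 'g word \<Rightarrow> bool"
  for X R where
  refl: "w \<in> words X \<Longrightarrow> word_cong X R w w"
| sym: "word_cong X R u v \<Longrightarrow> word_cong X R v u"
| trans: "word_cong X R u v \<Longrightarrow> word_cong X R v w \<Longrightarrow> word_cong X R u w"
| append: "word_cong X R u u' \<Longrightarrow> word_cong X R v v' \<Longrightarrow> word_cong X R (u @ v) (u' @ v')"
| cancel: "g \<in> X \<Longrightarrow> word_cong X R [(g, b), (g, \<not> b)] []"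
| relation: "(u, v) \<in> R \<Longrightarrow> u \<in> words X \<Longrightarrow> v \<in> words X \<Longrightarrow> word_cong X R u v"

definition word_equiv :: "'g set \<Rightarrow> ('g word \<times> 'g word) set \<Rightarrow> ('g word \<times> 'g word) set" where
  "word_equiv X R = {(u, v). word_cong X R u v}"

definition presented_group :: "'g set \<Rightarrow> ('g word \<times> 'g word) set \<Rightarrow> 'g word set monoid" where
  "presented_group X R =
     \<lparr>carrier = words X // word_equiv X R,
      mult = (\<lambda>P Q. \<Union>u\<in>P. \<Union>v\<in>Q. word_equiv X R `` {u @ v}),
      one = word_equiv X R `` {[]}\<rparr>"

lemma word_cong_words: "word_cong X R u v \<Longrightarrow> u \<in> words X \<and> v \<in> words X"
  by (induction rule: word_cong.induct) (auto simp: words_def)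

lemma equiv_word_equiv: "equiv (words X) (word_equiv X R)"
proof (rule equivI)
  show "word_equiv X R \<subseteq> words X \<times> words X"
    by (auto simp: word_equiv_def dest: word_cong_words)
  show "refl_on (words X) (word_equiv X R)"
    by (auto simp: word_equiv_def refl_on_def intro: word_cong.refl)
  show "sym (word_equiv X R)"
    by (auto simp: word_equiv_def sym_def intro: word_cong.sym)
  show "trans (word_equiv X R)"
    unfolding trans_def word_equiv_def using word_cong.trans by blast
qed

lemma mult_presented_group:
  assumes "u \<in> words X" "v \<in> words X"
  shows "word_equiv X R `` {u} \<otimes>\<^bsub>presented_group X R\<^esub> word_equiv X R `` {v} =
    word_equiv X R `` {u @ v}"
proof -
  have "(\<lambda>u v. word_equiv X R `` {u @ v}) respects2 word_equiv X R"
    by (intro congruent2I' equiv_class_eq[OF equiv_word_equiv])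
      (auto simp: word_equiv_def intro: word_cong.append)
  from UN_equiv_class2[OF equiv_word_equiv equiv_word_equiv this assms]
  show ?thesis
    by (simp add: presented_group_def)
qed

lemma group_presented_group: "group (presented_group X R)"
proof (rule groupI)
  let ?G = "presented_group X R" and ?c = "\<lambda>u. word_equiv X R `` {u}"
  have car: "carrier ?G = ?c ` words X"
    by (auto simp: presented_group_def quotient_def)
  have one: "\<one>\<^bsub>?G\<^esub> = ?c []"
    by (simp add: presented_group_def)
  have app: "u @ v \<in> words X" if "u \<in> words X" "v \<in> words X" for u v
    using that by (simp add: words_def)
  show "\<one>\<^bsub>?G\<^esub> \<in> carrier ?G"
    by (auto simp: car one words_def)
  fix P assume "P \<in> carrier ?G"
  then obtain u where u: "u \<in> words X" "P = ?c u" by (auto simp: car)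
  show "\<one>\<^bsub>?G\<^esub> \<otimes>\<^bsub>?G\<^esub> P = P"
    using u by (simp add: one mult_presented_group words_def)
  have "\<exists>w\<in>words X. word_cong X R (w @ u) []"
    using u(1)
  proof (induction u)
    case Nil
    show ?case by (rule bexI[of _ "[]"]) (auto simp: words_def intro: word_cong.refl)
  next
    case (Cons a u)
    obtain g b where a: "a = (g, b)" "g \<in> X" "u \<in> words X"
      using Cons.prems by (cases a) (auto simp: words_def)
    obtain w where w: "w \<in> words X" "word_cong X R (w @ u) []"
      using Cons.IH a by blast
    have "word_cong X R [(g, \<not> b), (g, b)] []"
      using word_cong.cancel[of g X R "\<not> b"] a by simp
    then have "word_cong X R (w @ [(g, \<not> b), (g, b)] @ u) (w @ [] @ u)"
      using w a by (intro word_cong.append word_cong.refl)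
    then have "word_cong X R ((w @ [(g, \<not> b)]) @ a # u) []"
      using w a word_cong.trans[of X R "w @ [(g, \<not> b), (g, b)] @ u" "w @ u" "[]"] by simp
    moreover have "w @ [(g, \<not> b)] \<in> words X"
      using w a by (auto simp: words_def)
    ultimately show ?case by blast
  qed
  then obtain w where w: "w \<in> words X" "word_cong X R (w @ u) []" by blast
  then have "?c (w @ u) = ?c []"
    by (intro equiv_class_eq[OF equiv_word_equiv]) (simp add: word_equiv_def)
  then show "\<exists>Q\<in>carrier ?G. Q \<otimes>\<^bsub>?G\<^esub> P = \<one>\<^bsub>?G\<^esub>"
    using w u by (auto simp: car one mult_presented_group)
  fix Q assume "Q \<in> carrier ?G"
  then obtain v where v: "v \<in> words X" "Q = ?c v" by (auto simp: car)
  show "P \<otimes>\<^bsub>?G\<^esub> Q \<in> carrier ?G"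
    using u v by (auto simp: car mult_presented_group app)
  fix Q' assume "Q' \<in> carrier ?G"
  then obtain v' where "v' \<in> words X" "Q' = ?c v'" by (auto simp: car)
  then show "P \<otimes>\<^bsub>?G\<^esub> Q \<otimes>\<^bsub>?G\<^esub> Q' = P \<otimes>\<^bsub>?G\<^esub> (Q \<otimes>\<^bsub>?G\<^esub> Q')"
    using u v by (simp add: mult_presented_group app)
qed

text \<open>The one-letter word consisting of the generator \<open>y\<^bsub>A,B\<^esub>\<close>.\<close>

definition gen :: "'a \<Rightarrow> 'a \<Rightarrow> ('a \<times> 'a) word" where
  "gen A B = [((A, B), True)]"

end

theory Submission
  imports Defs
begin

text \<open>
  Sending the point of a cube \<open>(A, S)\<close> with coordinates \<open>x\<close> to the edge weights
  \<open>e \<mapsto> x s\<close> (for \<open>e \<in> s - A\<close>), \<open>e \<mapsto> 1 - x s\<close> (for \<open>e \<in> s \<inter> A\<close>) and the indicator of \<open>A\<close> off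
  \<open>\<Union>S\<close> embeds the dimer complex into \<open>\<real>\<^sup>E\<close>. The image is the set \<open>K\<close> of fractional perfect matchings
  whose support lies in the union of two dimer coverings, a union of convex cells. The stars
  \<open>{a \<in> K. a > 0 on A}\<close> of the dimer coverings form an open cover of \<open>K\<close> in which three stars meet only
  if the triple is flat, and three dimer coverings lie in a common cell if they form a flat triple.
  Hence the elements \<open>y A B\<close> of the presented group are a cocycle on the cover, transport along
  loops with respect to it is homotopy invariant, and it inverts the map that sends a word to the
  corresponding loop of straight edges between dimer coverings. Every loop is homotopic to such an
  edge loop since stars contract linearly onto their centres.
\<close>

section \<open>Transport along paths\<close>

text \<open>The cell structure of the quotient is not analysed. Since \<Gamma> is finite, the dimer
  complex is the image of finitely many closed cubes, hence compact, and a continuous injection into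
  a Hausdorff space is already an embedding. The delicate point is injectivity: on the whole cubed
  complex the edge weights lose information, for at the centre of a cube over one cycle all edges of
  the cycle weigh 1/2, whatever the base \<open>A\<close> is there. In cubes whose vertices are
  dimer coverings \<open>A\<close> alternates along every cycle, so the weights leave only
  \<open>A\<close> and its flip, which the gluing identifies. Flatness of three dimer coverings is
  the same as being contained in the union of two. One direction makes the generators a cocycle, the
  other fills the triangle of the three coverings inside a convex cell. The generator of
  \<open>(A, B)\<close> is realised by the loop with vertices
  \<open>A\<^sub>0, A, B, A\<^sub>0\<close>. For \<open>A = A\<^sub>0\<close> this loop only goes
  forth and back, which explains the second family of relations. Arguments along paths and
  homotopies use connectedness of the interval in place of subdivisions.\<close>

lemma interval_induct:
  fixes a b :: real
  assumes "P a" "t \<in> {a..b}"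
    and step: "\<And>t. t \<in> {a..b} \<Longrightarrow>
      \<exists>e>0. \<forall>x\<in>{a..b}. \<forall>y\<in>{a..b}. \<bar>x - t\<bar> < e \<longrightarrow> \<bar>y - t\<bar> < e \<longrightarrow> P x \<longrightarrow> P y"
  shows "P t"
\<comment> \<open>\<open>P\<close> is passed between any two points near \<open>t\<close>, in both
  directions and without knowing \<open>P t\<close>. So \<open>P\<close> is locally constant, and
  connectedness of the interval applies.\<close>
proof (rule connected_induction_simple[of "{a..b}" a t P])
  fix t assume "t \<in> {a..b}"
  then obtain e where e: "e > 0"
    "\<forall>x\<in>{a..b}. \<forall>y\<in>{a..b}. \<bar>x - t\<bar> < e \<longrightarrow> \<bar>y - t\<bar> < e \<longrightarrow> P x \<longrightarrow> P y"
    using step by blast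
  show "\<exists>T. openin (top_of_set {a..b}) T \<and> t \<in> T \<and> (\<forall>x\<in>T. \<forall>y\<in>T. P x \<longrightarrow> P y)"
    using e \<open>t \<in> {a..b}\<close>
    by (intro exI[of _ "{a..b} \<inter> ball t e"]) (auto simp: dist_real_def abs_minus_commute)
qed (use assms in auto)

text \<open>A Cech cocycle with values in a possibly non-abelian discrete group:
  \<open>c A B\<close> is one element for each pair of charts, not a function on the overlap. The
  bundle it defines is therefore flat, and transport in it depends only on the homotopy class of a
  path.\<close>

locale open_cocycle = group G for G :: "('g, 'm) monoid_scheme" (structure) +
  fixes K :: "'a::topological_space set"
    and D :: "'d set"
    and U :: "'d \<Rightarrow> 'a set"
    and c :: "'d \<Rightarrow> 'd \<Rightarrow> 'g"
  assumes cover: "x \<in> K \<Longrightarrow> \<exists>A\<in>D. x \<in> U A"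
    and open_U: "A \<in> D \<Longrightarrow> openin (top_of_set K) (U A)"
    and c_closed [simp]: "A \<in> D \<Longrightarrow> B \<in> D \<Longrightarrow> c A B \<in> carrier G"
    and c_mult: "\<lbrakk>A \<in> D; B \<in> D; C \<in> D; x \<in> U A; x \<in> U B; x \<in> U C\<rbrakk> \<Longrightarrow> c A B \<otimes> c B C = c A C"
begin

lemma c_self: "A \<in> D \<Longrightarrow> x \<in> U A \<Longrightarrow> c A A = \<one>"
  using c_mult[of A A A x] by (metis c_closed l_cancel_one')

lemma U_nbhd:
  fixes t :: "'t::metric_space"
  assumes "continuous_on S p" "p ` S \<subseteq> K" "t \<in> S" "A \<in> D" "p t \<in> U A"
  shows "\<exists>e>0. \<forall>s\<in>S. dist s t < e \<longrightarrow> p s \<in> U A"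
proof -
  have "openin (top_of_set S) (S \<inter> p -` U A)"
    using continuous_openin_preimage[of S p K "U A"] assms open_U by auto
  then show ?thesis
    using assms unfolding openin_euclidean_subtopology_iff by (simp add: subset_eq)
qed

text \<open>
  A section over a path of the principal bundle with transition functions \<^term>\<open>c\<close>;
  \<^term>\<open>L t A\<close> is its value at time \<^term>\<open>t\<close> in the chart \<^term>\<open>A\<close>.
\<close>

definition is_lift :: "(real \<Rightarrow> 'a) \<Rightarrow> real \<Rightarrow> real \<Rightarrow> (real \<Rightarrow> 'd \<Rightarrow> 'g) \<Rightarrow> bool" where
  "is_lift p a b L \<longleftrightarrow>
     (\<forall>t\<in>{a..b}. \<forall>A\<in>D. p t \<in> U A \<longrightarrow> L t A \<in> carrier G \<and>
        (\<forall>B\<in>D. p t \<in> U B \<longrightarrow> L t B = L t A \<otimes> c A B) \<and>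
        (\<exists>e>0. \<forall>s\<in>{a..b}. \<bar>s - t\<bar> < e \<longrightarrow> p s \<in> U A \<longrightarrow> L s A = L t A))"

lemma is_liftD:
  assumes "is_lift p a b L" "t \<in> {a..b}" "A \<in> D" "p t \<in> U A"
  shows "L t A \<in> carrier G"
    and "B \<in> D \<Longrightarrow> p t \<in> U B \<Longrightarrow> L t B = L t A \<otimes> c A B"
    and "\<exists>e>0. \<forall>s\<in>{a..b}. \<bar>s - t\<bar> < e \<longrightarrow> p s \<in> U A \<longrightarrow> L s A = L t A"
  using assms unfolding is_lift_def by blast+

text \<open>A relation that carries its side conditions, above all that the ends of the path lie in
  the charts \<open>A\<close> and \<open>B\<close>. Charts change by multiplication on the right, so
  that transports along consecutive paths multiply in the order of the paths.\<close>

definition transport ::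
    "(real \<Rightarrow> 'a) \<Rightarrow> real \<Rightarrow> real \<Rightarrow> 'd \<Rightarrow> 'd \<Rightarrow> 'g \<Rightarrow> bool" where
  "transport p a b A B g \<longleftrightarrow>
     a \<le> b \<and> A \<in> D \<and> B \<in> D \<and> p a \<in> U A \<and> p b \<in> U B \<and> continuous_on {a..b} p \<and> p ` {a..b} \<subseteq> K \<and>
     (\<exists>L. is_lift p a b L \<and> L a A = \<one> \<and> L b B = g)"

lemma is_lift_subset:
  assumes "is_lift p a b L" "{x..y} \<subseteq> {a..b}"
  shows "is_lift p x y L"
  unfolding is_lift_def
proof (intro ballI impI)
  fix t A assume t: "t \<in> {x..y}" "A \<in> D" "p t \<in> U A"
  then have "t \<in> {a..b}" using assms(2) by blast
  note D = is_liftD[OF assms(1) this t(2,3)]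
  show "L t A \<in> carrier G \<and> (\<forall>B\<in>D. p t \<in> U B \<longrightarrow> L t B = L t A \<otimes> c A B) \<and>
      (\<exists>e>0. \<forall>s\<in>{x..y}. \<bar>s - t\<bar> < e \<longrightarrow> p s \<in> U A \<longrightarrow> L s A = L t A)"
    using D(1,2) D(3) assms(2) by (meson subsetD)
qed

lemma transportI:
  assumes "a \<le> b" "A \<in> D" "B \<in> D" "p a \<in> U A" "p b \<in> U B"
    and "continuous_on {a..b} p" "p ` {a..b} \<subseteq> K"
    and "is_lift p a b L" "L a A = \<one>" "L b B = g"
  shows "transport p a b A B g"
  using assms unfolding transport_def by blast

text \<open>Lifts that agree in one chart at some time agree there in all charts, since both change
  by the same \<open>c\<close>. Near \<open>t\<close> both are constant in a fixed chart around
  \<open>p t\<close>, so agreement spreads from any nearby time to any other.\<close>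

lemma is_lift_unique:
  assumes L: "is_lift p a b L" and M: "is_lift p a b M"
    and p: "continuous_on {a..b} p" "p ` {a..b} \<subseteq> K"
    and A: "A \<in> D" "p a \<in> U A" "L a A = M a A" and "t \<in> {a..b}"
  shows "\<forall>B\<in>D. p t \<in> U B \<longrightarrow> L t B = M t B"
  using _ \<open>t \<in> {a..b}\<close>
proof (rule interval_induct[where P = "\<lambda>t. \<forall>B\<in>D. p t \<in> U B \<longrightarrow> L t B = M t B"])
  have "a \<in> {a..b}" using \<open>t \<in> {a..b}\<close> by auto
  then show "\<forall>B\<in>D. p a \<in> U B \<longrightarrow> L a B = M a B"
    using is_liftD(2)[OF L _ A(1,2)] is_liftD(2)[OF M _ A(1,2)] A(3) by simp
  fix t assume t: "t \<in> {a..b}"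
  then obtain A where A: "A \<in> D" "p t \<in> U A" using cover p by blast
  obtain e1 where e1: "e1 > 0" "\<forall>s\<in>{a..b}. \<bar>s - t\<bar> < e1 \<longrightarrow> p s \<in> U A \<longrightarrow> L s A = L t A"
    using is_liftD(3)[OF L t A] by blast
  obtain e2 where e2: "e2 > 0" "\<forall>s\<in>{a..b}. \<bar>s - t\<bar> < e2 \<longrightarrow> p s \<in> U A \<longrightarrow> M s A = M t A"
    using is_liftD(3)[OF M t A] by blast
  obtain e3 where e3: "e3 > 0" "\<forall>s\<in>{a..b}. \<bar>s - t\<bar> < e3 \<longrightarrow> p s \<in> U A"
    using U_nbhd[OF p t A] by (auto simp: dist_real_def)
  let ?e = "min e1 (min e2 e3)"
  show "\<exists>e>0. \<forall>x\<in>{a..b}. \<forall>y\<in>{a..b}. \<bar>x - t\<bar> < e \<longrightarrow> \<bar>y - t\<bar> < e \<longrightarrow>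
      (\<forall>B\<in>D. p x \<in> U B \<longrightarrow> L x B = M x B) \<longrightarrow> (\<forall>B\<in>D. p y \<in> U B \<longrightarrow> L y B = M y B)"
  proof (intro exI[of _ ?e] conjI ballI impI)
    fix x y B
    assume *: "x \<in> {a..b}" "y \<in> {a..b}" "\<bar>x - t\<bar> < ?e" "\<bar>y - t\<bar> < ?e"
      "\<forall>B\<in>D. p x \<in> U B \<longrightarrow> L x B = M x B" "B \<in> D" "p y \<in> U B"
    have U: "p x \<in> U A" "p y \<in> U A" using * e3 by auto
    have "L y A = L t A" using * e1 U by auto
    also have "\<dots> = L x A" using * e1 U by auto
    also have "\<dots> = M x A" using * U A by auto
    also have "\<dots> = M t A" using * e2 U by auto
    also have "\<dots> = M y A" using * e2 U by auto
    finally show "L y B = M y B"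
      using is_liftD(2)[OF L *(2) A(1) U(2) *(6,7)] is_liftD(2)[OF M *(2) A(1) U(2) *(6,7)] by simp
  qed (use e1 e2 e3 in auto)
qed

lemma transport_unique:
  assumes "transport p a b A B g" "transport p a b A B h"
  shows "g = h"
  using assms is_lift_unique[where t = b] unfolding transport_def by force

lemma transport_closed: "transport p a b A B g \<Longrightarrow> g \<in> carrier G"
  unfolding transport_def by (metis is_liftD(1) atLeastAtMost_iff order_refl)

lemma is_lift_const:
  assumes L: "is_lift p a b L" and p: "continuous_on {a..b} p" "p ` {a..b} \<subseteq> K"
    and A: "A \<in> D" "p ` {x..y} \<subseteq> U A" and xy: "a \<le> x" "x \<le> y" "y \<le> b"
  shows "L y A = L x A"
proof (rule interval_induct[where P = "\<lambda>t. L t A = L x A" and a = x and b = y])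
  fix t assume t: "t \<in> {x..y}"
  then obtain e where e: "e > 0" "\<forall>s\<in>{a..b}. \<bar>s - t\<bar> < e \<longrightarrow> p s \<in> U A \<longrightarrow> L s A = L t A"
    using is_liftD(3)[OF L, of t A] A xy by (auto simp: image_subset_iff)
  then have "\<forall>s\<in>{x..y}. \<bar>s - t\<bar> < e \<longrightarrow> L s A = L t A"
    using A xy by auto
  with e show "\<exists>e>0. \<forall>u\<in>{x..y}. \<forall>v\<in>{x..y}. \<bar>u - t\<bar> < e \<longrightarrow> \<bar>v - t\<bar> < e \<longrightarrow>
      L u A = L x A \<longrightarrow> L v A = L x A" by metis
qed (use xy in auto)

text \<open>As long as the path stays in the chart \<open>C\<close>, the lift is constant there. The
  only contributions are the change from \<open>A\<close> to \<open>C\<close> at the start and from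
  \<open>C\<close> to \<open>B\<close> at the end.\<close>

lemma transport_chart:
  assumes "a \<le> b" "p ` {a..b} \<subseteq> U C" "p ` {a..b} \<subseteq> K" "continuous_on {a..b} p"
    and D: "A \<in> D" "B \<in> D" "C \<in> D" and U: "p a \<in> U A" "p b \<in> U B"
  shows "transport p a b A B (c A C \<otimes> c C B)"
proof -
  let ?L = "\<lambda>t X. c A C \<otimes> c C X"
  have "is_lift p a b ?L"
    unfolding is_lift_def
  proof (intro ballI impI conjI)
    fix t X Y assume "t \<in> {a..b}" "X \<in> D" "p t \<in> U X" "Y \<in> D" "p t \<in> U Y"
    then show "?L t Y = ?L t X \<otimes> c X Y"
      using c_mult[of C X Y "p t"] assms by (auto simp: m_assoc image_subset_iff)
  qed (use D in \<open>auto intro: exI[of _ 1]\<close>)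
  moreover have "c A C \<otimes> c C A = \<one>"
    using c_mult[of A C A "p a"] c_self[of A "p a"] assms by (auto simp: image_subset_iff)
  ultimately show ?thesis
    using assms unfolding transport_def by (auto intro!: exI[of _ ?L])
qed

lemma transport_chart_left:
  assumes "a \<le> b" "p ` {a..b} \<subseteq> U A" "p ` {a..b} \<subseteq> K" "continuous_on {a..b} p"
    and "A \<in> D" "B \<in> D" "p b \<in> U B"
  shows "transport p a b A B (c A B)"
  using transport_chart[of a b p A A B] assms c_self[of A "p a"] by (auto simp: image_subset_iff)

lemma transport_chart_right:
  assumes "a \<le> b" "p ` {a..b} \<subseteq> U B" "p ` {a..b} \<subseteq> K" "continuous_on {a..b} p"
    and "A \<in> D" "B \<in> D" "p a \<in> U A"
  shows "transport p a b A B (c A B)"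
  using transport_chart[of a b p B A B] assms c_self[of B "p a"] by (auto simp: image_subset_iff)

text \<open>Multiplication by a constant on the left turns lifts into lifts, and multiplying the
  second lift by \<open>g\<close> makes it continue the first.\<close>

lemma transport_join:
  assumes 1: "transport p a b A B g" and 2: "transport p b d B C h"
  shows "transport p a d A C (g \<otimes> h)"
proof -
  obtain L where L: "is_lift p a b L" "L a A = \<one>" "L b B = g"
    using 1 unfolding transport_def by blast
  obtain M where M: "is_lift p b d M" "M b B = \<one>" "M d C = h"
    using 2 unfolding transport_def by blast
  have ab: "a \<le> b" "b \<le> d" and D: "A \<in> D" "B \<in> D" "C \<in> D" and U: "p a \<in> U A" "p b \<in> U B" "p d \<in> U C"
    using 1 2 unfolding transport_def by auto
  have g: "g \<in> carrier G" using 1 by (rule transport_closed)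
  define N where "N = (\<lambda>t X. if t \<le> b then L t X else g \<otimes> M t X)"
  have Nb: "L b X = g \<otimes> M b X" if "X \<in> D" "p b \<in> U X" for X
    using is_liftD(2)[OF L(1), of b B X] is_liftD(2)[OF M(1), of b B X] that ab D U L M g by simp
  have N2: "N t X = g \<otimes> M t X" if "X \<in> D" "p t \<in> U X" "b \<le> t" for t X
    using Nb that by (auto simp: N_def)
  have "is_lift p a d N"
    unfolding is_lift_def
  proof (intro ballI impI)
    fix t X assume t: "t \<in> {a..d}" and X: "X \<in> D" "p t \<in> U X"
    show "N t X \<in> carrier G \<and> (\<forall>Y\<in>D. p t \<in> U Y \<longrightarrow> N t Y = N t X \<otimes> c X Y) \<and>
        (\<exists>e>0. \<forall>s\<in>{a..d}. \<bar>s - t\<bar> < e \<longrightarrow> p s \<in> U X \<longrightarrow> N s X = N t X)"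
    proof (intro conjI ballI impI)
      show "N t X \<in> carrier G"
        using is_liftD(1)[OF L(1) _ X] is_liftD(1)[OF M(1) _ X] t g by (auto simp: N_def)
      show "N t Y = N t X \<otimes> c X Y" if "Y \<in> D" "p t \<in> U Y" for Y
        using is_liftD(2)[OF L(1) _ X that] is_liftD(2)[OF M(1) _ X that]
          is_liftD(1)[OF M(1) _ X] t g X that by (auto simp: N_def m_assoc)
      obtain e1 where e1: "e1 > 0"
        "t \<le> b \<longrightarrow> (\<forall>s\<in>{a..b}. \<bar>s - t\<bar> < e1 \<longrightarrow> p s \<in> U X \<longrightarrow> L s X = L t X)"
        using is_liftD(3)[OF L(1) _ X] t by (metis atLeastAtMost_iff zero_less_one)
      obtain e2 where e2: "e2 > 0"
        "t \<ge> b \<longrightarrow> (\<forall>s\<in>{b..d}. \<bar>s - t\<bar> < e2 \<longrightarrow> p s \<in> U X \<longrightarrow> M s X = M t X)"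
        using is_liftD(3)[OF M(1) _ X] t by (metis atLeastAtMost_iff zero_less_one)
      \<comment> \<open>Away from \<open>b\<close> the radius keeps \<open>s\<close> on the same
        side of \<open>b\<close> as \<open>t\<close>. At \<open>t = b\<close> both formulas for
        \<open>N\<close> hold by \<open>N2\<close>, so either side is allowed.\<close>
      define e where "e = (if t = b then min e1 e2 else min (min e1 e2) \<bar>t - b\<bar>)"
      show "\<exists>e>0. \<forall>s\<in>{a..d}. \<bar>s - t\<bar> < e \<longrightarrow> p s \<in> U X \<longrightarrow> N s X = N t X"
      proof (intro exI[of _ e] conjI ballI impI)
        show "e > 0" using e1 e2 by (auto simp: e_def)
        fix s assume s: "s \<in> {a..d}" "\<bar>s - t\<bar> < e" "p s \<in> U X"
        have less: "\<bar>s - t\<bar> < e1" "\<bar>s - t\<bar> < e2" using s(2) by (auto simp: e_def split: if_splits)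
        consider "s \<le> b" "t \<le> b" | "b \<le> s" "b \<le> t"
          using s(2) by (fastforce simp: e_def split: if_splits)
        then show "N s X = N t X"
        proof cases
          case 1
          then show ?thesis using e1 less s by (auto simp: N_def)
        next
          case 2
          then show ?thesis using e2 less s X by (auto simp: N2)
        qed
      qed
    qed
  qed
  moreover have "N a A = \<one>" "N d C = g \<otimes> h"
    using ab L M N2[of C d] D U by (auto simp: N_def)
  moreover have "{a..d} = {a..b} \<union> {b..d}" using ab by auto
  ultimately show ?thesis
    using 1 2 ab unfolding transport_def
    by (auto intro!: exI[of _ N] continuous_on_closed_Un)
qed

text \<open>Runs time backwards from \<open>x\<close> to \<open>y\<close>. It is needed because
  \<open>interval_induct\<close> asks for both directions.\<close>

lemma transport_cut:
  assumes 1: "transport p a x A B g" and xy: "a \<le> y" "y \<le> x" and C: "C \<in> D" "p ` {y..x} \<subseteq> U C"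
  shows "transport p a y A C (g \<otimes> c B C)"
proof -
  obtain L where L: "is_lift p a x L" "L a A = \<one>" "L x B = g"
    using 1 unfolding transport_def by blast
  have p: "continuous_on {a..x} p" "p ` {a..x} \<subseteq> K" "a \<le> x" "A \<in> D" "B \<in> D" "p a \<in> U A" "p x \<in> U B"
    using 1 unfolding transport_def by auto
  have U: "p x \<in> U C" "p y \<in> U C" using C xy by auto
  have "L x C = L y C" using is_lift_const[OF L(1) p(1,2) C] xy by auto
  then have "L y C = g \<otimes> c B C"
    using is_liftD(2)[OF L(1), of x B C] p C U L by auto
  moreover have "is_lift p a y L"
    by (rule is_lift_subset[OF L(1)]) (use xy in auto)
  moreover have "{a..y} \<subseteq> {a..x}" using xy by simp
  then have "continuous_on {a..y} p" "p ` {a..y} \<subseteq> K"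
    using p(1,2) by (blast intro: continuous_on_subset)+
  ultimately show ?thesis
    using p(4,6) U(2) L(2) xy(1) C(1) by (intro transportI[where L = L])
qed

lemma transport_affine:
  assumes 1: "transport p (m * a + n) (m * b + n) A B g" and m: "m > 0"
  shows "transport (\<lambda>t. p (m * t + n)) a b A B g"
proof -
  obtain L where L: "is_lift p (m * a + n) (m * b + n) L" "L (m * a + n) A = \<one>" "L (m * b + n) B = g"
    using 1 unfolding transport_def by blast
  have p: "m * a + n \<le> m * b + n" "A \<in> D" "B \<in> D" "p (m * a + n) \<in> U A" "p (m * b + n) \<in> U B"
    "continuous_on {m * a + n..m * b + n} p" "p ` {m * a + n..m * b + n} \<subseteq> K"
    using 1 unfolding transport_def by auto
  have mem: "m * t + n \<in> {m * a + n..m * b + n}" if "t \<in> {a..b}" for t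
    using that m by (simp add: mult_left_mono)
  have "is_lift (\<lambda>t. p (m * t + n)) a b (\<lambda>t. L (m * t + n))"
    unfolding is_lift_def
  proof (intro ballI impI conjI)
    fix t X assume t: "t \<in> {a..b}" and X: "X \<in> D" "p (m * t + n) \<in> U X"
    note D = is_liftD[OF L(1) mem[OF t] X]
    show "L (m * t + n) X \<in> carrier G" by (fact D)
    show "L (m * t + n) Y = L (m * t + n) X \<otimes> c X Y" if "Y \<in> D" "p (m * t + n) \<in> U Y" for Y
      using D(2) that by blast
    obtain e where e: "e > 0" "\<forall>s\<in>{m * a + n..m * b + n}.
        \<bar>s - (m * t + n)\<bar> < e \<longrightarrow> p s \<in> U X \<longrightarrow> L s X = L (m * t + n) X"
      using D(3) by blast
    show "\<exists>e>0. \<forall>s\<in>{a..b}. \<bar>s - t\<bar> < e \<longrightarrow> p (m * s + n) \<in> U X \<longrightarrow>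
        L (m * s + n) X = L (m * t + n) X"
    proof (intro exI[of _ "e / m"] conjI ballI impI)
      fix s assume s: "s \<in> {a..b}" "\<bar>s - t\<bar> < e / m" "p (m * s + n) \<in> U X"
      have "m * s + n - (m * t + n) = m * (s - t)" by (simp add: algebra_simps)
      then have "\<bar>m * s + n - (m * t + n)\<bar> = m * \<bar>s - t\<bar>"
        using m by (simp only: abs_mult abs_of_pos)
      also have "\<dots> < e" using s(2) m by (simp add: field_simps)
      finally show "L (m * s + n) X = L (m * t + n) X" using e(2) s(1,3) mem by blast
    qed (use e m in auto)
  qed
  moreover have "continuous_on {a..b} (\<lambda>t. p (m * t + n))"
    by (intro continuous_on_compose2[OF p(6)] image_subsetI mem continuous_intros)
  moreover have "(\<lambda>t. p (m * t + n)) ` {a..b} \<subseteq> K"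
    by (intro image_subsetI subsetD[OF p(7)] imageI mem)
  moreover have "a \<le> b" using p(1) m by simp
  ultimately show ?thesis
    using p(2-5) L(2,3) by (intro transportI[where L = "\<lambda>t. L (m * t + n)"])
qed

lemma transport_cong:
  assumes "transport p a b A B g" and pq: "\<And>t. t \<in> {a..b} \<Longrightarrow> p t = q t"
  shows "transport q a b A B g"
proof -
  obtain L where L: "is_lift p a b L" "L a A = \<one>" "L b B = g"
    and p: "a \<le> b" "A \<in> D" "B \<in> D" "p a \<in> U A" "p b \<in> U B"
    "continuous_on {a..b} p" "p ` {a..b} \<subseteq> K"
    using assms(1) unfolding transport_def by blast
  have "is_lift q a b L"
    using L(1) unfolding is_lift_def by (simp only: pq cong: ball_cong)
  moreover have "continuous_on {a..b} q"
    by (rule continuous_on_eq[OF p(6) pq])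
  moreover have "q ` {a..b} \<subseteq> K"
    using p(7) pq by (metis image_cong)
  moreover have "q a \<in> U A" "q b \<in> U B"
    using p(1,4,5) pq[of a] pq[of b] by simp_all
  ultimately show ?thesis
    using p(1-3) L(2,3) by (intro transportI[where L = L])
qed

lemma transport_joinpaths:
  assumes p: "transport p 0 1 A B g" and q: "transport q 0 1 B C h"
    and "pathfinish p = pathstart q"
  shows "transport (p +++ q) 0 1 A C (g \<otimes> h)"
proof (rule transport_join)
  have "transport (\<lambda>t. p (2 * t + 0)) 0 (1/2) A B g"
    by (rule transport_affine) (use p in auto)
  then show "transport (p +++ q) 0 (1/2) A B g"
    by (rule transport_cong) (auto simp: joinpaths_def)
  have "transport (\<lambda>t. q (2 * t + (-1))) (1/2) 1 B C h"
    by (rule transport_affine) (use q in auto)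
  moreover have "q (2 * t + (-1)) = (p +++ q) t" if "t \<in> {1/2..1}" for t
  proof (cases "t = 1/2")
    case True
    show ?thesis using assms(3) unfolding True by (simp add: joinpaths_def pathstart_def pathfinish_def)
  next
    case False
    then show ?thesis using that by (simp add: joinpaths_def)
  qed
  ultimately show "transport (p +++ q) (1/2) 1 B C h"
    by (rule transport_cong)
qed

text \<open>Existence of transport and its local constancy in a family of paths, proved together by
  continuing in the time variable. Near a point \<open>(s, t)\<close> all paths of the family stay
  in one chart, where the continuation contributes the same factor to each of them.\<close>

lemma transport_locally_constant:
  fixes h :: "real \<times> real \<Rightarrow> 'a"
  assumes h: "continuous_on ({0..1} \<times> {0..1}) h" "h ` ({0..1} \<times> {0..1}) \<subseteq> K"
    and A: "A \<in> D" "\<And>s. s \<in> {0..1} \<Longrightarrow> h (s, 0) \<in> U A"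
    and B: "B \<in> D" "\<And>s. s \<in> {0..1} \<Longrightarrow> h (s, 1) \<in> U B"
    and s: "s \<in> {0..1}"
  shows "\<exists>g. \<exists>e>0. \<forall>s'\<in>{0..1}. \<bar>s' - s\<bar> < e \<longrightarrow> transport (\<lambda>t. h (s', t)) 0 1 A B g"
proof -
  \<comment> \<open>The chart \<open>C\<close> and the value \<open>g\<close> come before
    \<open>s'\<close>: they serve all nearby paths at once. \<open>C\<close> may vary with
    \<open>t\<close>, because the paths wander through several charts.\<close>
  define P where "P = (\<lambda>t. \<exists>C\<in>D. \<exists>g. \<exists>e>0. \<forall>s'\<in>{0..1}. \<bar>s' - s\<bar> < e \<longrightarrow>
    transport (\<lambda>t. h (s', t)) 0 t A C g)"
  have cont: "continuous_on {a..b} (\<lambda>t. h (s', t))" if "s' \<in> {0..1}" "0 \<le> a" "b \<le> 1" for s' a b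
    using that by (intro continuous_on_compose2[OF h(1)]) (auto intro!: continuous_intros)
  have img: "(\<lambda>t. h (s', t)) ` {a..b} \<subseteq> K" if "s' \<in> {0..1}" "0 \<le> a" "b \<le> 1" for s' a b
    using that by (intro image_subsetI subsetD[OF h(2)] imageI) auto
  have "transport (\<lambda>t. h (s', t)) 0 0 A A (c A A)" if "s' \<in> {0..1}" for s'
    using cont[OF that, of 0 0] img[OF that, of 0 0] A that by (intro transport_chart_left) auto
  then have P0: "P 0"
    unfolding P_def using A(1) zero_less_one by blast
  have step: "\<exists>e>0. \<forall>x\<in>{0..1}. \<forall>y\<in>{0..1}. \<bar>x - t\<bar> < e \<longrightarrow> \<bar>y - t\<bar> < e \<longrightarrow> P x \<longrightarrow> P y"
    if t: "t \<in> {0..1}" for t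
  proof -
    have st: "(s, t) \<in> {0..1} \<times> {0..1}" using s t by auto
    then obtain C where C: "C \<in> D" "h (s, t) \<in> U C" using cover h by blast
    obtain e where e: "e > 0" "\<forall>z\<in>{0..1} \<times> {0..1}. dist z (s, t) < e \<longrightarrow> h z \<in> U C"
      using U_nbhd[OF h st C] by blast
    have hU: "h (s', t') \<in> U C"
      if "s' \<in> {0..1}" "t' \<in> {0..1}" "\<bar>s' - s\<bar> < e/2" "\<bar>t' - t\<bar> < e/2" for s' t'
    proof -
      have "dist (s', t') (s, t) \<le> \<bar>s' - s\<bar> + \<bar>t' - t\<bar>"
        using sqrt_sum_squares_le_sum_abs[of "s' - s" "t' - t"] by (simp add: dist_Pair_Pair dist_real_def)
      then show ?thesis using e that by auto
    qed
    have Py: "P y" if x: "x \<in> {0..1}" "\<bar>x - t\<bar> < e/2" and y: "y \<in> {0..1}" "\<bar>y - t\<bar> < e/2" and P: "P x" for x y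
    proof -
      obtain B g e' where B: "B \<in> D" "e' > 0"
        "\<And>s'. s' \<in> {0..1} \<Longrightarrow> \<bar>s' - s\<bar> < e' \<Longrightarrow> transport (\<lambda>t. h (s', t)) 0 x A B g"
        using P unfolding P_def by blast
      have "transport (\<lambda>t. h (s', t)) 0 y A C (g \<otimes> c B C)"
        if s': "s' \<in> {0..1}" "\<bar>s' - s\<bar> < min e' (e/2)" for s'
      proof (cases "x \<le> y")
        case True
        have *: "h (s', t') \<in> U C" if t': "t' \<in> {x..y}" for t'
        proof (rule hU)
          show "\<bar>t' - t\<bar> < e/2" using t' x(2) y(2) unfolding abs_less_iff by simp
        qed (use t' s' x y in simp_all)
        have "transport (\<lambda>t. h (s', t)) x y B C (c B C)"
        proof (rule transport_chart_right)
          show "(\<lambda>t. h (s', t)) ` {x..y} \<subseteq> U C" using * by blast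
          show "h (s', x) \<in> U B" using B(3)[of s'] s' unfolding transport_def by simp
        qed (use True B C x y s' cont img in auto)
        then show ?thesis by (rule transport_join[rotated]) (use B(3)[of s'] s' in auto)
      next
        case False
        have *: "h (s', t') \<in> U C" if t': "t' \<in> {y..x}" for t'
        proof (rule hU)
          show "\<bar>t' - t\<bar> < e/2" using t' x(2) y(2) unfolding abs_less_iff by simp
        qed (use t' s' x y in simp_all)
        show ?thesis
        proof (rule transport_cut)
          show "transport (\<lambda>t. h (s', t)) 0 x A B g" using B(3)[of s'] s' by auto
          show "(\<lambda>t. h (s', t)) ` {y..x} \<subseteq> U C" using * by blast
        qed (use False C y in auto)
      qed
      then show "P y" unfolding P_def using B(2) C(1) e(1)
        by (intro bexI[of _ C] exI[of _ "g \<otimes> c B C"] exI[of _ "min e' (e/2)"] conjI ballI impI)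
          simp_all
    qed
    have "e/2 > 0" using e(1) by simp
    moreover have "\<forall>x\<in>{0..1}. \<forall>y\<in>{0..1}. \<bar>x - t\<bar> < e/2 \<longrightarrow> \<bar>y - t\<bar> < e/2 \<longrightarrow> P x \<longrightarrow> P y"
      by (intro ballI impI) (rule Py)
    ultimately show ?thesis by (intro exI[of _ "e/2"] conjI)
  qed
  have "P 1"
    by (rule interval_induct[of P 0 1 1, OF P0 _ step]) simp_all
  then obtain C g e where C: "C \<in> D" "e > 0"
    "\<And>s'. s' \<in> {0..1} \<Longrightarrow> \<bar>s' - s\<bar> < e \<Longrightarrow> transport (\<lambda>t. h (s', t)) 0 1 A C g"
    unfolding P_def by blast
  \<comment> \<open>The induction ends in some chart \<open>C\<close>. The change to the prescribed
    chart \<open>B\<close> is a transport over the degenerate interval from 1 to 1.\<close>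
  have "transport (\<lambda>t. h (s', t)) 0 1 A B (g \<otimes> c C B)" if s': "s' \<in> {0..1}" "\<bar>s' - s\<bar> < e" for s'
  proof (rule transport_join)
    show *: "transport (\<lambda>t. h (s', t)) 0 1 A C g" by (rule C(3)[OF s'])
    have "h (s', 1) \<in> U C" using * unfolding transport_def by simp
    moreover have "h (s', 1) \<in> U B" by (rule B(2)[OF s'(1)])
    ultimately show "transport (\<lambda>t. h (s', t)) 1 1 C B (c C B)"
      using cont[OF s'(1), of 1 1] img[OF s'(1), of 1 1] B(1) C(1)
      by (intro transport_chart_right) simp_all
  qed
  with C(2) show ?thesis
    by (intro exI[of _ "g \<otimes> c C B"] exI[of _ e] conjI ballI impI)
qed

text \<open>The ends stay fixed during the homotopy, so the charts \<open>A\<close> and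
  \<open>B\<close> serve all intermediate paths. Their transports are locally constant in the
  homotopy parameter, hence constant.\<close>

lemma transport_homotopic:
  assumes pq: "homotopic_paths K p q" and p: "transport p 0 1 A B g" and q: "transport q 0 1 A B g'"
  shows "g = g'"
proof -
  obtain h :: "real \<times> real \<Rightarrow> 'a" where h: "continuous_on ({0..1} \<times> {0..1}) h" "h \<in> {0..1} \<times> {0..1} \<rightarrow> K"
    "\<forall>t\<in>{0..1}. h (0, t) = p t" "\<forall>t\<in>{0..1}. h (1, t) = q t"
    "\<forall>s\<in>{0..1}. h (s, 0) = p 0 \<and> h (s, 1) = p 1"
    using pq unfolding homotopic_paths pathstart_def pathfinish_def o_def
    by blast
  have AB: "A \<in> D" "B \<in> D" "p 0 \<in> U A" "p 1 \<in> U B" using p unfolding transport_def by auto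
  have hK: "h ` ({0..1} \<times> {0..1}) \<subseteq> K" using h(2) by (simp add: image_subset_iff_funcset)
  have U0: "h (s, 0) \<in> U A" and U1: "h (s, 1) \<in> U B" if "s \<in> {0..1}" for s
    using bspec[OF h(5) that] AB(3,4) by simp_all
  have "transport (\<lambda>t. h (s, t)) 0 1 A B g" if "s \<in> {0..1}" for s
  proof (rule interval_induct[OF _ that])
    show "transport (\<lambda>t. h (0, t)) 0 1 A B g"
      by (rule transport_cong[OF p]) (use h(3) in simp)
    fix s :: real assume s: "s \<in> {0..1}"
    obtain g' e where "e > 0"
      and g': "\<forall>s'\<in>{0..1}. \<bar>s' - s\<bar> < e \<longrightarrow> transport (\<lambda>t. h (s', t)) 0 1 A B g'"
      using transport_locally_constant[OF h(1) hK AB(1) U0 AB(2) U1 s] by blast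
    show "\<exists>e>0. \<forall>x\<in>{0..1}. \<forall>y\<in>{0..1}. \<bar>x - s\<bar> < e \<longrightarrow> \<bar>y - s\<bar> < e \<longrightarrow>
        transport (\<lambda>t. h (x, t)) 0 1 A B g \<longrightarrow> transport (\<lambda>t. h (y, t)) 0 1 A B g"
    proof (intro exI[of _ e] conjI ballI impI)
      fix x y :: real
      assume x: "x \<in> {0..1}" "\<bar>x - s\<bar> < e" "transport (\<lambda>t. h (x, t)) 0 1 A B g"
        and y: "y \<in> {0..1}" "\<bar>y - s\<bar> < e"
      have "g' = g" using g' x transport_unique by blast
      then show "transport (\<lambda>t. h (y, t)) 0 1 A B g" using g' y by blast
    qed (fact \<open>e > 0\<close>)
  qed
  from this[of 1] have "transport q 0 1 A B g"
    by (rule transport_cong) (use h(4) in simp_all)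
  then show ?thesis using q transport_unique by blast
qed

end

text \<open>The values of \<open>p\<close> lie in a mere topological space, so the straight-line
  homotopy is taken in the parameter interval, between the reparametrisations \<open>f\<close> and
  \<open>g\<close>.\<close>

lemma homotopic_paths_compose_real:
  fixes p :: "real \<Rightarrow> 'a::topological_space" and f g :: "real \<Rightarrow> real"
  assumes "path p" "path_image p \<subseteq> S" "path f" "path g"
    and "path_image f \<subseteq> {0..1}" "path_image g \<subseteq> {0..1}"
    and "pathstart g = pathstart f" "pathfinish g = pathfinish f"
  shows "homotopic_paths S (p \<circ> f) (p \<circ> g)"
proof (rule homotopic_paths_continuous_image)
  have "f t \<in> {0..1}" "g t \<in> {0..1}" if "t \<in> {0..1}" for t
    using that assms(5,6) unfolding path_image_def by blast+
  then show "homotopic_paths {0..1} f g"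
    using assms by (intro homotopic_paths_linear) (simp_all add: closed_segment_subset)
qed (use assms in \<open>auto simp: path_def path_image_def\<close>)

lemma homotopic_paths_const_right:
  assumes "path p" "path_image p \<subseteq> S" "x = pathfinish p"
  shows "homotopic_paths S (p +++ (\<lambda>_. x)) p"
proof -
  have "homotopic_paths S (p \<circ> (linepath 0 1 +++ linepath 1 1)) (p \<circ> linepath 0 1)"
    using assms by (intro homotopic_paths_compose_real)
      (auto simp: path_image_join closed_segment_eq_real_ivl)
  moreover have "p \<circ> linepath 0 1 = p" "p \<circ> linepath 1 1 = (\<lambda>_. x)"
    using assms(3) by (auto simp: linepath_def pathfinish_def o_def)
  ultimately show ?thesis by (simp add: path_compose_join)
qed

lemma homotopic_paths_const_left:
  assumes "path p" "path_image p \<subseteq> S" "x = pathstart p"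
  shows "homotopic_paths S ((\<lambda>_. x) +++ p) p"
proof -
  have "homotopic_paths S (p \<circ> (linepath 0 0 +++ linepath 0 1)) (p \<circ> linepath 0 1)"
    using assms by (intro homotopic_paths_compose_real)
      (auto simp: path_image_join closed_segment_eq_real_ivl)
  moreover have "p \<circ> linepath 0 1 = p" "p \<circ> linepath 0 0 = (\<lambda>_. x)"
    using assms(3) by (auto simp: linepath_def pathstart_def o_def)
  ultimately show ?thesis by (simp add: path_compose_join)
qed

section \<open>The matching complex\<close>

locale finite_multigraph =
  fixes \<Gamma> :: "('v, 'e) multigraph"
  assumes finite_graph: "finite_graph \<Gamma>"
begin

abbreviation "V \<equiv> verts \<Gamma>"
abbreviation "E \<equiv> edges \<Gamma>"
abbreviation "D \<equiv> dimer_coverings \<Gamma>"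
abbreviation "edg \<equiv> edge_at \<Gamma>"

lemma finite_V [simp]: "finite V" and finite_E [simp]: "finite E"
  using finite_graph by (auto simp: finite_graph_def)

lemma ends_subset: "e \<in> E \<Longrightarrow> ends \<Gamma> e \<subseteq> V" and card_ends: "e \<in> E \<Longrightarrow> card (ends \<Gamma> e) = 2"
  using finite_graph by (auto simp: finite_graph_def loopless_graph_def)

lemma ex_end: "e \<in> E \<Longrightarrow> \<exists>v\<in>V. v \<in> ends \<Gamma> e"
  using ends_subset[of e] card_ends[of e] by (metis card.empty ex_in_conv subsetD zero_neq_numeral)

lemma dimer_subset: "A \<in> D \<Longrightarrow> A \<subseteq> E"
  by (auto simp: dimer_coverings_def)

lemma edg_eq: "A \<in> D \<Longrightarrow> v \<in> V \<Longrightarrow> e \<in> A \<Longrightarrow> v \<in> ends \<Gamma> e \<Longrightarrow> edg A v = e"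
  unfolding edge_at_def dimer_coverings_def by (intro the1_equality) auto

lemma edg_in: "A \<in> D \<Longrightarrow> v \<in> V \<Longrightarrow> edg A v \<in> A"
  and edg_end: "A \<in> D \<Longrightarrow> v \<in> V \<Longrightarrow> v \<in> ends \<Gamma> (edg A v)"
  using edg_eq unfolding dimer_coverings_def by blast+

lemma dimerI:
  assumes "A \<subseteq> E" "\<And>v. v \<in> V \<Longrightarrow> \<exists>e. {e \<in> A. v \<in> ends \<Gamma> e} = {e}"
  shows "A \<in> D"
  unfolding dimer_coverings_def
proof (intro CollectI conjI ballI)
  fix v assume "v \<in> V"
  then obtain e where "{e \<in> A. v \<in> ends \<Gamma> e} = {e}" using assms(2) by blast
  then have "e' \<in> A \<and> v \<in> ends \<Gamma> e' \<longleftrightarrow> e' = e" for e' by blast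
  then show "\<exists>!e. e \<in> A \<and> v \<in> ends \<Gamma> e" by simp
qed (fact assms(1))

lemma dimer_edges_at: "A \<in> D \<Longrightarrow> v \<in> V \<Longrightarrow> {e \<in> A. v \<in> ends \<Gamma> e} = {edg A v}"
  using edg_eq edg_in edg_end by blast

text \<open>
  The fractional perfect matchings supported on \<^term>\<open>A \<union> B\<close> form the cube with opposite
  vertices \<^term>\<open>A\<close> and \<^term>\<open>B\<close>.
\<close>

definition mspan :: "'e set \<Rightarrow> 'e set \<Rightarrow> ('e \<Rightarrow> real) set" where
  "mspan A B = {a. (\<forall>e. 0 \<le> a e) \<and> (\<forall>e. e \<notin> A \<union> B \<longrightarrow> a e = 0) \<and>
     (\<forall>v\<in>V. (\<Sum>e | e \<in> E \<and> v \<in> ends \<Gamma> e. a e) = 1)}"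

definition matching_complex :: "('e \<Rightarrow> real) set" where
  "matching_complex = (\<Union>A\<in>D. \<Union>B\<in>D. mspan A B)"

definition star :: "'e set \<Rightarrow> ('e \<Rightarrow> real) set" where
  "star A = {a \<in> matching_complex. \<forall>e\<in>A. 0 < a e}"

definition seg :: "('e \<Rightarrow> real) \<Rightarrow> ('e \<Rightarrow> real) \<Rightarrow> real \<Rightarrow> 'e \<Rightarrow> real" where
  "seg x y = (\<lambda>s e. (1 - s) * x e + s * y e)"

lemma seg_span:
  assumes "x \<in> mspan A B" "y \<in> mspan A B" "s \<in> {0..1}"
  shows "seg x y s \<in> mspan A B"
proof -
  have "(\<Sum>e\<in>F. seg x y s e) = (1 - s) * sum x F + s * sum y F" for F
    by (simp add: seg_def sum.distrib sum_distrib_left)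
  moreover have "0 \<le> seg x y s e" if "0 \<le> x e" "0 \<le> y e" for e
    using assms(3) that by (simp add: seg_def)
  moreover have "seg x y s e = 0" if "x e = 0" "y e = 0" for e
    using that by (simp add: seg_def)
  ultimately show ?thesis
    using assms(1,2) unfolding mspan_def by simp
qed

lemma span_subset: "A \<in> D \<Longrightarrow> B \<in> D \<Longrightarrow> mspan A B \<subseteq> matching_complex"
  unfolding matching_complex_def by blast

lemma indicator_span:
  assumes "A \<in> D" "A \<subseteq> P \<union> Q"
  shows "indicator A \<in> mspan P Q"
proof -
  have "(\<Sum>e | e \<in> E \<and> v \<in> ends \<Gamma> e. indicator A e :: real) = 1" if v: "v \<in> V" for v
  proof -
    have "(\<Sum>e | e \<in> E \<and> v \<in> ends \<Gamma> e. indicator A e :: real) =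
        card ({e. e \<in> E \<and> v \<in> ends \<Gamma> e} \<inter> A)"
      by (simp add: indicator_def if_distrib sum.If_cases Int_def)
    also have "{e. e \<in> E \<and> v \<in> ends \<Gamma> e} \<inter> A = {edg A v}"
      using dimer_edges_at[OF assms(1) v] dimer_subset[OF assms(1)] by blast
    finally show ?thesis by simp
  qed
  moreover have "indicator A e = (0::real)" if "e \<notin> P \<union> Q" for e
    using that assms(2) by (simp add: indicator_def) blast
  ultimately show ?thesis unfolding mspan_def by simp
qed

text \<open>Only the edges of \<open>P\<close> and \<open>Q\<close> at \<open>v\<close> can carry
  weight, so a point of the cell has at most one degree of freedom at each vertex.\<close>

lemma span_vertex_sum:
  assumes a: "a \<in> mspan P Q" and PQ: "P \<in> D" "Q \<in> D" and v: "v \<in> V"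
  shows "edg P v \<noteq> edg Q v \<Longrightarrow> a (edg P v) + a (edg Q v) = 1"
    and "edg P v = edg Q v \<Longrightarrow> a (edg P v) = 1"
proof -
  have "(\<Sum>e | e \<in> E \<and> v \<in> ends \<Gamma> e. a e) = (\<Sum>e\<in>{edg P v, edg Q v}. a e)"
  proof (rule sum.mono_neutral_right)
    show "{edg P v, edg Q v} \<subseteq> {e \<in> E. v \<in> ends \<Gamma> e}"
      using PQ v edg_in edg_end dimer_subset by blast
    show "\<forall>e\<in>{e \<in> E. v \<in> ends \<Gamma> e} - {edg P v, edg Q v}. a e = 0"
      using a edg_eq[OF PQ(1) v] edg_eq[OF PQ(2) v] unfolding mspan_def by blast
  qed simp
  then have 1: "(\<Sum>e\<in>{edg P v, edg Q v}. a e) = 1" using a v unfolding mspan_def by simp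
  from 1 show "edg P v \<noteq> edg Q v \<Longrightarrow> a (edg P v) + a (edg Q v) = 1" by simp
  from 1 show "edg P v = edg Q v \<Longrightarrow> a (edg P v) = 1" by simp
qed

section \<open>Stars, flat triples and common cells\<close>

lemma star_cover:
  assumes "a \<in> matching_complex"
  shows "\<exists>C\<in>D. a \<in> star C"
proof -
  obtain A B where AB: "A \<in> D" "B \<in> D" and a: "a \<in> mspan A B"
    using assms unfolding matching_complex_def by blast
  \<comment> \<open>Take the edge of \<open>A\<close> wherever it has positive weight. Where it has
    none, the edge of \<open>B\<close> at that vertex has weight 1. The choice refers to edges and
    not to vertices, so it is consistent at both ends of an edge.\<close>
  define C where "C = {e \<in> A. a e > 0} \<union> {e \<in> B. a e = 1}"
  have "C \<in> D"
  proof (rule dimerI)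
    show "C \<subseteq> E" using AB dimer_subset unfolding C_def by blast
    fix v assume v: "v \<in> V"
    have C: "{e \<in> C. v \<in> ends \<Gamma> e} =
        (if a (edg A v) > 0 then {edg A v} else {}) \<union> (if a (edg B v) = 1 then {edg B v} else {})"
      (is "?L = ?R")
    proof -
      have "?L = {e \<in> {e \<in> A. v \<in> ends \<Gamma> e}. a e > 0} \<union> {e \<in> {e \<in> B. v \<in> ends \<Gamma> e}. a e = 1}"
        unfolding C_def by blast
      also have "\<dots> = ?R"
        unfolding dimer_edges_at[OF AB(1) v] dimer_edges_at[OF AB(2) v] by auto
      finally show ?thesis .
    qed
    have "a (edg A v) \<ge> 0" using a by (simp add: mspan_def)
    then show "\<exists>e. {e \<in> C. v \<in> ends \<Gamma> e} = {e}"
      using span_vertex_sum[OF a AB v] unfolding C by (cases "edg A v = edg B v") auto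
  qed
  moreover have "0 < a e" if "e \<in> C" for e
    using that unfolding C_def by auto
  ultimately show ?thesis using assms unfolding star_def by blast
qed

lemma star_span: "a \<in> star A \<Longrightarrow> a \<in> mspan P Q \<Longrightarrow> A \<subseteq> P \<union> Q"
  unfolding star_def mspan_def by (metis (mono_tags, lifting) mem_Collect_eq order_less_irrefl subsetI)

text \<open>Pigeonhole: at each vertex the three edges are chosen among the two edges of
  \<open>P\<close> and \<open>Q\<close>.\<close>

lemma flat_subset:
  assumes "A \<in> D" "B \<in> D" "C \<in> D" "P \<in> D" "Q \<in> D" "A \<union> B \<union> C \<subseteq> P \<union> Q"
  shows "flat \<Gamma> A B C"
  unfolding flat_def
proof
  fix v assume v: "v \<in> V"
  have "edg X v = edg P v \<or> edg X v = edg Q v" if "X \<in> D" "X \<subseteq> P \<union> Q" for X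
    using edg_eq[OF assms(4) v, of "edg X v"] edg_eq[OF assms(5) v, of "edg X v"] edg_in[OF that(1) v]
      edg_end[OF that(1) v] that(2) by (metis Un_iff subsetD)
  then have "edg A v = edg P v \<or> edg A v = edg Q v" "edg B v = edg P v \<or> edg B v = edg Q v"
    "edg C v = edg P v \<or> edg C v = edg Q v"
    using assms by simp_all
  then show "edg A v = edg B v \<or> edg B v = edg C v \<or> edg A v = edg C v" by metis
qed

lemma star_flat:
  assumes "A \<in> D" "B \<in> D" "C \<in> D" "a \<in> star A" "a \<in> star B" "a \<in> star C"
  shows "flat \<Gamma> A B C"
proof -
  obtain P Q where "P \<in> D" "Q \<in> D" "a \<in> mspan P Q"
    using assms(4) unfolding star_def matching_complex_def by blast
  then show ?thesis using assms star_span[of a] by (intro flat_subset[of _ _ _ P Q]) blast+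
qed

lemma flat_common_span:
  assumes D: "A \<in> D" "B \<in> D" "C \<in> D" and "flat \<Gamma> A B C"
  shows "\<exists>P\<in>D. \<exists>Q\<in>D. A \<union> B \<union> C \<subseteq> P \<union> Q"
proof -
  \<comment> \<open>With \<open>P = A\<close>, the covering \<open>Q\<close> has to supply at each
    vertex the value among the edges of \<open>B\<close> and \<open>C\<close> that differs from the
    edge of \<open>A\<close>. Flatness says that there is at most one such value. If there is none,
    all three edges agree and \<open>Q\<close> takes the common one.\<close>
  define Q where "Q = ((B \<union> C) - A) \<union> (A \<inter> B \<inter> C)"
  have "Q \<in> D"
  proof (rule dimerI)
    show "Q \<subseteq> E" using D dimer_subset unfolding Q_def by blast
    fix v assume v: "v \<in> V"
    have mem: "edg X v \<in> Y \<longleftrightarrow> edg X v = edg Y v" if "X \<in> D" "Y \<in> D" for X Y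
      using edg_eq[OF that(2) v] edg_in[OF that(2) v] edg_end[OF that(1) v] by metis
    have "{e \<in> Q. v \<in> ends \<Gamma> e} =
        ({e \<in> B. v \<in> ends \<Gamma> e} \<union> {e \<in> C. v \<in> ends \<Gamma> e} - {e \<in> A. v \<in> ends \<Gamma> e}) \<union>
        ({e \<in> A. v \<in> ends \<Gamma> e} \<inter> {e \<in> B. v \<in> ends \<Gamma> e} \<inter> {e \<in> C. v \<in> ends \<Gamma> e})"
      unfolding Q_def by blast
    also have "\<dots> = ({edg B v, edg C v} - {edg A v}) \<union> ({edg A v} \<inter> {edg B v} \<inter> {edg C v})"
      unfolding dimer_edges_at[OF D(1) v] dimer_edges_at[OF D(2) v] dimer_edges_at[OF D(3) v] by auto
    finally have "{e \<in> Q. v \<in> ends \<Gamma> e} =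
        ({edg B v, edg C v} - {edg A v}) \<union> ({edg A v} \<inter> {edg B v} \<inter> {edg C v})" .
    moreover have "edg A v = edg B v \<or> edg B v = edg C v \<or> edg A v = edg C v"
      using assms(4) v unfolding flat_def by blast
    ultimately show "\<exists>e. {e \<in> Q. v \<in> ends \<Gamma> e} = {e}"
      by (cases "edg A v = edg B v"; cases "edg A v = edg C v") auto
  qed
  moreover have "A \<union> B \<union> C \<subseteq> A \<union> Q" unfolding Q_def by blast
  ultimately show ?thesis using D(1) by blast
qed

lemma star_open: "A \<in> D \<Longrightarrow> openin (top_of_set matching_complex) (star A)"
proof -
  assume A: "A \<in> D"
  have "finite A" using dimer_subset[OF A] finite_E finite_subset by blast
  moreover have "open {a :: 'e \<Rightarrow> real. 0 < a e}" for e
    by (intro open_Collect_less continuous_on_const continuous_on_product_coordinates)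
  ultimately have "open (\<Inter>e\<in>A. {a :: 'e \<Rightarrow> real. 0 < a e})" by (intro open_INT) auto
  moreover have "star A = matching_complex \<inter> (\<Inter>e\<in>A. {a. 0 < a e})" unfolding star_def by blast
  ultimately show ?thesis by (auto simp: openin_open)
qed

lemma indicator_complex: "A \<in> D \<Longrightarrow> indicator A \<in> matching_complex"
  using indicator_span[of A A A] span_subset[of A A] by blast

text \<open>A dimer covering contained in another one equals it, since every edge has an end that
  the smaller covering must cover. Thus the centre of a star lies in no other star, which later
  fixes the chart at the end of a loop.\<close>

lemma indicator_star_iff:
  assumes "A \<in> D" "B \<in> D"
  shows "indicator A \<in> star B \<longleftrightarrow> A = B"
proof
  assume "indicator A \<in> star B"
  then have "B \<subseteq> A" unfolding star_def by (auto simp: indicator_def split: if_splits)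
  moreover have "A \<subseteq> B"
  proof
    fix e assume e: "e \<in> A"
    then obtain v where v: "v \<in> V" "v \<in> ends \<Gamma> e" using ex_end dimer_subset[OF assms(1)] by blast
    then have "edg B v = e"
      using edg_eq[OF assms(1) v(1)] e v(2) edg_in[OF assms(2) v(1)] edg_end[OF assms(2) v(1)] \<open>B \<subseteq> A\<close>
      by (metis subsetD)
    then show "e \<in> B" using edg_in[OF assms(2) v(1)] by simp
  qed
  ultimately show "A = B" by blast
qed (use indicator_complex[OF assms(1)] in \<open>auto simp: star_def\<close>)

section \<open>Segments and homotopies inside cells\<close>

lemma pathstart_seg [simp]: "pathstart (seg x y) = x"
  and pathfinish_seg [simp]: "pathfinish (seg x y) = y"
  by (auto simp: seg_def pathstart_def pathfinish_def)

lemma path_seg [simp]: "path (seg x y)"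
  unfolding path_def seg_def
  by (intro continuous_on_coordinatewise_then_product continuous_intros)

lemma path_image_seg:
  "x \<in> mspan A B \<Longrightarrow> y \<in> mspan A B \<Longrightarrow> path_image (seg x y) \<subseteq> mspan A B"
  unfolding path_image_def using seg_span by blast

text \<open>The straight-line homotopy stays in the complex as soon as the two points at equal times
  share a convex cell. The cell may change with the time.\<close>

lemma homotopic_paths_span:
  assumes p: "path p" and q: "path q"
    and ends: "pathstart q = pathstart p" "pathfinish q = pathfinish p"
    and common: "\<And>s. s \<in> {0..1} \<Longrightarrow> \<exists>A\<in>D. \<exists>B\<in>D. p s \<in> mspan A B \<and> q s \<in> mspan A B"
  shows "homotopic_paths matching_complex p q"
proof -
  let ?h = "\<lambda>z :: real \<times> real. seg (p (snd z)) (q (snd z)) (fst z)"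
  have C: "continuous_on ({0..1} \<times> {0..1}) (\<lambda>z :: real \<times> real. f (snd z) e)"
    if f: "path f" for f :: "real \<Rightarrow> 'e \<Rightarrow> real" and e
  proof (rule continuous_on_compose2[where g = "\<lambda>t. f t e" and t = "{0..1}"])
    show "continuous_on {0..1} (\<lambda>t. f t e)"
      using f unfolding path_def by (rule continuous_on_product_then_coordinatewise)
    show "continuous_on ({0..1} \<times> {0..1}) (snd :: real \<times> real \<Rightarrow> real)"
      by (rule continuous_on_snd[OF continuous_on_id])
  qed auto
  have "continuous_on ({0..1} \<times> {0..1}) ?h"
    unfolding seg_def
    by (intro continuous_on_coordinatewise_then_product continuous_on_add continuous_on_mult
        continuous_on_diff continuous_on_const continuous_on_fst continuous_on_id C[OF p] C[OF q])
  moreover have "?h z \<in> matching_complex" if "z \<in> {0..1} \<times> {0..1}" for z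
  proof -
    have "snd z \<in> {0..1}" "fst z \<in> {0..1}" using that unfolding mem_Times_iff by blast+
    with common[of "snd z"] obtain A B where "A \<in> D" "B \<in> D"
      "p (snd z) \<in> mspan A B" "q (snd z) \<in> mspan A B" by blast
    then have "?h z \<in> mspan A B" using seg_span[OF _ _ \<open>fst z \<in> {0..1}\<close>] by blast
    then show ?thesis using span_subset[OF \<open>A \<in> D\<close> \<open>B \<in> D\<close>] by blast
  qed
  ultimately show ?thesis
    unfolding homotopic_paths
  proof (intro exI[of _ ?h] conjI ballI funcsetI)
    fix t :: real assume "t \<in> {0..1}"
    show "pathstart (?h \<circ> Pair t) = pathstart p" "pathfinish (?h \<circ> Pair t) = pathfinish p"
      using ends by (simp_all add: seg_def pathstart_def pathfinish_def fun_eq_iff flip: distrib_right)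
  qed (simp_all add: seg_def)
qed

section \<open>Edge paths\<close>

text \<open>Any two dimer coverings may follow each other, since the segment between them is a
  diagonal of \<open>mspan A B\<close>. A single vertex gives the constant path; the value at
  \<open>[]\<close> is a dummy that the lemmas exclude.\<close>

fun edge_path :: "'e set list \<Rightarrow> real \<Rightarrow> 'e \<Rightarrow> real" where
  "edge_path [] = (\<lambda>_ _. 0)"
| "edge_path [A] = (\<lambda>_. indicator A)"
| "edge_path (A # B # As) = seg (indicator A) (indicator B) +++ edge_path (B # As)"

abbreviation homotopic :: "(real \<Rightarrow> 'e \<Rightarrow> real) \<Rightarrow> (real \<Rightarrow> 'e \<Rightarrow> real) \<Rightarrow> bool" (infix "\<simeq>" 50) where
  "p \<simeq> q \<equiv> homotopic_paths matching_complex p q"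

lemma pathstart_edge_path [simp]: "xs \<noteq> [] \<Longrightarrow> pathstart (edge_path xs) = indicator (hd xs)"
  by (cases xs rule: edge_path.cases) (simp_all add: pathstart_def[of "\<lambda>_. indicator _"])

lemma pathfinish_edge_path [simp]: "xs \<noteq> [] \<Longrightarrow> pathfinish (edge_path xs) = indicator (last xs)"
  by (induction xs rule: edge_path.induct) (simp_all add: pathfinish_def[of "\<lambda>_. indicator _"])

lemma path_image_seg_complex:
  assumes "A \<in> D" "B \<in> D"
  shows "path_image (seg (indicator A) (indicator B)) \<subseteq> matching_complex"
  using path_image_seg[of "indicator A" A B "indicator B"] indicator_span[of A A B]
    indicator_span[of B A B] span_subset[of A B] assms by auto

lemma edge_path:
  assumes "set xs \<subseteq> D" "xs \<noteq> []"
  shows "path (edge_path xs)" "path_image (edge_path xs) \<subseteq> matching_complex"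
  using assms
proof (induction xs rule: edge_path.induct)
  case (2 A)
  { case 1 show ?case by (simp add: path_def) }
  { case 2 then show ?case by (simp add: indicator_complex path_image_def) }
next
  case (3 A B As)
  { case 1 then show ?case using 3 by (simp add: path_join_imp) }
  { case 2 then show ?case
      using 3 path_image_seg_complex[of A B] unfolding edge_path.simps
      by (intro order_trans[OF path_image_join_subset] Un_least) simp_all }
qed simp_all

text \<open>The two lists overlap in the vertex \<open>A\<close>. Equality holds only up to
  homotopy: joining paths is not associative, and for empty \<open>xs\<close> the first factor is a
  constant path.\<close>

lemma edge_path_append:
  assumes "set xs \<subseteq> D" "A \<in> D" "set ys \<subseteq> D"
  shows "edge_path (xs @ [A]) +++ edge_path (A # ys) \<simeq> edge_path (xs @ A # ys)"
  using assms(1)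
proof (induction xs)
  case Nil
  have "pathstart (edge_path (A # ys)) = indicator A" by simp
  then show ?case
    using homotopic_paths_const_left[of "edge_path (A # ys)" matching_complex "indicator A"]
      edge_path[of "A # ys"] assms by simp
next
  case (Cons B xs)
  define C where "C = hd (xs @ [A])"
  obtain zs where zs: "xs @ [A] = C # zs" unfolding C_def by (cases xs) auto
  then have zs': "xs @ A # ys = C # zs @ ys"
    by (metis append.assoc append_Cons append_Nil)
  have C: "C \<in> D" "B \<in> D" "set zs \<subseteq> D"
    using arg_cong[OF zs, of set] Cons.prems assms(2) by auto
  have paths: "path (edge_path (C # zs))" "path_image (edge_path (C # zs)) \<subseteq> matching_complex"
    "path (edge_path (A # ys))" "path_image (edge_path (A # ys)) \<subseteq> matching_complex"
    using edge_path[of "C # zs"] edge_path[of "A # ys"] C assms by simp_all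
  have last: "last (C # zs) = A" using zs by (metis last_snoc)
  let ?s = "seg (indicator B) (indicator C) :: real \<Rightarrow> 'e \<Rightarrow> real"
  have s: "path ?s" "path_image ?s \<subseteq> matching_complex"
    using path_image_seg_complex C by simp_all
  have "(?s +++ edge_path (C # zs)) +++ edge_path (A # ys) \<simeq>
      ?s +++ (edge_path (C # zs) +++ edge_path (A # ys))"
    using paths s last
    by (intro homotopic_paths_sym[OF homotopic_paths_assoc]) (simp_all del: edge_path.simps)
  moreover have "?s +++ (edge_path (C # zs) +++ edge_path (A # ys)) \<simeq> ?s +++ edge_path (C # zs @ ys)"
    using Cons s zs zs' by (intro homotopic_paths_join) (simp_all del: edge_path.simps)
  ultimately have "(?s +++ edge_path (C # zs)) +++ edge_path (A # ys) \<simeq> ?s +++ edge_path (C # zs @ ys)"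
    by (rule homotopic_paths_trans)
  then show ?case by (simp only: append_Cons zs zs' edge_path.simps)
qed

text \<open>Homotopies can be applied inside a longer edge path. Equal last vertices let the tail be
  split off by \<open>edge_path_append\<close>; equal first vertices give both paths the same
  segment in front.\<close>

lemma edge_path_subst:
  assumes "edge_path xs \<simeq> edge_path ys" "hd xs = hd ys" "last xs = last ys" "xs \<noteq> []" "ys \<noteq> []"
    and "set us \<subseteq> D" "set vs \<subseteq> D" "set xs \<subseteq> D" "set ys \<subseteq> D"
  shows "edge_path (us @ xs @ vs) \<simeq> edge_path (us @ ys @ vs)"
  using assms(6)
proof (induction us)
  case Nil
  obtain A xs' ys' where A: "xs = xs' @ [A]" "ys = ys' @ [A]"
    using assms(3-5) by (metis append_butlast_last_id)
  have eq: "edge_path (zs @ [A]) +++ edge_path (A # vs) \<simeq> edge_path (zs @ A # vs)"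
    if "set (zs @ [A]) \<subseteq> D" for zs
    using edge_path_append[of zs A vs] that assms(7) by simp
  have "edge_path (xs' @ [A]) +++ edge_path (A # vs) \<simeq> edge_path (ys' @ [A]) +++ edge_path (A # vs)"
    using assms A edge_path[of "A # vs"] by (intro homotopic_paths_join) simp_all
  then show ?case
    using eq[of xs'] eq[of ys'] assms(8,9) A
    by (simp del: edge_path.simps) (meson homotopic_paths_sym homotopic_paths_trans)
next
  case (Cons B us)
  have IH: "edge_path (us @ xs @ vs) \<simeq> edge_path (us @ ys @ vs)" using Cons by simp
  obtain C zs zs' where C: "us @ xs @ vs = C # zs" "us @ ys @ vs = C # zs'"
    using assms(2,4,5) by (cases us; cases xs; cases ys) auto
  have "C \<in> set (us @ xs @ vs)" using C by simp
  then have "C \<in> D" "B \<in> D" using Cons.prems assms(7,8) by auto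
  then show ?case
    using C IH path_image_seg_complex[of B C]
    by (auto intro!: homotopic_paths_join)
qed

text \<open>The three vertices lie in one convex cell, so the path over \<open>B\<close> and the
  direct segment are compared inside this cell.\<close>

lemma edge_path_flat:
  assumes "A \<in> D" "B \<in> D" "C \<in> D" "flat \<Gamma> A B C" "set us \<subseteq> D" "set vs \<subseteq> D"
  shows "edge_path (us @ [A, B, C] @ vs) \<simeq> edge_path (us @ [A, C] @ vs)"
proof (rule edge_path_subst)
  obtain P Q where PQ: "P \<in> D" "Q \<in> D" "A \<union> B \<union> C \<subseteq> P \<union> Q"
    using flat_common_span[OF assms(1-4)] by blast
  have ind: "indicator A \<in> mspan P Q" "indicator B \<in> mspan P Q" "indicator C \<in> mspan P Q"
    using indicator_span assms PQ by auto
  have span: "edge_path xs s \<in> mspan P Q"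
    if "set xs \<subseteq> {A, B, C}" "xs \<noteq> []" "s \<in> {0..1}" for xs s
    using that
  proof (induction xs arbitrary: s rule: edge_path.induct)
    case (3 X Y As)
    then show ?case
      using seg_span[of "indicator X" P Q "indicator Y" "2 * s"] ind by (auto simp: joinpaths_def)
  qed (use ind in auto)
  show "edge_path [A, B, C] \<simeq> edge_path [A, C]"
  proof (rule homotopic_paths_span)
    show "\<exists>A'\<in>D. \<exists>B'\<in>D. edge_path [A, B, C] s \<in> mspan A' B' \<and> edge_path [A, C] s \<in> mspan A' B'"
      if "s \<in> {0..1}" for s
      using PQ(1,2) span[OF _ _ that, of "[A, B, C]"] span[OF _ _ that, of "[A, C]"]
      by (intro bexI[of _ P] bexI[of _ Q] conjI) simp_all
  qed (use assms edge_path[of "[A, B, C]"] edge_path[of "[A, C]"] in \<open>simp_all del: edge_path.simps\<close>)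
qed (use assms in simp_all)

lemma edge_path_repeat:
  assumes "A \<in> D" "set us \<subseteq> D" "set vs \<subseteq> D"
  shows "edge_path (us @ [A, A] @ vs) \<simeq> edge_path (us @ [A] @ vs)"
proof (rule edge_path_subst)
  have "seg (indicator A) (indicator A) = (\<lambda>_. indicator A :: 'e \<Rightarrow> real)"
    by (auto simp: seg_def algebra_simps)
  then have "edge_path [A, A] = edge_path [A]"
    by (auto simp: joinpaths_def)
  then show "edge_path [A, A] \<simeq> edge_path [A]"
    using edge_path[of "[A]"] assms by simp
qed (use assms in simp_all)

lemma flat_back: "flat \<Gamma> A B A"
  by (simp add: flat_def)

text \<open>Going forth and back is a flat triple, whatever \<open>A\<close> and \<open>B\<close>
  are.\<close>

lemma edge_path_back:
  assumes "A \<in> D" "B \<in> D" "set us \<subseteq> D" "set vs \<subseteq> D"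
  shows "edge_path (us @ [A, B, A] @ vs) \<simeq> edge_path (us @ [A] @ vs)"
  using edge_path_flat[of A B A us vs] edge_path_repeat[of A us vs] assms flat_back
    homotopic_paths_trans by blast

end

section \<open>Words and loops\<close>

locale based_multigraph = finite_multigraph \<Gamma> for \<Gamma> :: "('v, 'e) multigraph" +
  fixes A\<^sub>0 :: "'e set"
  assumes A0: "A\<^sub>0 \<in> dimer_coverings \<Gamma>"
begin

abbreviation gens :: "('e set \<times> 'e set) set" where
  "gens \<equiv> D \<times> D"

definition rels :: "(('e set \<times> 'e set) word \<times> ('e set \<times> 'e set) word) set" where
  "rels = {(gen A C, gen A B @ gen B C) | A B C. A \<in> D \<and> B \<in> D \<and> C \<in> D \<and> flat \<Gamma> A B C} \<union>
    {(gen A\<^sub>0 A, []) | A. A \<in> D}"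

abbreviation P :: "('e set \<times> 'e set) word set monoid" where
  "P \<equiv> presented_group gens rels"

abbreviation cls :: "('e set \<times> 'e set) word \<Rightarrow> ('e set \<times> 'e set) word set" where
  "cls u \<equiv> word_equiv gens rels `` {u}"

abbreviation cong :: "('e set \<times> 'e set) word \<Rightarrow> ('e set \<times> 'e set) word \<Rightarrow> bool" where
  "cong \<equiv> word_cong gens rels"

text \<open>A letter stands for the loop from \<open>A\<^sub>0\<close> over its two coverings back
  to \<open>A\<^sub>0\<close>. The final \<open>A\<^sub>0\<close> is left off, since it opens the
  next letter; \<open>word_path\<close> supplies the last one.\<close>

fun word_verts :: "('e set \<times> 'e set) word \<Rightarrow> 'e set list" where
  "word_verts [] = []"
| "word_verts (((A, B), b) # w) = A\<^sub>0 # (if b then [A, B] else [B, A]) @ word_verts w"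

definition word_path :: "('e set \<times> 'e set) word \<Rightarrow> real \<Rightarrow> 'e \<Rightarrow> real" where
  "word_path w = edge_path (word_verts w @ [A\<^sub>0])"

lemma word_verts_append [simp]: "word_verts (u @ v) = word_verts u @ word_verts v"
  by (induction u rule: word_verts.induct) simp_all

lemma words_Cons [simp]: "a # w \<in> words X \<longleftrightarrow> fst a \<in> X \<and> w \<in> words X"
  and words_Nil [simp]: "[] \<in> words X"
  and words_append [simp]: "u @ v \<in> words X \<longleftrightarrow> u \<in> words X \<and> v \<in> words X"
  by (cases a; auto simp: words_def)+

lemma word_verts_dimers: "w \<in> words gens \<Longrightarrow> set (word_verts w) \<subseteq> D"
  using A0 by (induction w rule: word_verts.induct) auto

lemma word_verts_Cons: "\<exists>ys. word_verts w @ [A\<^sub>0] = A\<^sub>0 # ys"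
  by (cases w rule: word_verts.cases) auto

lemma hd_word_verts [simp]: "hd (word_verts w @ [A\<^sub>0]) = A\<^sub>0"
  using word_verts_Cons[of w] by auto

lemma word_path_ends [simp]:
  "pathstart (word_path w) = indicator A\<^sub>0" "pathfinish (word_path w) = indicator A\<^sub>0"
  by (simp_all add: word_path_def)

lemma word_path:
  assumes "w \<in> words gens"
  shows "path (word_path w)" "path_image (word_path w) \<subseteq> matching_complex"
  unfolding word_path_def using edge_path[of "word_verts w @ [A\<^sub>0]"] word_verts_dimers[OF assms] A0
  by simp_all

lemma word_path_append:
  assumes "u \<in> words gens" "v \<in> words gens"
  shows "word_path u +++ word_path v \<simeq> word_path (u @ v)"
proof -
  obtain ys where ys: "word_verts v @ [A\<^sub>0] = A\<^sub>0 # ys" using word_verts_Cons by blast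
  have "set ys \<subseteq> D" using arg_cong[OF ys, of set] word_verts_dimers[OF assms(2)] A0 by auto
  then show ?thesis
    using edge_path_append[of "word_verts u" A\<^sub>0 ys] word_verts_dimers[OF assms(1)] A0 ys
    by (simp add: word_path_def)
qed

text \<open>Well-definedness of the map from the presented group to homotopy classes of
  loops.\<close>

lemma cong_homotopic: "cong u v \<Longrightarrow> word_path u \<simeq> word_path v"
proof (induction rule: word_cong.induct)
  case (refl w)
  then show ?case using word_path by simp
next
  case (sym u v)
  then show ?case by (rule_tac homotopic_paths_sym)
next
  case (trans u v w)
  then show ?case by (rule_tac homotopic_paths_trans)
next
  case (append u u' v v')
  then have w: "u \<in> words gens" "u' \<in> words gens" "v \<in> words gens" "v' \<in> words gens"
    using word_cong_words by blast+
  have "word_path u +++ word_path v \<simeq> word_path u' +++ word_path v'"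
    using append by (intro homotopic_paths_join) simp_all
  then show ?case
    using word_path_append[OF w(1,3)] word_path_append[OF w(2,4)]
      homotopic_paths_sym homotopic_paths_trans by blast
next
  case (cancel g b)
  \<comment> \<open>A letter followed by its inverse is a palindrome and collapses from the
    middle.\<close>
  have *: "edge_path [A\<^sub>0, A, B, A\<^sub>0, B, A, A\<^sub>0] \<simeq> edge_path [A\<^sub>0]" if "A \<in> D" "B \<in> D" for A B
  proof -
    have "edge_path [A\<^sub>0, A, B, A\<^sub>0, B, A, A\<^sub>0] \<simeq> edge_path [A\<^sub>0, A, B, A, A\<^sub>0]"
      using edge_path_back[of B A\<^sub>0 "[A\<^sub>0, A]" "[A, A\<^sub>0]"] that A0 by (simp del: edge_path.simps)
    moreover have "edge_path [A\<^sub>0, A, B, A, A\<^sub>0] \<simeq> edge_path [A\<^sub>0, A, A\<^sub>0]"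
      using edge_path_back[of A B "[A\<^sub>0]" "[A\<^sub>0]"] that A0 by (simp del: edge_path.simps)
    moreover have "edge_path [A\<^sub>0, A, A\<^sub>0] \<simeq> edge_path [A\<^sub>0]"
      using edge_path_back[of A\<^sub>0 A "[]" "[]"] that A0 by (simp del: edge_path.simps)
    ultimately show ?thesis using homotopic_paths_trans by blast
  qed
  obtain A B where g: "g = (A, B)" "A \<in> D" "B \<in> D" using cancel by auto
  then show ?case
    using *[of A B] *[of B A] by (cases b) (simp_all add: word_path_def del: edge_path.simps)
next
  case (relation u v)
  from relation(1) consider
      (flat) A B C where "A \<in> D" "B \<in> D" "C \<in> D" "flat \<Gamma> A B C" "u = gen A C" "v = gen A B @ gen B C"
    | (base) A where "A \<in> D" "u = gen A\<^sub>0 A" "v = []"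
    unfolding rels_def by blast
  then show ?case
  proof cases
    case flat
    \<comment> \<open>The visit to \<open>A\<^sub>0\<close> between the two letters is a step forth
      and back from \<open>B\<close>. Without it the triple \<open>A, B, C\<close> becomes
      consecutive and flatness applies.\<close>
    have "edge_path [A\<^sub>0, A, B, A\<^sub>0, B, C, A\<^sub>0] \<simeq> edge_path [A\<^sub>0, A, B, C, A\<^sub>0]"
      using edge_path_back[of B A\<^sub>0 "[A\<^sub>0, A]" "[C, A\<^sub>0]"] flat A0 by (simp del: edge_path.simps)
    moreover have "edge_path [A\<^sub>0, A, B, C, A\<^sub>0] \<simeq> edge_path [A\<^sub>0, A, C, A\<^sub>0]"
      using edge_path_flat[of A B C "[A\<^sub>0]" "[A\<^sub>0]"] flat A0 by (simp del: edge_path.simps)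
    ultimately have "edge_path [A\<^sub>0, A, C, A\<^sub>0] \<simeq> edge_path [A\<^sub>0, A, B, A\<^sub>0, B, C, A\<^sub>0]"
      using homotopic_paths_trans homotopic_paths_sym by blast
    then show ?thesis using flat by (simp add: word_path_def gen_def del: edge_path.simps)
  next
    case base
    have "edge_path [A\<^sub>0, A\<^sub>0, A, A\<^sub>0] \<simeq> edge_path [A\<^sub>0, A, A\<^sub>0]"
      using edge_path_repeat[of A\<^sub>0 "[]" "[A, A\<^sub>0]"] base A0 by (simp del: edge_path.simps)
    moreover have "edge_path [A\<^sub>0, A, A\<^sub>0] \<simeq> edge_path [A\<^sub>0]"
      using edge_path_back[of A\<^sub>0 A "[]" "[]"] base A0 by (simp del: edge_path.simps)
    ultimately have "edge_path [A\<^sub>0, A\<^sub>0, A, A\<^sub>0] \<simeq> edge_path [A\<^sub>0]"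
      by (rule homotopic_paths_trans)
    then show ?thesis using base by (simp add: word_path_def gen_def del: edge_path.simps)
  qed
qed

section \<open>The cocycle of generators and its transport\<close>

definition y :: "'e set \<Rightarrow> 'e set \<Rightarrow> ('e set \<times> 'e set) word set" where
  "y A B = cls (gen A B)"

lemma cls_eq: "cong u v \<Longrightarrow> cls u = cls v"
  by (intro equiv_class_eq[OF equiv_word_equiv]) (simp add: word_equiv_def)

lemma cls_eqD: "cls u = cls v \<Longrightarrow> u \<in> words gens \<Longrightarrow> v \<in> words gens \<Longrightarrow> cong u v"
  using eq_equiv_class[OF _ equiv_word_equiv] unfolding word_equiv_def by blast

lemma cls_closed: "u \<in> words gens \<Longrightarrow> cls u \<in> carrier P"
  by (simp add: presented_group_def quotientI)

lemma gen_words: "A \<in> D \<Longrightarrow> B \<in> D \<Longrightarrow> gen A B \<in> words gens"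
  by (simp add: gen_def)

lemma y_closed: "A \<in> D \<Longrightarrow> B \<in> D \<Longrightarrow> y A B \<in> carrier P"
  using cls_closed gen_words by (simp add: y_def)

lemma y_flat:
  assumes "A \<in> D" "B \<in> D" "C \<in> D" "flat \<Gamma> A B C"
  shows "y A B \<otimes>\<^bsub>P\<^esub> y B C = y A C"
proof -
  have "cong (gen A C) (gen A B @ gen B C)"
  proof (rule word_cong.relation)
    show "(gen A C, gen A B @ gen B C) \<in> rels" using assms unfolding rels_def by blast
  qed (use assms gen_words in simp_all)
  then show ?thesis
    using cls_eq by (simp add: y_def mult_presented_group gen_words assms)
qed

lemma y_base:
  assumes "A \<in> D"
  shows "y A\<^sub>0 A = \<one>\<^bsub>P\<^esub>"
proof -
  have "cong (gen A\<^sub>0 A) []"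
  proof (rule word_cong.relation)
    show "(gen A\<^sub>0 A, []) \<in> rels" using assms unfolding rels_def by blast
  qed (use assms A0 gen_words in simp_all)
  then show ?thesis using cls_eq by (simp add: y_def presented_group_def)
qed

text \<open>Three stars with a common point belong to a flat triple, so the first family of
  relations is what makes the generators a cocycle.\<close>

sublocale open_cocycle P matching_complex D star y
proof (intro open_cocycle.intro open_cocycle_axioms.intro)
  show "group P" by (rule group_presented_group)
  show "y A B \<otimes>\<^bsub>P\<^esub> y B C = y A C"
    if "A \<in> D" "B \<in> D" "C \<in> D" "x \<in> star A" "x \<in> star B" "x \<in> star C" for A B C x
    using that y_flat star_flat by simp
qed (simp_all add: star_cover star_open y_closed)

text \<open>The segment lies in the star of \<open>A\<close> before time 1 and in the star of
  \<open>B\<close> after time 0. The chart is changed at time 1/2, once, and this contributes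
  \<open>y A B\<close>.\<close>

lemma transport_seg:
  assumes "A \<in> D" "B \<in> D"
  shows "transport (seg (indicator A) (indicator B)) 0 1 A B (y A B)"
proof -
  let ?s = "seg (indicator A) (indicator B)"
  have span: "?s t \<in> mspan A B" if "t \<in> {0..1}" for t
    using seg_span[OF _ _ that] indicator_span[of A A B] indicator_span[of B A B] assms by blast
  have K: "?s t \<in> matching_complex" if "t \<in> {0..1}" for t
    using span[OF that] span_subset[OF assms] by blast
  have U: "?s t \<in> star A" if "0 \<le> t" "t < 1" for t
    using K[of t] that unfolding star_def seg_def by (simp add: add_pos_nonneg)
  have V: "?s t \<in> star B" if "0 < t" "t \<le> 1" for t
    using K[of t] that unfolding star_def seg_def by (simp add: add_nonneg_pos)
  have cont: "continuous_on {a..b} ?s" for a b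
    unfolding seg_def
    by (intro continuous_on_coordinatewise_then_product continuous_intros)
  have 1: "transport ?s 0 (1/2) A B (y A B)"
    using assms
  proof (intro transport_chart_left cont image_subsetI)
    show "?s (1/2) \<in> star B" by (rule V) simp_all
  qed (auto intro: U K)
  have 2: "transport ?s (1/2) 1 B B (y B B)"
    using assms(2)
  proof (intro transport_chart_left cont image_subsetI)
    show "?s 1 \<in> star B" by (rule V) simp_all
  qed (auto intro: V K)
  have "y B B = \<one>\<^bsub>P\<^esub>"
    by (rule c_self[OF assms(2)]) (rule V[of 1], simp_all)
  then show ?thesis using transport_join[OF 1 2] assms by simp
qed

fun path_product :: "'e set list \<Rightarrow> ('e set \<times> 'e set) word set" where
  "path_product [] = \<one>\<^bsub>P\<^esub>"
| "path_product [A] = \<one>\<^bsub>P\<^esub>"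
| "path_product (A # B # As) = y A B \<otimes>\<^bsub>P\<^esub> path_product (B # As)"

lemma transport_edge_path:
  assumes "xs \<noteq> []" "set xs \<subseteq> D"
  shows "transport (edge_path xs) 0 1 (hd xs) (last xs) (path_product xs)"
  using assms
proof (induction xs rule: edge_path.induct)
  case (2 A)
  then have A: "A \<in> D" "indicator A \<in> star A" "(indicator A :: 'e \<Rightarrow> real) \<in> matching_complex"
    using indicator_star_iff[of A A] indicator_complex[of A] by simp_all
  then have "transport (\<lambda>_. indicator A) 0 1 A A (y A A)"
    by (intro transport_chart_left) auto
  then show ?case using c_self[OF A(1,2)] by simp
next
  case (3 A B As)
  have "transport (seg (indicator A) (indicator B) +++ edge_path (B # As)) 0 1 A (last (B # As))
      (y A B \<otimes>\<^bsub>P\<^esub> path_product (B # As))"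
  proof (rule transport_joinpaths)
    show "transport (seg (indicator A) (indicator B)) 0 1 A B (y A B)"
      using 3 by (intro transport_seg) simp_all
    show "transport (edge_path (B # As)) 0 1 B (last (B # As)) (path_product (B # As))"
      using 3 by simp
  qed simp
  then show ?case by simp
qed simp

lemma y_base_right:
  assumes "A \<in> D"
  shows "y A A\<^sub>0 = \<one>\<^bsub>P\<^esub>"
  using y_flat[of A\<^sub>0 A A\<^sub>0] y_base[OF assms] y_base[OF A0] A0 assms flat_back y_closed
  by simp

text \<open>The inverse letter and \<open>y B A\<close> are both right inverses of
  \<open>y A B\<close>. This matches \<open>word_verts\<close>, which swaps the two coverings of an
  inverse letter.\<close>

lemma cls_letter:
  assumes "A \<in> D" "B \<in> D"
  shows "cls [((A, B), b)] = (if b then y A B else y B A)"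
proof (cases b)
  case True
  then show ?thesis by (simp add: y_def gen_def)
next
  case False
  have AB: "y A B \<otimes>\<^bsub>P\<^esub> y B A = \<one>\<^bsub>P\<^esub>"
    using y_flat[of A B A] c_self[of A "indicator A"] indicator_star_iff[of A A] assms flat_back by simp
  have "cong ([((A, B), True), ((A, B), \<not> True)]) []"
    using assms by (intro word_cong.cancel) simp
  then have "cls ([((A, B), True)] @ [((A, B), False)]) = \<one>\<^bsub>P\<^esub>"
    using cls_eq by (simp add: presented_group_def)
  then have "y A B \<otimes>\<^bsub>P\<^esub> cls [((A, B), False)] = \<one>\<^bsub>P\<^esub>"
    using assms by (subst (asm) mult_presented_group[symmetric]) (simp_all add: y_def gen_def)
  then have "cls [((A, B), False)] = y B A"
    using AB assms y_closed cls_closed[of "[((A, B), False)]"]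
    
    by (metis (no_types, lifting) fst_conv Units_eq Units_l_cancel mem_Sigma_iff words_Cons words_Nil)
  then show ?thesis using False by simp
qed

text \<open>The segments joining a letter to \<open>A\<^sub>0\<close> contribute
  \<open>y A\<^sub>0 A\<close> and \<open>y B A\<^sub>0\<close>, or the same with \<open>A\<close>
  and \<open>B\<close> swapped. They are trivial by the relations at \<open>A\<^sub>0\<close>, so
  transport returns the class of the word.\<close>

lemma path_product_word:
  assumes "w \<in> words gens"
  shows "path_product (word_verts w @ [A\<^sub>0]) = cls w"
  using assms
proof (induction w rule: word_verts.induct)
  case 1
  then show ?case by (simp add: presented_group_def)
next
  case (2 A B b w)
  then have D: "A \<in> D" "B \<in> D" and w: "w \<in> words gens" by simp_all
  obtain ys where ys: "word_verts w @ [A\<^sub>0] = A\<^sub>0 # ys" using word_verts_Cons by blast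
  have IH: "path_product (A\<^sub>0 # ys) = cls w" using 2 w ys by simp
  have "cls (((A, B), b) # w) = cls [((A, B), b)] \<otimes>\<^bsub>P\<^esub> cls w"
    using D w by (simp add: mult_presented_group)
  also have "\<dots> = (if b then y A B else y B A) \<otimes>\<^bsub>P\<^esub> cls w" using cls_letter[OF D] by simp
  also have "\<dots> = path_product (word_verts (((A, B), b) # w) @ [A\<^sub>0])"
    using D y_closed cls_closed[OF w] y_base y_base_right ys IH by (cases b) (simp_all add: ys)
  finally show ?case by simp
qed

lemma homotopic_cong:
  assumes "u \<in> words gens" "v \<in> words gens" "word_path u \<simeq> word_path v"
  shows "cong u v"
proof -
  have t: "transport (word_path w) 0 1 A\<^sub>0 A\<^sub>0 (cls w)" if "w \<in> words gens" for w
    using transport_edge_path[of "word_verts w @ [A\<^sub>0]"] word_verts_dimers[OF that] A0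
      path_product_word[OF that] by (simp add: word_path_def)
  have "cls u = cls v" using transport_homotopic[OF assms(3) t t] assms(1,2) by blast
  then show ?thesis using cls_eqD assms(1,2) by blast
qed

section \<open>Every loop is an edge loop\<close>

text \<open>Meant for paths from \<open>A\<^sub>0\<close> to \<open>A\<close>. The last edge is kept
  outside the word, so that progress along a path can be recorded before the path closes up.\<close>

definition reducible :: "'e set \<Rightarrow> (real \<Rightarrow> 'e \<Rightarrow> real) \<Rightarrow> bool" where
  "reducible A p \<longleftrightarrow> (\<exists>w\<in>words gens. p \<simeq> edge_path (word_verts w @ [A\<^sub>0, A]))"

lemma reducible_homotopic: "reducible A p \<Longrightarrow> q \<simeq> p \<Longrightarrow> reducible A q"
  unfolding reducible_def using homotopic_paths_trans by blast

lemma reducible_step: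
  assumes D: "A \<in> D" "B \<in> D" and "reducible B p"
  shows "reducible A (p +++ seg (indicator B) (indicator A))"
proof -
  obtain w where w: "w \<in> words gens" "p \<simeq> edge_path (word_verts w @ [A\<^sub>0, B])"
    using assms(3) unfolding reducible_def by blast
  note W = word_verts_dimers[OF w(1)]
  let ?s = "seg (indicator B) (indicator A) :: real \<Rightarrow> 'e \<Rightarrow> real"
  have s: "path_image ?s \<subseteq> matching_complex" by (rule path_image_seg_complex[OF D(2,1)])
  have end_p: "pathfinish p = indicator B"
    using homotopic_paths_imp_pathfinish[OF w(2)] by simp
  have "?s \<simeq> edge_path [B, A]"
    using homotopic_paths_sym[OF homotopic_paths_const_right[OF path_seg s, of "indicator A"]] by simp
  then have "p +++ ?s \<simeq> edge_path (word_verts w @ [A\<^sub>0, B]) +++ edge_path [B, A]"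
    by (rule homotopic_paths_join[OF w(2)]) (simp add: end_p)
  also have "\<dots> \<simeq> edge_path (word_verts w @ [A\<^sub>0, B, A])"
    using edge_path_append[of "word_verts w @ [A\<^sub>0]" B "[A]"] W A0 D by (simp del: edge_path.simps)
  \<comment> \<open>Inserting the detour from \<open>A\<close> to \<open>A\<^sub>0\<close> and back
    completes the letter \<open>((B, A), True)\<close> and leaves a new last edge from
    \<open>A\<^sub>0\<close> to \<open>A\<close>.\<close>
  also have "\<dots> \<simeq> edge_path (word_verts w @ [A\<^sub>0, B, A, A\<^sub>0, A])"
    using homotopic_paths_sym[OF edge_path_back[of A A\<^sub>0 "word_verts w @ [A\<^sub>0, B]" "[]"]] W A0 D
    by (simp del: edge_path.simps)
  also have "word_verts w @ [A\<^sub>0, B, A, A\<^sub>0, A] = word_verts (w @ [((B, A), True)]) @ [A\<^sub>0, A]" by simp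
  finally show ?thesis using w(1) D unfolding reducible_def
    by (intro bexI[of _ "w @ [((B, A), True)]"]) simp_all
qed

text \<open>How the spoke to a centre changes when the star changes. Every cell containing a point
  of a star also contains the centre of that star. Hence the start of \<open>r\<close>, lying in
  both stars, shares one cell with both centres, while a later point of \<open>r\<close> only shares
  a cell with \<open>A\<close>.\<close>

lemma star_contract:
  assumes D: "A \<in> D" "B \<in> D" and r: "path r" "path_image r \<subseteq> star A" "pathstart r \<in> star B"
  shows "r +++ seg (pathfinish r) (indicator A) \<simeq>
    seg (pathstart r) (indicator B) +++ seg (indicator B) (indicator A)"
    (is "?p \<simeq> ?q")
proof -
  let ?x = "pathstart r"
  have common: "\<exists>X\<in>D. \<exists>Y\<in>D. z \<in> mspan X Y \<and> indicator A \<in> mspan X Y"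
    if z: "z \<in> star A" for z
  proof -
    obtain X Y where "X \<in> D" "Y \<in> D" "z \<in> mspan X Y"
      using z unfolding star_def matching_complex_def by blast
    then show ?thesis using star_span[OF z] indicator_span[OF D(1)] by blast
  qed
  have "?x \<in> star A" using r(2) by blast
  have x: "\<exists>X\<in>D. \<exists>Y\<in>D. ?x \<in> mspan X Y \<and> indicator A \<in> mspan X Y \<and> indicator B \<in> mspan X Y"
  proof -
    obtain X Y where XY: "X \<in> D" "Y \<in> D" "?x \<in> mspan X Y"
      using r(3) unfolding star_def matching_complex_def by blast
    have "indicator A \<in> mspan X Y"
      by (rule indicator_span[OF D(1) star_span[OF \<open>?x \<in> star A\<close> XY(3)]])
    moreover have "indicator B \<in> mspan X Y"
      by (rule indicator_span[OF D(2) star_span[OF r(3) XY(3)]])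
    ultimately show ?thesis using XY by blast
  qed
  have p: "\<exists>X\<in>D. \<exists>Y\<in>D. ?p s \<in> mspan X Y \<and> indicator A \<in> mspan X Y" if s: "s \<in> {0..1}" for s
  proof (cases "s \<le> 1/2")
    case True
    then have "r (2 * s) \<in> star A" using r(2) s unfolding path_image_def by (simp add: image_subset_iff)
    then show ?thesis using common True by (simp add: joinpaths_def)
  next
    case False
    obtain X Y where XY: "X \<in> D" "Y \<in> D" "pathfinish r \<in> mspan X Y" "indicator A \<in> mspan X Y"
      using common[of "pathfinish r"] r(2) by blast
    have "2 * s - 1 \<in> {0..1}" using False s by simp
    from seg_span[OF XY(3,4) this] show ?thesis using XY False by (auto simp: joinpaths_def)
  qed
  have q: "\<exists>X\<in>D. \<exists>Y\<in>D. ?q s \<in> mspan X Y \<and> ?x \<in> mspan X Y" if s: "s \<in> {0..1}" for s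
  proof -
    obtain X Y where XY: "X \<in> D" "Y \<in> D" "?x \<in> mspan X Y" "indicator A \<in> mspan X Y" "indicator B \<in> mspan X Y"
      using x by blast
    have "?q s \<in> mspan X Y"
      using seg_span[OF XY(3,5), of "2 * s"] seg_span[OF XY(5,4), of "2 * s - 1"] s
      by (simp add: joinpaths_def)
    then show ?thesis using XY by blast
  qed
  have paths: "path ?p" "path ?q" using r(1) by simp_all
  have sub: "path_image f \<subseteq> matching_complex"
    if "\<And>s. s \<in> {0..1} \<Longrightarrow> \<exists>X\<in>D. \<exists>Y\<in>D. f s \<in> mspan X Y \<and> z f \<in> mspan X Y" for f z
    using that span_subset unfolding path_image_def by blast
  have const: "path (\<lambda>_. z)" "pathstart (\<lambda>_. z) = z" "pathfinish (\<lambda>_. z) = z" for z :: "'e \<Rightarrow> real"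
    by (simp_all add: path_def pathstart_def pathfinish_def)
  \<comment> \<open>The points of \<open>?p\<close> and \<open>?q\<close> at equal times need not
    share a cell, so one path is delayed. While \<open>?q\<close> runs inside a cell of
    \<open>?x\<close>, the other path rests at \<open>?x\<close>; while \<open>?p\<close> runs, with
    each point in some cell of \<open>A\<close>, the first rests at \<open>A\<close>.\<close>
  have "(\<lambda>_. ?x) +++ ?p \<simeq> ?q +++ (\<lambda>_. indicator A)"
  proof (rule homotopic_paths_span)
    fix s :: real assume s: "s \<in> {0..1}"
    show "\<exists>X\<in>D. \<exists>Y\<in>D. ((\<lambda>_. ?x) +++ ?p) s \<in> mspan X Y \<and> (?q +++ (\<lambda>_. indicator A)) s \<in> mspan X Y"
    proof (cases "s \<le> 1/2")
      case True
      then have "2 * s \<in> {0..1}" using s by simp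
      from q[OF this] True show ?thesis by (simp only: joinpaths_def if_True) blast
    next
      case False
      then have "2 * s - 1 \<in> {0..1}" using s by simp
      from p[OF this] False show ?thesis by (simp only: joinpaths_def if_False)
    qed
  qed (use paths const in \<open>simp_all\<close>)
  moreover have "(\<lambda>_. ?x) +++ ?p \<simeq> ?p"
    using sub[OF p] paths by (intro homotopic_paths_const_left) simp_all
  moreover have "?q +++ (\<lambda>_. indicator A) \<simeq> ?q"
    using sub[OF q] paths by (intro homotopic_paths_const_right) simp_all
  ultimately show ?thesis using homotopic_paths_sym homotopic_paths_trans by blast
qed

lemma loop_reducible:
  assumes p: "path p" "path_image p \<subseteq> matching_complex"
    and ends: "pathstart p = indicator A\<^sub>0" "pathfinish p = indicator A\<^sub>0"
  shows "\<exists>w\<in>words gens. p \<simeq> word_path w"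
proof -
  \<comment> \<open>The path up to time \<open>t\<close> is closed off by the spoke from
    \<open>p t\<close> to the centre of a star containing it.\<close>
  define good where "good t \<longleftrightarrow> (\<exists>A\<in>D. p t \<in> star A \<and>
    reducible A ((p \<circ> linepath 0 t) +++ seg (p t) (indicator A)))" for t
  have seg_A0: "seg (indicator A\<^sub>0) (indicator A\<^sub>0) = (\<lambda>_. indicator A\<^sub>0 :: 'e \<Rightarrow> real)"
    by (auto simp: seg_def algebra_simps)
  have p01: "p 0 = indicator A\<^sub>0" "p 1 = indicator A\<^sub>0"
    using ends by (simp_all add: pathstart_def pathfinish_def)
  have A0_star: "indicator A\<^sub>0 \<in> star A\<^sub>0" using indicator_star_iff[OF A0 A0] by simp
  have "good 0"
  proof -
    have "p \<circ> linepath 0 0 = (\<lambda>_. indicator A\<^sub>0)" using p01 by (auto simp: linepath_def)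
    then have "(p \<circ> linepath 0 0) +++ seg (p 0) (indicator A\<^sub>0) = edge_path (word_verts [] @ [A\<^sub>0, A\<^sub>0])"
      using p01 seg_A0 by (simp add: joinpaths_def)
    moreover have "edge_path (word_verts [] @ [A\<^sub>0, A\<^sub>0]) \<simeq> edge_path (word_verts [] @ [A\<^sub>0, A\<^sub>0])"
      using edge_path[of "word_verts [] @ [A\<^sub>0, A\<^sub>0]"] A0 by simp
    ultimately have "reducible A\<^sub>0 ((p \<circ> linepath 0 0) +++ seg (p 0) (indicator A\<^sub>0))"
      unfolding reducible_def by (metis words_Nil)
    then show ?thesis using A0 A0_star p01(1) unfolding good_def by (intro bexI[of _ A\<^sub>0]) simp_all
  qed
  have step: "\<exists>e>0. \<forall>x\<in>{0..1}. \<forall>z\<in>{0..1}. \<bar>x - t\<bar> < e \<longrightarrow> \<bar>z - t\<bar> < e \<longrightarrow> good x \<longrightarrow> good z"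
    if t: "t \<in> {0..1}" for t
  proof -
    have cont: "continuous_on {0..1} p" and img: "p ` {0..1} \<subseteq> matching_complex"
      using p by (simp_all add: path_def path_image_def)
    have "p t \<in> matching_complex" using img t by blast
    then obtain A where A: "A \<in> D" "p t \<in> star A" using cover by blast
    obtain e where e: "e > 0" "\<And>s. s \<in> {0..1} \<Longrightarrow> \<bar>s - t\<bar> < e \<Longrightarrow> p s \<in> star A"
      using U_nbhd[OF cont img t A] by (auto simp: dist_real_def)
    have "good z" if x: "x \<in> {0..1}" "\<bar>x - t\<bar> < e" and z: "z \<in> {0..1}" "\<bar>z - t\<bar> < e" and "good x" for x z
    proof -
      obtain B where B: "B \<in> D" "p x \<in> star B"
        and red: "reducible B ((p \<circ> linepath 0 x) +++ seg (p x) (indicator B))"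
        using \<open>good x\<close> unfolding good_def by blast
      have sub: "path (p \<circ> linepath u v)" "path_image (p \<circ> linepath u v) \<subseteq> matching_complex"
        "pathstart (p \<circ> linepath u v) = p u" "pathfinish (p \<circ> linepath u v) = p v"
        if "u \<in> {0..1}" "v \<in> {0..1}" for u v
      proof -
        have seg01: "closed_segment u v \<subseteq> {0..1}"
          using that by (intro closed_segment_subset) simp_all
        show "path (p \<circ> linepath u v)"
          using cont seg01 by (intro path_continuous_image) (auto intro: continuous_on_subset)
        show "path_image (p \<circ> linepath u v) \<subseteq> matching_complex"
          using img seg01 unfolding path_image_compose path_image_linepath by blast
      qed (simp_all add: pathstart_compose pathfinish_compose)
      have s01: "0 \<in> {0..1::real}" by simp
      let ?q = "p \<circ> linepath 0 x" and ?r = "p \<circ> linepath x z"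
      note q = sub[OF s01 x(1)] and r = sub[OF x(1) z(1)]
      have "path_image ?r \<subseteq> star A"
      proof -
        have "\<bar>s - t\<bar> < e" "s \<in> {0..1}" if "s \<in> closed_segment x z" for s
          using that x z by (auto simp: closed_segment_eq_real_ivl abs_less_iff split: if_splits)
        then show ?thesis using e(2) unfolding path_image_compose path_image_linepath by blast
      qed
      then have contract: "?r +++ seg (p z) (indicator A) \<simeq> seg (p x) (indicator B) +++ seg (indicator B) (indicator A)"
        using star_contract[OF A(1) B(1) r(1)] B(2) r(3,4) by simp
      have segs: "path_image (seg (p u) (indicator C)) \<subseteq> matching_complex"
        if C: "C \<in> D" "p u \<in> star C" for u C
      proof -
        obtain X Y where XY: "X \<in> D" "Y \<in> D" "p u \<in> mspan X Y"
          using C(2) unfolding star_def matching_complex_def by blast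
        then have "indicator C \<in> mspan X Y" using star_span[OF C(2)] indicator_span[OF C(1)] by blast
        then show ?thesis using path_image_seg[OF XY(3)] span_subset[OF XY(1,2)] by blast
      qed
      \<comment> \<open>Both sides are reparametrisations of \<open>p\<close> with the same ends.
        This also covers \<open>z < x\<close>, where the right-hand side runs up to \<open>x\<close>
        and back.\<close>
      have "p \<circ> linepath 0 z \<simeq> p \<circ> (linepath 0 x +++ linepath x z)"
        using x z by (intro homotopic_paths_compose_real p)
          (simp_all add: path_image_join closed_segment_subset)
      then have "(p \<circ> linepath 0 z) +++ seg (p z) (indicator A) \<simeq> (?q +++ ?r) +++ seg (p z) (indicator A)"
        using segs[OF A(1) e(2)[OF z]] sub(4)[OF s01 z(1)]
        by (intro homotopic_paths_join) (simp_all add: path_compose_join)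
      also have "\<dots> \<simeq> ?q +++ (?r +++ seg (p z) (indicator A))"
        using q r segs[OF A(1) e(2)[OF z]]
        by (intro homotopic_paths_sym[OF homotopic_paths_assoc]) simp_all
      also have "\<dots> \<simeq> ?q +++ (seg (p x) (indicator B) +++ seg (indicator B) (indicator A))"
        using q r by (intro homotopic_paths_join[OF _ contract]) simp_all
      also have "\<dots> \<simeq> (?q +++ seg (p x) (indicator B)) +++ seg (indicator B) (indicator A)"
        using q segs[OF B] path_image_seg_complex[OF B(1) A(1)]
        by (intro homotopic_paths_assoc) simp_all
      finally have "reducible A ((p \<circ> linepath 0 z) +++ seg (p z) (indicator A))"
        by (rule reducible_homotopic[OF reducible_step[OF A(1) B(1) red]])
      then show ?thesis using A(1) e(2)[OF z] unfolding good_def by blast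
    qed
    then show ?thesis using e(1) by blast
  qed
  have "good 1"
    by (rule interval_induct[of good 0 1 1, OF \<open>good 0\<close> _ step]) simp_all
  then obtain A where A: "A \<in> D" "indicator A\<^sub>0 \<in> star A"
    and "reducible A ((p \<circ> linepath 0 1) +++ seg (p 1) (indicator A))"
    unfolding good_def p01(2) by blast
  \<comment> \<open>At time 1 the path is at \<open>A\<^sub>0\<close>, which lies in no other star.
    The final spoke is then constant.\<close>
  moreover have "A = A\<^sub>0" using indicator_star_iff[OF A0 A(1)] A(2) by simp
  moreover have "p \<circ> linepath 0 1 = p" by (auto simp: linepath_def)
  ultimately obtain w where w: "w \<in> words gens"
    "p +++ (\<lambda>_. indicator A\<^sub>0) \<simeq> edge_path (word_verts w @ [A\<^sub>0, A\<^sub>0])"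
    unfolding reducible_def p01(2) by (auto simp: seg_A0)
  have "p \<simeq> p +++ (\<lambda>_. indicator A\<^sub>0)"
    using p ends(2) by (intro homotopic_paths_sym[OF homotopic_paths_const_right]) simp_all
  also note w(2)
  also have "edge_path (word_verts w @ [A\<^sub>0, A\<^sub>0]) \<simeq> word_path w"
    using edge_path_repeat[OF A0 word_verts_dimers[OF w(1)], of "[]"] by (simp add: word_path_def)
  finally show ?thesis using w(1) by blast
qed

end

context finite_multigraph
begin

section \<open>Edge weights of points of the cubed complex\<close>

lemma even_cycle_subset: "even_cycle \<Gamma> s \<Longrightarrow> s \<subseteq> E"
  by (simp add: even_cycle_def cyclic_set_def)

lemma even_cycle_nonempty:
  assumes "even_cycle \<Gamma> s"
  shows "s \<noteq> {}"
proof -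
  obtain n :: nat and e where "2 \<le> n" "s = e ` {..<n}"
    using assms unfolding even_cycle_def single_circle_def by blast
  then show ?thesis by (simp add: lessThan_empty_iff)
qed

lemma based_cubesD:
  assumes "(A, S) \<in> based_cubes \<Gamma>"
  shows "A \<subseteq> E" "finite S" "\<And>s. s \<in> S \<Longrightarrow> even_cycle \<Gamma> s" "pairwise (indep_edge_sets \<Gamma>) S"
  using assms by (simp_all add: based_cubes_def power_group_def)

lemma based_cube_eq_at_vertex:
  assumes "(A, S) \<in> based_cubes \<Gamma>" "s \<in> S" "t \<in> S" "e \<in> s" "f \<in> t" "v \<in> ends \<Gamma> e" "v \<in> ends \<Gamma> f"
  shows "s = t"
  using based_cubesD(4)[OF assms(1)] assms(2-) unfolding pairwise_def indep_edge_sets_def by blast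

lemma based_cube_eq:
  assumes "(A, S) \<in> based_cubes \<Gamma>" "s \<in> S" "t \<in> S" "e \<in> s" "e \<in> t"
  shows "s = t"
proof -
  have "e \<in> E" using even_cycle_subset[OF based_cubesD(3)[OF assms(1,2)]] assms(4) by blast
  then obtain v where "v \<in> ends \<Gamma> e" using ex_end by blast
  then show ?thesis using based_cube_eq_at_vertex assms by blast
qed

lemma mult_power_group: "A \<otimes>\<^bsub>power_group E\<^esub> B = (A \<union> B) - (A \<inter> B)"
  by (simp add: power_group_def)

lemma cycle_product_disjoint:
  assumes "finite T" "\<And>s. s \<in> T \<Longrightarrow> s \<subseteq> E" "\<And>s t. s \<in> T \<Longrightarrow> t \<in> T \<Longrightarrow> s \<noteq> t \<Longrightarrow> s \<inter> t = {}"
  shows "cycle_product \<Gamma> T = \<Union>T"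
  using assms
proof (induction T)
  case empty
  interpret comm_group "power_group E" by (rule comm_group_power_group)
  show ?case unfolding cycle_product_def finprod_empty by (simp add: power_group_def)
next
  case (insert s T)
  interpret comm_group "power_group E" by (rule comm_group_power_group)
  have "cycle_product \<Gamma> (insert s T) = s \<otimes>\<^bsub>power_group E\<^esub> cycle_product \<Gamma> T"
    unfolding cycle_product_def using insert.hyps insert.prems(1)
    by (intro finprod_insert) (auto simp: power_group_def)
  also have "cycle_product \<Gamma> T = \<Union>T" using insert by simp
  also have "s \<otimes>\<^bsub>power_group E\<^esub> \<Union>T = s \<union> \<Union>T"
  proof -
    have "s \<inter> t = {}" if "t \<in> T" for t
      using insert.prems(2)[of s t] insert.hyps(2) that by blast
    then show ?thesis unfolding mult_power_group by blast
  qed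
  finally show ?case by simp
qed

lemma translate_iff:
  assumes "(A, S) \<in> based_cubes \<Gamma>" "T \<subseteq> S"
  shows "e \<in> translate \<Gamma> T A \<longleftrightarrow> (e \<in> A) \<noteq> (e \<in> \<Union>T)"
proof -
  have "cycle_product \<Gamma> T = \<Union>T"
  proof (rule cycle_product_disjoint)
    show "finite T" using based_cubesD(2)[OF assms(1)] assms(2) finite_subset by blast
    show "s \<subseteq> E" if "s \<in> T" for s
      using that assms(2) even_cycle_subset based_cubesD(3)[OF assms(1)] by blast
    show "s \<inter> t = {}" if "s \<in> T" "t \<in> T" "s \<noteq> t" for s t
      using based_cube_eq[OF assms(1)] that assms(2) by blast
  qed
  then show ?thesis unfolding translate_def mult_power_group by blast
qed

text \<open>Cycles of a based cube are independent, so on such a cube each sum has at most one term.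
  Written as sums, the weights are visibly continuous in the coordinates.\<close>

definition edge_weight :: "'e cube_point \<Rightarrow> 'e \<Rightarrow> real" where
  "edge_weight = (\<lambda>((A, S), x) e.
     if e \<in> A then 1 - (\<Sum>s | s \<in> S \<and> e \<in> s. x s) else (\<Sum>s | s \<in> S \<and> e \<in> s. x s))"

lemma edge_weight_cycle:
  assumes "(A, S) \<in> based_cubes \<Gamma>" "s \<in> S" "e \<in> s"
  shows "edge_weight ((A, S), x) e = (if e \<in> A then 1 - x s else x s)"
proof -
  have "{t. t \<in> S \<and> e \<in> t} = {s}" using based_cube_eq[OF assms(1)] assms(2,3) by blast
  then show ?thesis by (simp add: edge_weight_def)
qed

lemma edge_weight_outside:
  assumes "e \<notin> \<Union>S"
  shows "edge_weight ((A, S), x) e = (if e \<in> A then 1 else 0)"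
proof -
  have "{t. t \<in> S \<and> e \<in> t} = {}" using assms by blast
  then show ?thesis by (simp only: edge_weight_def prod.case) simp
qed

lemma topspace_cube_sum:
  "((A, S), x) \<in> topspace (cube_sum \<Gamma>) \<longleftrightarrow> (A, S) \<in> based_cubes \<Gamma> \<and> x \<in> S \<rightarrow>\<^sub>E {0..1}"
  by (simp add: cube_sum_def)

text \<open>A cycle with coordinate 0 gives its edges the indicator of \<open>A\<close>, as if it
  were absent. A flip exchanges \<open>x\<close> with \<open>1 - x\<close> and membership in
  \<open>A\<close> with non-membership, and the two changes cancel.\<close>

lemma edge_weight_glue: "cube_glue \<Gamma> p q \<Longrightarrow> edge_weight p = edge_weight q"
proof (induction rule: cube_glue.induct)
  case (face A S x S' x')
  then have b: "(A, S) \<in> based_cubes \<Gamma>" "(A, S') \<in> based_cubes \<Gamma>" by (simp_all add: topspace_cube_sum)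
  show ?case
  proof
    fix e
    consider s where "s \<in> S" "e \<in> s" | s where "s \<in> S' - S" "e \<in> s" "e \<notin> \<Union>S" | "e \<notin> \<Union>S'" "e \<notin> \<Union>S"
      using face.hyps(3) by blast
    then show "edge_weight ((A, S), x) e = edge_weight ((A, S'), x') e"
    proof cases
      case 1
      then show ?thesis using face.hyps(3,4) edge_weight_cycle[OF b(1)] edge_weight_cycle[OF b(2)]
        by (metis subsetD)
    next
      case 2
      then show ?thesis using face.hyps(5) edge_weight_cycle[OF b(2), of s e x'] edge_weight_outside[of e S A x]
        by simp
    next
      case 3
      then show ?thesis by (simp only: edge_weight_outside[OF 3(1)] edge_weight_outside[OF 3(2)])
    qed
  qed
next
  case (flip A S x T x')
  then have b: "(A, S) \<in> based_cubes \<Gamma>" "(translate \<Gamma> T A, S) \<in> based_cubes \<Gamma>"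
    by (simp_all add: topspace_cube_sum)
  note tr = translate_iff[OF b(1) flip.hyps(3)]
  show ?case
  proof
    fix e
    consider s where "s \<in> T" "s \<in> S" "e \<in> s" | s where "s \<in> S - T" "s \<in> S" "e \<in> s" | "e \<notin> \<Union>S"
      using flip.hyps(3) by blast
    then show "edge_weight ((A, S), x) e = edge_weight ((translate \<Gamma> T A, S), x') e"
    proof cases
      case 1
      then have "e \<in> translate \<Gamma> T A \<longleftrightarrow> e \<notin> A" using tr by blast
      then show ?thesis
        using flip.hyps(5) 1(1) edge_weight_cycle[OF b(1) 1(2,3)] edge_weight_cycle[OF b(2) 1(2,3)] by simp
    next
      case 2
      then have "e \<notin> \<Union>T" using based_cube_eq[OF b(1)] flip.hyps(3) by blast
      then have "e \<in> translate \<Gamma> T A \<longleftrightarrow> e \<in> A" using tr by blast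
      then show ?thesis
        using flip.hyps(4) 2(1) edge_weight_cycle[OF b(1) 2(2,3)] edge_weight_cycle[OF b(2) 2(2,3)] by simp
    next
      case 3
      then have "e \<notin> \<Union>T" using flip.hyps(3) by blast
      then have "e \<in> translate \<Gamma> T A \<longleftrightarrow> e \<in> A" using tr by blast
      then show ?thesis by (simp only: edge_weight_outside[OF 3])
    qed
  qed
qed

lemma edge_weight_equiv:
  assumes "(p, q) \<in> cube_equiv \<Gamma>"
  shows "edge_weight p = edge_weight q"
proof -
  have "equivclp (cube_glue \<Gamma>) p q" using assms by (simp add: cube_equiv_def)
  then show ?thesis by (induction rule: equivclp_induct) (auto dest: edge_weight_glue)
qed

definition class_weight :: "'e cube_point set \<Rightarrow> 'e \<Rightarrow> real" where
  "class_weight C = edge_weight (SOME p. p \<in> C)"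

lemma class_weight:
  assumes "p \<in> topspace (cube_sum \<Gamma>)"
  shows "class_weight (cube_class \<Gamma> p) = edge_weight p"
proof -
  have "p \<in> cube_class \<Gamma> p"
    using equiv_class_self[OF equiv_cube_equiv assms] by (simp add: cube_class_def)
  then have "(SOME q. q \<in> cube_class \<Gamma> p) \<in> cube_class \<Gamma> p" by (rule someI)
  then have "(p, SOME q. q \<in> cube_class \<Gamma> p) \<in> cube_equiv \<Gamma>" by (simp add: cube_class_def)
  then show ?thesis unfolding class_weight_def by (rule edge_weight_equiv[symmetric])
qed

lemma continuous_map_edge_weight: "continuous_map (cube_sum \<Gamma>) euclidean edge_weight"
proof -
  have comp: "continuous_map (product_topology (\<lambda>_. top_of_set {0..1}) S) euclidean
      (\<lambda>x. edge_weight ((A, S), x))" if b: "(A, S) \<in> based_cubes \<Gamma>" for A S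
  proof -
    have "continuous_map (product_topology (\<lambda>_. top_of_set {0..1::real}) S) euclideanreal
        (\<lambda>x. edge_weight ((A, S), x) e)" for e
    proof -
      have "continuous_map (product_topology (\<lambda>_. top_of_set {0..1::real}) S) euclideanreal (\<lambda>x. x s)"
        if "s \<in> S" for s
        using continuous_map_product_projection[OF that] by (rule continuous_map_into_fulltopology)
      moreover have "finite S" by (rule based_cubesD(2)[OF b])
      ultimately have "continuous_map (product_topology (\<lambda>_. top_of_set {0..1::real}) S) euclideanreal
          (\<lambda>x. \<Sum>s | s \<in> S \<and> e \<in> s. x s)"
        by (intro continuous_map_sum) simp_all
      then show ?thesis
        by (cases "e \<in> A") (simp_all add: edge_weight_def continuous_map_diff)
    qed
    then show ?thesis
      unfolding euclidean_product_topology[symmetric] by (simp add: continuous_map_componentwise_UNIV)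
  qed
  show ?thesis
    unfolding continuous_map_def
  proof (intro conjI allI impI)
    fix U :: "('e \<Rightarrow> real) set" assume U: "openin euclidean U"
    show "openin (cube_sum \<Gamma>) {p \<in> topspace (cube_sum \<Gamma>). edge_weight p \<in> U}"
      unfolding cube_sum_def openin_sum_topology
    proof (intro conjI ballI)
      fix c assume c: "c \<in> based_cubes \<Gamma>"
      obtain A S where AS: "c = (A, S)" by (cases c)
      have "openin (product_topology (\<lambda>_. top_of_set {0..1}) S)
          {x \<in> topspace (product_topology (\<lambda>_. top_of_set {0..1}) S). edge_weight ((A, S), x) \<in> U}"
        using openin_continuous_map_preimage[OF comp U] c AS by simp
      moreover have "{x. (c, x) \<in> {p \<in> topspace (sum_topology
          (\<lambda>(A, S). product_topology (\<lambda>_. top_of_set {0..1}) S) (based_cubes \<Gamma>)). edge_weight p \<in> U}} =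
          {x \<in> topspace (product_topology (\<lambda>_. top_of_set {0..1}) S). edge_weight ((A, S), x) \<in> U}"
        using c AS by simp
      ultimately show "openin (case c of (A, S) \<Rightarrow> product_topology (\<lambda>_. top_of_set {0..1}) S)
          {x. (c, x) \<in> {p \<in> topspace (sum_topology
          (\<lambda>(A, S). product_topology (\<lambda>_. top_of_set {0..1}) S) (based_cubes \<Gamma>)). edge_weight p \<in> U}}"
        using AS by simp
    qed auto
  qed simp
qed

lemma continuous_map_class_weight: "continuous_map (cubed_complex \<Gamma>) euclidean class_weight"
proof (rule continuous_compose_quotient_map)
  show "quotient_map (cube_sum \<Gamma>) (cubed_complex \<Gamma>) (\<lambda>p. cube_equiv \<Gamma> `` {p})"
    unfolding cubed_complex_def by (rule quotient_map_quotient_topology)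
  show "continuous_map (cube_sum \<Gamma>) euclidean (class_weight \<circ> (\<lambda>p. cube_equiv \<Gamma> `` {p}))"
    using continuous_map_edge_weight
    by (rule continuous_map_eq) (simp add: class_weight flip: cube_class_def)
qed

section \<open>The cubes of the dimer complex\<close>

definition dimer_cubes :: "'e based_cube set" where
  "dimer_cubes = {c \<in> based_cubes \<Gamma>. cube_vertices \<Gamma> c \<subseteq> D}"

definition dimer_points :: "'e cube_point set" where
  "dimer_points = {((A, S), x) | A S x. (A, S) \<in> dimer_cubes \<and> x \<in> S \<rightarrow>\<^sub>E {0..1}}"

lemma dimer_points_subset: "dimer_points \<subseteq> topspace (cube_sum \<Gamma>)"
  unfolding dimer_points_def dimer_cubes_def using topspace_cube_sum by blast

lemma dimer_complex_eq:
  "dimer_complex \<Gamma> = subtopology (cubed_complex \<Gamma>) (cube_class \<Gamma> ` dimer_points)"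
proof -
  have "{cube_class \<Gamma> (c, x) | c x. (c, x) \<in> topspace (cube_sum \<Gamma>) \<and>
      cube_vertices \<Gamma> c \<subseteq> dimer_coverings \<Gamma>} = cube_class \<Gamma> ` dimer_points"
    unfolding dimer_points_def dimer_cubes_def by (auto simp: topspace_cube_sum image_iff)
  then show ?thesis unfolding dimer_complex_def by simp
qed

lemma topspace_dimer_complex: "topspace (dimer_complex \<Gamma>) = cube_class \<Gamma> ` dimer_points"
proof -
  have "cube_class \<Gamma> ` dimer_points \<subseteq> topspace (cubed_complex \<Gamma>)"
    using dimer_points_subset unfolding cubed_complex_def cube_class_def
    by (auto simp: quotientI)
  then show ?thesis unfolding dimer_complex_eq by auto
qed

lemma finite_dimer_cubes: "finite dimer_cubes"
proof (rule finite_subset)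
  show "dimer_cubes \<subseteq> Pow E \<times> Pow (Pow E)"
    unfolding dimer_cubes_def using based_cubesD(1,3) even_cycle_subset by fast
qed simp

text \<open>There are only finitely many dimer cubes, each compact inside the topological sum.
  Compactness passes to the image of their union in the quotient.\<close>

lemma compact_dimer_complex: "compact_space (dimer_complex \<Gamma>)"
proof -
  let ?X = "\<lambda>c :: 'e based_cube. product_topology (\<lambda>_. top_of_set {0..1::real}) (snd c)"
  have cs: "cube_sum \<Gamma> = sum_topology ?X (based_cubes \<Gamma>)"
    unfolding cube_sum_def by (simp add: case_prod_unfold)
  have "compactin (cube_sum \<Gamma>) (Pair c ` topspace (?X c))" if "c \<in> dimer_cubes" for c
  proof (rule image_compactin)
    have "compact_space (?X c)"
      by (simp add: compact_space_product_topology compact_space_subtopology)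
    then show "compactin (?X c) (topspace (?X c))" unfolding compact_space_def .
    show "continuous_map (?X c) (cube_sum \<Gamma>) (Pair c)"
      unfolding cs using that by (intro continuous_map_component_injection) (simp add: dimer_cubes_def)
  qed
  then have "compactin (cube_sum \<Gamma>) (\<Union>((\<lambda>c. Pair c ` topspace (?X c)) ` dimer_cubes))"
    using finite_dimer_cubes by (intro compactin_Union) auto
  moreover have "(\<Union>((\<lambda>c. Pair c ` topspace (?X c)) ` dimer_cubes)) = dimer_points"
    unfolding dimer_points_def by force
  ultimately have "compactin (cube_sum \<Gamma>) dimer_points" by simp
  moreover have "continuous_map (cube_sum \<Gamma>) (cubed_complex \<Gamma>) (cube_class \<Gamma>)"
    using quotient_imp_continuous_map[OF quotient_map_quotient_topology]
    unfolding cubed_complex_def cube_class_def by blast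
  ultimately have "compactin (cubed_complex \<Gamma>) (cube_class \<Gamma> ` dimer_points)"
    by (rule image_compactin)
  then show ?thesis unfolding dimer_complex_eq by (rule compact_space_subtopology)
qed

lemma dimer_cubesD:
  assumes "(A, S) \<in> dimer_cubes"
  shows "(A, S) \<in> based_cubes \<Gamma>" "\<And>T. T \<subseteq> S \<Longrightarrow> translate \<Gamma> T A \<in> D" "A \<in> D"
proof -
  show b: "(A, S) \<in> based_cubes \<Gamma>" using assms by (simp add: dimer_cubes_def)
  show T: "translate \<Gamma> T A \<in> D" if "T \<subseteq> S" for T
    using assms that unfolding dimer_cubes_def cube_vertices_def by blast
  have "translate \<Gamma> {} A = A" using translate_iff[OF b, of "{}"] by blast
  then show "A \<in> D" using T[of "{}"] by simp
qed

text \<open>The cell is spanned by \<open>A\<close> and the opposite vertex of the cube, obtained by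
  flipping all cycles.\<close>

lemma edge_weight_span:
  assumes c: "(A, S) \<in> dimer_cubes" and x: "x \<in> S \<rightarrow>\<^sub>E {0..1}"
  shows "edge_weight ((A, S), x) \<in> mspan A (translate \<Gamma> S A)"
proof -
  let ?B = "translate \<Gamma> S A" and ?a = "edge_weight ((A, S), x)"
  note b = dimer_cubesD(1)[OF c] and A = dimer_cubesD(3)[OF c]
  have B: "?B \<in> D" by (rule dimer_cubesD(2)[OF c]) simp
  note tr = translate_iff[OF b order_refl]
  have x01: "0 \<le> x s" "x s \<le> 1" if "s \<in> S" for s using x that by (auto simp: PiE_iff)
  have "0 \<le> ?a e" for e
  proof (cases "e \<in> \<Union>S")
    case True
    then obtain s where "s \<in> S" "e \<in> s" by blast
    then show ?thesis using edge_weight_cycle[OF b, of s e x] x01[of s] by simp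
  next
    case False
    then show ?thesis by (simp only: edge_weight_outside[OF False]) simp
  qed
  moreover have supp: "?a e = 0" if "e \<notin> A \<union> ?B" for e
  proof -
    have e: "e \<notin> \<Union>S" "e \<notin> A" using that tr by blast+
    show ?thesis using e(2) by (simp only: edge_weight_outside[OF e(1)] if_False)
  qed
  moreover have "(\<Sum>e | e \<in> E \<and> v \<in> ends \<Gamma> e. ?a e) = 1" if v: "v \<in> V" for v
  proof -
    have "(\<Sum>e | e \<in> E \<and> v \<in> ends \<Gamma> e. ?a e) = (\<Sum>e\<in>{edg A v, edg ?B v}. ?a e)"
    proof (rule sum.mono_neutral_right)
      show "{edg A v, edg ?B v} \<subseteq> {e \<in> E. v \<in> ends \<Gamma> e}"
        using A B v edg_in edg_end dimer_subset by blast
      show "\<forall>e\<in>{e \<in> E. v \<in> ends \<Gamma> e} - {edg A v, edg ?B v}. ?a e = 0"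
        using supp edg_eq[OF A v] edg_eq[OF B v] by blast
    qed simp
    also have "\<dots> = 1"
    \<comment> \<open>A common edge lies on no cycle and has weight 1. Otherwise both edges lie on
      cycles, which coincide because they meet at \<open>v\<close>, and the weights are
      \<open>1 - x s\<close> and \<open>x s\<close>.\<close>
    proof (cases "edg A v = edg ?B v")
      case True
      then have "edg A v \<in> A" "edg A v \<in> ?B" using edg_in[OF A v] edg_in[OF B v] by simp_all
      moreover from this have e: "edg A v \<notin> \<Union>S" using tr by blast
      ultimately have "?a (edg A v) = 1" by (simp only: edge_weight_outside[OF e] if_True)
      then show ?thesis using True by simp
    next
      case False
      have "edg A v \<in> A" "edg A v \<notin> ?B" "edg ?B v \<in> ?B" "edg ?B v \<notin> A"
        using False edg_in[OF A v] edg_in[OF B v] edg_end[OF A v] edg_end[OF B v] edg_eq[OF A v] edg_eq[OF B v]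
        by metis+
      then obtain s t where st: "s \<in> S" "edg A v \<in> s" "t \<in> S" "edg ?B v \<in> t" using tr by blast
      then have "s = t" using based_cube_eq_at_vertex[OF b] edg_end[OF A v] edg_end[OF B v] by blast
      then show ?thesis
        using False st edge_weight_cycle[OF b st(1,2), of x] edge_weight_cycle[OF b st(3,4), of x]
          \<open>edg A v \<in> A\<close> \<open>edg ?B v \<notin> A\<close> by simp
    qed
    finally show ?thesis .
  qed
  ultimately show ?thesis unfolding mspan_def by blast
qed

section \<open>The cycles of a pair of dimer coverings\<close>

definition mate :: "'e set \<Rightarrow> 'v \<Rightarrow> 'v" where
  "mate A v = (THE w. ends \<Gamma> (edg A v) = {v, w})"

lemma mate:
  assumes A: "A \<in> D" and v: "v \<in> V"
  shows "ends \<Gamma> (edg A v) = {v, mate A v}" "mate A v \<noteq> v" "mate A v \<in> V"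
    "edg A (mate A v) = edg A v" "mate A (mate A v) = v"
proof -
  have e: "edg A v \<in> E" using edg_in[OF A v] dimer_subset[OF A] by blast
  have unique: "mate A u = w" if "ends \<Gamma> (edg A u) = {u, w}" for u w
    unfolding mate_def using that by (intro the_equality) (auto simp: doubleton_eq_iff)
  obtain x y where xy: "ends \<Gamma> (edg A v) = {x, y}" "x \<noteq> y"
    using card_ends[OF e] unfolding card_2_iff by blast
  define w where "w = (if v = x then y else x)"
  have w: "ends \<Gamma> (edg A v) = {v, w}" "w \<noteq> v"
    using xy edg_end[OF A v] unfolding w_def by auto
  have eq: "mate A v = w" by (rule unique[OF w(1)])
  have wV: "w \<in> V" using ends_subset[OF e] w(1) by blast
  have edg: "edg A w = edg A v"
    using edg_eq[OF A wV edg_in[OF A v]] w(1) by blast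
  have "mate A w = v" by (rule unique) (use edg w(1) in auto)
  then show "ends \<Gamma> (edg A v) = {v, mate A v}" "mate A v \<noteq> v" "mate A v \<in> V"
    "edg A (mate A v) = edg A v" "mate A (mate A v) = v"
    using eq w wV edg by simp_all
qed

text \<open>For a vertex \<open>v\<close> of \<Gamma>, the vertices of the component of
  \<open>A \<union> B\<close> containing \<open>v\<close>. A single edge common to \<open>A\<close>
  and \<open>B\<close> is the degenerate case.\<close>

inductive_set mate_orbit :: "'e set \<Rightarrow> 'e set \<Rightarrow> 'v \<Rightarrow> 'v set" for A B v where
  base: "v \<in> mate_orbit A B v"
| left: "u \<in> mate_orbit A B v \<Longrightarrow> mate A u \<in> mate_orbit A B v"
| right: "u \<in> mate_orbit A B v \<Longrightarrow> mate B u \<in> mate_orbit A B v"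

definition orbit_edges :: "'e set \<Rightarrow> 'e set \<Rightarrow> 'v \<Rightarrow> 'e set" where
  "orbit_edges A B v = edg A ` mate_orbit A B v \<union> edg B ` mate_orbit A B v"

definition walk :: "'e set \<Rightarrow> 'e set \<Rightarrow> 'v \<Rightarrow> nat \<Rightarrow> 'v" where
  "walk A B v = rec_nat v (\<lambda>i. mate (if even i then A else B))"

end

section \<open>Alternating walks along two dimer coverings\<close>

locale dimer_pair = finite_multigraph \<Gamma> for \<Gamma> :: "('v, 'e) multigraph" +
  fixes A B :: "'e set"
  assumes A: "A \<in> dimer_coverings \<Gamma>" and B: "B \<in> dimer_coverings \<Gamma>"
begin

lemma orbit_V: "u \<in> mate_orbit A B v \<Longrightarrow> v \<in> V \<Longrightarrow> u \<in> V"
  by (induction rule: mate_orbit.induct) (simp_all add: mate(3) A B)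

lemma orbit_trans: "w \<in> mate_orbit A B u \<Longrightarrow> u \<in> mate_orbit A B v \<Longrightarrow> w \<in> mate_orbit A B v"
  by (induction rule: mate_orbit.induct) (simp_all add: mate_orbit.intros)

lemma orbit_sym:
  assumes "u \<in> mate_orbit A B v" "v \<in> V"
  shows "v \<in> mate_orbit A B u"
  using assms(1)
proof (induction rule: mate_orbit.induct)
  case base
  show ?case by (rule mate_orbit.base)
next
  case (left u)
  have "u \<in> mate_orbit A B (mate A u)"
    using mate_orbit.left[of "mate A u" A B "mate A u", OF mate_orbit.base] mate(5)[OF A orbit_V[OF left(1) assms(2)]] by simp
  then show ?case using orbit_trans left by blast
next
  case (right u)
  have "u \<in> mate_orbit A B (mate B u)"
    using mate_orbit.right[of "mate B u" A B "mate B u", OF mate_orbit.base] mate(5)[OF B orbit_V[OF right(1) assms(2)]] by simp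
  then show ?case using orbit_trans right by blast
qed

lemma orbit_eq: "u \<in> mate_orbit A B v \<Longrightarrow> v \<in> V \<Longrightarrow> mate_orbit A B u = mate_orbit A B v"
  using orbit_trans orbit_sym by blast

definition split :: "'v \<Rightarrow> bool" where
  "split v \<longleftrightarrow> v \<in> V \<and> edg A v \<noteq> edg B v"

lemma edg_mem:
  assumes "v \<in> V"
  shows "edg A v \<in> B \<longleftrightarrow> edg A v = edg B v" "edg B v \<in> A \<longleftrightarrow> edg A v = edg B v"
  using edg_eq[OF A assms] edg_eq[OF B assms] edg_in[OF A assms] edg_in[OF B assms]
    edg_end[OF A assms] edg_end[OF B assms] by metis+

text \<open>The edge of \<open>A\<close> at \<open>v\<close> is not in \<open>B\<close>, so at its
  other end \<open>B\<close> must use a different edge; likewise with the roles exchanged.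
  Disagreement thus spreads over the whole orbit.\<close>

lemma split_mate:
  assumes "split v"
  shows "split (mate A v)" "split (mate B v)"
proof -
  have v: "v \<in> V" "edg A v \<noteq> edg B v" using assms by (simp_all add: split_def)
  have "edg A (mate A v) \<notin> B" using edg_mem(1)[OF v(1)] v(2) mate(4)[OF A v(1)] by simp
  then show "split (mate A v)"
    using edg_mem(1)[of "mate A v"] mate(3)[OF A v(1)] edg_in[OF B] unfolding split_def by metis
  have "edg B (mate B v) \<notin> A" using edg_mem(2)[OF v(1)] v(2) mate(4)[OF B v(1)] by simp
  then show "split (mate B v)"
    using edg_mem(2)[of "mate B v"] mate(3)[OF B v(1)] edg_in[OF A] unfolding split_def by metis
qed

lemma split_orbit: "u \<in> mate_orbit A B v \<Longrightarrow> split v \<Longrightarrow> split u"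
  by (induction rule: mate_orbit.induct) (simp_all add: split_mate)

lemma split_V: "split v \<Longrightarrow> v \<in> V"
  by (simp add: split_def)

lemma orbit_edges_subset: "v \<in> V \<Longrightarrow> orbit_edges A B v \<subseteq> E"
  using orbit_V edg_in[OF A] edg_in[OF B] dimer_subset[OF A] dimer_subset[OF B]
  unfolding orbit_edges_def by blast

lemma orbit_edges_end:
  assumes "v \<in> V" "e \<in> orbit_edges A B v" "u \<in> ends \<Gamma> e"
  shows "u \<in> mate_orbit A B v"
proof -
  consider w where "w \<in> mate_orbit A B v" "e = edg A w" | w where "w \<in> mate_orbit A B v" "e = edg B w"
    using assms(2) unfolding orbit_edges_def by blast
  then show ?thesis
  proof cases
    case 1
    then have "u = w \<or> u = mate A w" using assms(3) mate(1)[OF A orbit_V[OF 1(1) assms(1)]] by simp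
    then show ?thesis using 1(1) mate_orbit.left by blast
  next
    case 2
    then have "u = w \<or> u = mate B w" using assms(3) mate(1)[OF B orbit_V[OF 2(1) assms(1)]] by simp
    then show ?thesis using 2(1) mate_orbit.right by blast
  qed
qed

lemma orbit_edges_at:
  assumes "v \<in> V" "u \<in> V"
  shows "{e \<in> orbit_edges A B v. u \<in> ends \<Gamma> e} = (if u \<in> mate_orbit A B v then {edg A u, edg B u} else {})"
proof (cases "u \<in> mate_orbit A B v")
  case True
  have "e \<in> {edg A u, edg B u}" if "e \<in> orbit_edges A B v" "u \<in> ends \<Gamma> e" for e
  proof -
    have "e \<in> A \<or> e \<in> B"
      using that(1) orbit_V[OF _ assms(1)] edg_in[OF A] edg_in[OF B] unfolding orbit_edges_def by blast
    then show ?thesis using edg_eq[OF A assms(2)] edg_eq[OF B assms(2)] that(2) by blast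
  qed
  moreover have "edg A u \<in> orbit_edges A B v" "edg B u \<in> orbit_edges A B v"
    using True unfolding orbit_edges_def by blast+
  ultimately show ?thesis
    using True edg_end[OF A assms(2)] edg_end[OF B assms(2)] by auto
next
  case False
  then show ?thesis using orbit_edges_end[OF assms(1)] by auto
qed

lemma walk_0 [simp]: "walk A B v 0 = v"
  and walk_Suc [simp]: "walk A B v (Suc i) = mate (if even i then A else B) (walk A B v i)"
  by (simp_all add: walk_def)

lemma walk_orbit: "walk A B v i \<in> mate_orbit A B v"
  by (induction i) (auto intro: mate_orbit.intros)

lemma walk_V: "v \<in> V \<Longrightarrow> walk A B v i \<in> V"
  using walk_orbit orbit_V by blast

lemma walk_back:
  assumes "v \<in> V"
  shows "mate (if even i then A else B) (walk A B v (Suc i)) = walk A B v i"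
  using mate(5)[OF A walk_V[OF assms]] mate(5)[OF B walk_V[OF assms]] by simp

text \<open>From a coincidence, step forward on the left and backward on the right. Both steps use
  the same covering, as their indices have equal parity, and the gap shrinks by two. A gap of one is
  impossible because a mate differs from its vertex.\<close>

lemma walk_odd_gap:
  assumes "v \<in> V"
  shows "walk A B v i \<noteq> walk A B v (i + 2 * k + 1)"
proof (induction k arbitrary: i)
  case 0
  have "walk A B v (Suc i) \<noteq> walk A B v i"
    using mate(2)[OF A walk_V[OF assms], of i] mate(2)[OF B walk_V[OF assms], of i] by simp
  then show ?case by simp
next
  case (Suc k)
  show ?case
  proof
    assume eq: "walk A B v i = walk A B v (i + 2 * Suc k + 1)"
    have "walk A B v (Suc i) = mate (if even i then A else B) (walk A B v i)" by simp
    also have "\<dots> = mate (if even (i + 2 * Suc k) then A else B) (walk A B v (Suc (i + 2 * Suc k)))"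
      using eq by simp
    also have "\<dots> = walk A B v (i + 2 * Suc k)" by (rule walk_back[OF assms])
    also have "i + 2 * Suc k = Suc i + 2 * k + 1" by simp
    finally show False using Suc by blast
  qed
qed

lemma walk_even_gap:
  assumes "v \<in> V" "even k" "walk A B v i = walk A B v (i + k)"
  shows "walk A B v k = v"
  using assms(3)
proof (induction i)
  case (Suc i)
  have "walk A B v i = mate (if even i then A else B) (walk A B v (Suc i))"
    by (rule walk_back[OF assms(1), symmetric])
  also have "\<dots> = mate (if even (i + k) then A else B) (walk A B v (Suc (i + k)))"
    using Suc.prems assms(2) by simp
  also have "\<dots> = walk A B v (i + k)" by (rule walk_back[OF assms(1)])
  finally show ?case by (rule Suc.IH)
qed simp

text \<open>The walk repeats a vertex since there are finitely many. The gap is even, so both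
  occurrences can be walked back together until the earlier one is \<open>v\<close>. The least
  positive even return time admits no earlier repetition.\<close>

lemma ex_period:
  assumes "v \<in> V"
  shows "\<exists>n>0. even n \<and> walk A B v n = v \<and> inj_on (walk A B v) {..<n}"
proof -
  have gap: "even k \<and> walk A B v k = v" if "walk A B v i = walk A B v (i + k)" for i k
  proof
    show "even k"
    proof (rule ccontr)
      assume "odd k"
      then obtain m where "k = 2 * m + 1" by (elim oddE)
      then show False using walk_odd_gap[OF assms, of i m] that by (simp add: add.assoc)
    qed
    then show "walk A B v k = v" using walk_even_gap[OF assms _ that] by blast
  qed
  have "\<not> inj (walk A B v)"
  proof
    assume "inj (walk A B v)"
    moreover have "finite (range (walk A B v))"
      using finite_V walk_V[OF assms] by (meson finite_subset image_subsetI)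
    ultimately show False using finite_imageD infinite_UNIV_nat by blast
  qed
  then obtain i j where ij: "i < j" "walk A B v i = walk A B v j"
    unfolding inj_def by (metis linorder_neqE_nat)
  define P where "P n \<longleftrightarrow> n > 0 \<and> even n \<and> walk A B v n = v" for n
  have "P (j - i)" using gap[of i "j - i"] ij unfolding P_def by simp
  define n where "n = (LEAST n. P n)"
  have n: "P n" unfolding n_def by (rule LeastI[of P, OF \<open>P (j - i)\<close>])
  have least: "\<not> P m" if "m < n" for m using that unfolding n_def by (rule not_less_Least)
  have "inj_on (walk A B v) {..<n}"
  proof (rule linorder_inj_onI')
    fix k l assume kl: "k \<in> {..<n}" "l \<in> {..<n}" "k < l"
    show "walk A B v k \<noteq> walk A B v l"
    proof
      assume "walk A B v k = walk A B v l"
      then have "P (l - k)" using gap[of k "l - k"] kl unfolding P_def by simp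
      moreover have "l - k < n" using kl by (intro less_imp_diff_less) simp
      ultimately show False using least by blast
    qed
  qed
  then show ?thesis using n unfolding P_def by blast
qed

lemma orbit_edges_even_cycle:
  assumes "split v"
  shows "even_cycle \<Gamma> (orbit_edges A B v)"
proof -
  have v: "v \<in> V" by (rule split_V[OF assms])
  obtain n where n: "n > 0" "even n" "walk A B v n = v" "inj_on (walk A B v) {..<n}"
    using ex_period[OF v] by blast
  let ?w = "walk A B v" and ?C = "\<lambda>i. if even i then A else B"
  let ?e = "\<lambda>i. edg (?C i) (?w i)"
  have n2: "2 \<le> n" using n(1,2) by presburger
  have C: "?C i \<in> D" for i using A B by simp
  have split_w: "split (?w i)" for i using split_orbit[OF walk_orbit assms] .
  have w_mod: "?w (Suc i mod n) = ?w (Suc i)" if "i < n" for i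
  proof (cases "Suc i = n")
    case True
    then show ?thesis using n(3) by (simp del: walk_Suc)
  next
    case False
    then show ?thesis using that by simp
  qed
  have ends: "ends \<Gamma> (?e i) = {?w i, ?w (Suc i)}" for i
    using mate(1)[OF C[of i] walk_V[OF v, of i]] by simp
  have mod_parity: "even (Suc i mod n) \<longleftrightarrow> odd i" if "i < n" for i
    using that n(2) by (cases "Suc i = n") auto
  \<comment> \<open>Even positions carry edges of \<open>A\<close> and odd ones edges of
    \<open>B\<close>. At split vertices these are never the same edge.\<close>
  have e_parity: "even i \<longleftrightarrow> even j" if "?e i = ?e j" for i j
  proof (rule ccontr)
    assume *: "even i \<noteq> even j"
    have no: "edg A (?w k) \<noteq> edg B (?w l)" for k l
      using edg_mem(1)[OF walk_V[OF v], of k] split_w[of k] edg_in[OF B walk_V[OF v], of l]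
      unfolding split_def by metis
    then show False using * that no[of i j] no[of j i] by (cases "even i") auto
  qed
  \<comment> \<open>Equal edges have the same two ends. If they were traversed in opposite
    directions, \<open>j\<close> would be the successor of \<open>i\<close> modulo \<open>n\<close>;
    as \<open>n\<close> is even, that contradicts equal parity.\<close>
  have inj_e: "inj_on ?e {..<n}"
  proof (rule inj_onI)
    fix i j assume ij: "i \<in> {..<n}" "j \<in> {..<n}" "?e i = ?e j"
    then have par: "even i \<longleftrightarrow> even j" using e_parity by blast
    have "{?w i, ?w (Suc i)} = {?w j, ?w (Suc j)}"
      using ends[of i] ends[of j] ij(3) by (simp only:)
    then have "?w j \<in> {?w i, ?w (Suc i mod n)}"
      using w_mod[of i] ij(1) by (simp only: lessThan_iff) blast
    moreover have "?w j \<noteq> ?w (Suc i mod n)"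
    proof
      assume "?w j = ?w (Suc i mod n)"
      then have "j = Suc i mod n" using n(4) ij n(1) by (simp add: inj_on_def)
      then show False using mod_parity[of i] par ij by simp
    qed
    ultimately have "?w j = ?w i" by simp
    then show "i = j" using n(4) ij by (simp add: inj_on_def)
  qed
  have range: "?w i \<in> ?w ` {..<n}" for i
  proof (induction i)
    case 0
    then show ?case using n(1) by (intro image_eqI[of _ _ 0]) simp_all
  next
    case (Suc i)
    then obtain j where j: "j < n" "?w i = ?w j" by auto
    have "even i \<longleftrightarrow> even j"
    proof (rule ccontr)
      assume odd: "even i \<noteq> even j"
      have "\<exists>k. i = j + 2 * k + 1 \<or> j = i + 2 * k + 1" using odd by presburger
      then show False using walk_odd_gap[OF v] j(2) by metis
    qed
    then have "?w (Suc i) = ?w (Suc j)" using j(2) by simp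
    also have "\<dots> = ?w (Suc j mod n)" using w_mod[OF j(1)] by simp
    finally show ?case using n(1) by auto
  qed
  have prev: "?w (Suc (i + n - 1)) = ?w i" if "i < n" for i
  proof -
    have "?w (i + n) = ?w i"
    proof (induction i)
      case 0
      then show ?case using n(3) by simp
    next
      case (Suc i)
      then show ?case using n(2) by simp
    qed
    moreover have "Suc (i + n - 1) = i + n" using n(1) by simp
    ultimately show ?thesis by (simp only:)
  qed
  \<comment> \<open>The edges at \<open>?w i\<close> are the one leaving along the walk and the one
    arriving. The arriving one gets the index \<open>i + n - 1\<close>, which avoids a case split at
    0 and has the right parity because \<open>n\<close> is even.\<close>
  have edges_range: "edg X (?w i) \<in> ?e ` {..<n}" if i: "i < n" and X: "X = A \<or> X = B" for X i
  proof (cases "X = ?C i")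
    case True
    then show ?thesis using i by blast
  next
    case False
    define k where "k = i + n - 1"
    have k: "Suc k = i + n" using n(1) unfolding k_def by simp
    then have "even k \<longleftrightarrow> odd i" using n(2) by presburger
    then have Xk: "X = ?C k" using False X by auto
    have "?w i = ?w (Suc k)" using prev[OF i] unfolding k_def by simp
    then have "edg X (?w i) = ?e k" using mate(4)[OF C walk_V[OF v], of k] Xk by simp
    moreover have "?e k \<in> ?e ` {..<n}"
    proof (cases i)
      case 0
      then have "k < n" using k by simp
      then show ?thesis by blast
    next
      case (Suc i')
      then have "k = i' + n" using k by simp
      moreover from this have "?w k = ?w i'" using prev[of i'] Suc i n(1) by simp
      moreover have "even k \<longleftrightarrow> even i'" using \<open>k = i' + n\<close> n(2) by simp
      ultimately have "?e k = ?e i'" by simp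
      then show ?thesis using Suc i by auto
    qed
    ultimately show ?thesis by simp
  qed
  have mate_orbit: "mate_orbit A B v = ?w ` {..<n}"
  proof
    have closed: "mate X (?w i) \<in> ?w ` {..<n}" if i: "i < n" and X: "X = A \<or> X = B" for X i
    proof -
      obtain j where j: "j < n" "edg X (?w i) = ?e j" using edges_range[OF i X] by auto
      have "X \<in> D" using X A B by blast
      then have "mate X (?w i) \<in> ends \<Gamma> (?e j)"
        using mate(1)[OF _ walk_V[OF v], of X i] j(2) by simp
      then show ?thesis using ends[of j] range[of j] range[of "Suc j"] by auto
    qed
    show "mate_orbit A B v \<subseteq> ?w ` {..<n}"
    proof
      fix u assume "u \<in> mate_orbit A B v"
      then show "u \<in> ?w ` {..<n}"
      proof (induction rule: mate_orbit.induct)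
        case base
        then show ?case using range[of 0] by simp
      qed (use closed in auto)
    qed
    show "?w ` {..<n} \<subseteq> mate_orbit A B v" using walk_orbit by blast
  qed
  have edges: "orbit_edges A B v = ?e ` {..<n}"
  proof
    show "orbit_edges A B v \<subseteq> ?e ` {..<n}"
      unfolding orbit_edges_def mate_orbit using edges_range by blast
    show "?e ` {..<n} \<subseteq> orbit_edges A B v"
      unfolding orbit_edges_def using walk_orbit by auto
  qed
  have "single_circle \<Gamma> (orbit_edges A B v)"
    unfolding single_circle_def
  proof (intro exI conjI allI impI)
    show "2 \<le> n" "inj_on ?w {..<n}" "inj_on ?e {..<n}" "orbit_edges A B v = ?e ` {..<n}"
      by (fact n2 n(4) inj_e edges)+
    show "ends \<Gamma> (?e i) = {?w i, ?w (Suc i mod n)}" if "i < n" for i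
      using ends[of i] w_mod[OF that] by simp
  qed
  moreover have "even (card (orbit_edges A B v))"
    using edges inj_e n(2) by (simp add: card_image)
  moreover have "cyclic_set \<Gamma> (orbit_edges A B v)"
    unfolding cyclic_set_def
  proof (intro conjI ballI)
    show "orbit_edges A B v \<subseteq> E" by (rule orbit_edges_subset[OF v])
    show "finite (orbit_edges A B v)" using edges by simp
    fix u assume u: "u \<in> V"
    show "card {e \<in> orbit_edges A B v. u \<in> ends \<Gamma> e} = 2 \<or> {e \<in> orbit_edges A B v. u \<in> ends \<Gamma> e} = {}"
      using orbit_edges_at[OF v u] split_orbit[OF _ assms, of u] unfolding split_def by simp
  qed
  ultimately show ?thesis unfolding even_cycle_def by blast
qed

section \<open>The cube spanned by two dimer coverings\<close>

definition cycles :: "'e set set" where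
  "cycles = orbit_edges A B ` {v. split v}"

lemma cyclesE:
  assumes "s \<in> cycles"
  obtains v where "split v" "v \<in> V" "s = orbit_edges A B v"
  using assms split_V unfolding cycles_def by blast

lemma cycles_based: "(A, cycles) \<in> based_cubes \<Gamma>"
proof -
  have "cycles \<subseteq> Pow E"
    using orbit_edges_subset by (auto elim!: cyclesE)
  then have "finite cycles" by (rule finite_subset) simp
  moreover have "even_cycle \<Gamma> s" if "s \<in> cycles" for s
    using that orbit_edges_even_cycle by (auto elim!: cyclesE)
  moreover have "s = t" if st: "s \<in> cycles" "t \<in> cycles" and ef: "e \<in> s" "f \<in> t" "u \<in> ends \<Gamma> e" "u \<in> ends \<Gamma> f"
    for s t e f u
  proof -
    obtain v where v: "split v" "v \<in> V" "s = orbit_edges A B v" using st(1) by (rule cyclesE)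
    obtain w where w: "split w" "w \<in> V" "t = orbit_edges A B w" using st(2) by (rule cyclesE)
    have "mate_orbit A B u = mate_orbit A B v" "mate_orbit A B u = mate_orbit A B w"
      using orbit_eq orbit_edges_end ef v w by blast+
    then show ?thesis using v(3) w(3) by (simp add: orbit_edges_def)
  qed
  then have "pairwise (indep_edge_sets \<Gamma>) cycles"
    unfolding pairwise_def indep_edge_sets_def by blast
  ultimately show ?thesis
    using dimer_subset[OF A] by (simp add: based_cubes_def power_group_def)
qed

text \<open>Flipping the cycles in \<open>T\<close> replaces the edge of \<open>A\<close> by that of
  \<open>B\<close> at the vertices of these cycles and changes nothing at the others.\<close>

lemma cycles_dimer: "(A, cycles) \<in> dimer_cubes"
proof -
  have "translate \<Gamma> T A \<in> D" if T: "T \<subseteq> cycles" for T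
  proof (rule dimerI)
    note tr = translate_iff[OF cycles_based T]
    show "translate \<Gamma> T A \<subseteq> E"
      using tr dimer_subset[OF A] T even_cycle_subset based_cubesD(3)[OF cycles_based] by blast
    fix u assume u: "u \<in> V"
    have sub: "e \<in> {edg A u, edg B u}" if e: "e \<in> \<Union>T" "u \<in> ends \<Gamma> e" for e
    proof -
      obtain t where t: "t \<in> T" "e \<in> t" using e(1) by blast
      then obtain v where v: "split v" "v \<in> V" "t = orbit_edges A B v" using T cyclesE by blast
      have "e \<in> {e \<in> orbit_edges A B v. u \<in> ends \<Gamma> e}" using t v e(2) by simp
      then show ?thesis unfolding orbit_edges_at[OF v(2) u] by (simp split: if_splits)
    qed
    show "\<exists>e. {e \<in> translate \<Gamma> T A. u \<in> ends \<Gamma> e} = {e}"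
    proof (cases "\<exists>e\<in>\<Union>T. u \<in> ends \<Gamma> e")
      case True
      then obtain e t where t: "t \<in> T" "e \<in> t" "u \<in> ends \<Gamma> e" by blast
      then obtain v where v: "split v" "v \<in> V" "t = orbit_edges A B v" using T cyclesE by blast
      have "u \<in> mate_orbit A B v" using orbit_edges_end[OF v(2)] t v(3) by blast
      then have mem: "edg A u \<in> \<Union>T" "edg B u \<in> \<Union>T" and "split u"
        using t(1) v split_orbit unfolding orbit_edges_def by blast+
      have "edg A u \<noteq> edg B u" "edg B u \<notin> A"
        using \<open>split u\<close> edg_mem(2)[OF u] by (simp_all add: split_def)
      then have "e \<in> translate \<Gamma> T A \<and> u \<in> ends \<Gamma> e \<longleftrightarrow> e = edg B u" for e
        using tr[of e] sub[of e] mem edg_in[OF A u] edg_end[OF B u] edg_eq[OF A u, of e] by blast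
      then show ?thesis by auto
    next
      case False
      then have "e \<in> translate \<Gamma> T A \<and> u \<in> ends \<Gamma> e \<longleftrightarrow> e = edg A u" for e
        using tr[of e] edg_in[OF A u] edg_end[OF A u] edg_eq[OF A u, of e] by blast
      then show ?thesis by auto
    qed
  qed
  then show ?thesis using cycles_based unfolding dimer_cubes_def cube_vertices_def by blast
qed

text \<open>The two weights at a split vertex add up to 1. Crossing an edge of \<open>A\<close>
  preserves its weight, hence the complementary one; crossing an edge of \<open>B\<close> does not
  even change the edge. This constant is the coordinate of the cycle.\<close>

lemma span_orbit:
  assumes a: "a \<in> mspan A B" and "u \<in> mate_orbit A B v" and v: "split v"
  shows "a (edg B u) = a (edg B v)"
  using assms(2)
proof (induction rule: mate_orbit.induct)
  case (left u)
  have u: "split u" "split (mate A u)" using split_orbit[OF left(1) v] split_mate by blast+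
  then show ?case
    using span_vertex_sum(1)[OF a A B, of u] span_vertex_sum(1)[OF a A B, of "mate A u"]
      mate(4)[OF A, of u] left(2) unfolding split_def by simp
next
  case (right u)
  then show ?case using mate(4)[OF B, of u] orbit_V split_V[OF v] by simp
qed simp

lemma span_cycle:
  assumes a: "a \<in> mspan A B" and s: "s \<in> cycles"
  shows "\<exists>r\<in>{0..1}. \<forall>e\<in>s. a e = (if e \<in> A then 1 - r else r)"
proof -
  obtain v where v: "split v" "v \<in> V" "s = orbit_edges A B v" using s by (rule cyclesE)
  let ?r = "a (edg B v)"
  have sum: "a (edg A u) + a (edg B u) = 1" if "split u" for u
    using span_vertex_sum(1)[OF a A B, of u] that unfolding split_def by simp
  have nonneg: "0 \<le> a e" for e using a unfolding mspan_def by simp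
  have "?r \<in> {0..1}" using sum[OF v(1)] nonneg[of "edg A v"] nonneg[of "edg B v"] by simp
  moreover have "a e = (if e \<in> A then 1 - ?r else ?r)" if e: "e \<in> s" for e
  proof -
    consider u where "u \<in> mate_orbit A B v" "e = edg A u" | u where "u \<in> mate_orbit A B v" "e = edg B u"
      using e unfolding v(3) orbit_edges_def by blast
    then show ?thesis
    proof cases
      case 1
      then have "split u" using split_orbit v(1) by blast
      then show ?thesis
        using sum[of u] span_orbit[OF a 1(1) v(1)] 1(2) edg_in[OF A split_V, of u] by simp
    next
      case 2
      then have "split u" using split_orbit v(1) by blast
      then have "e \<notin> A" using edg_mem(2)[of u] 2(2) unfolding split_def by simp
      then show ?thesis using span_orbit[OF a 2(1) v(1)] 2(2) by simp
    qed
  qed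
  ultimately show ?thesis by blast
qed

lemma span_weight:
  assumes a: "a \<in> mspan A B"
  shows "\<exists>x \<in> cycles \<rightarrow>\<^sub>E {0..1}. edge_weight ((A, cycles), x) = a"
proof -
  obtain r where r: "\<And>s. s \<in> cycles \<Longrightarrow> r s \<in> {0..1}"
    "\<And>s e. s \<in> cycles \<Longrightarrow> e \<in> s \<Longrightarrow> a e = (if e \<in> A then 1 - r s else r s)"
    using span_cycle[OF a] by metis
  let ?x = "restrict r cycles"
  have "edge_weight ((A, cycles), ?x) e = a e" for e
  proof (cases "e \<in> \<Union>cycles")
    case True
    then obtain s where s: "s \<in> cycles" "e \<in> s" by blast
    then show ?thesis using edge_weight_cycle[OF cycles_based s] r(2)[OF s] by simp
  next
    case False
    \<comment> \<open>At an end of an edge of \<open>A\<close> or \<open>B\<close> off all cycles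
      the two coverings agree, so the edge has weight 1 there.\<close>
    have in_cycle: "edg A v = edg B v" if "v \<in> V" "e = edg A v \<or> e = edg B v" for v
    proof (rule ccontr)
      assume "edg A v \<noteq> edg B v"
      then have "orbit_edges A B v \<in> cycles" using that(1) unfolding cycles_def split_def by blast
      moreover have "e \<in> orbit_edges A B v"
        using that(2) mate_orbit.base unfolding orbit_edges_def by blast
      ultimately show False using False by blast
    qed
    have "a e = (if e \<in> A then 1 else 0)"
    proof (cases "e \<in> A \<union> B")
      case True
      then obtain v where v: "v \<in> V" "v \<in> ends \<Gamma> e"
        using ex_end dimer_subset[OF A] dimer_subset[OF B] by blast
      have "e = edg A v \<or> e = edg B v" using True edg_eq[OF A v(1) _ v(2)] edg_eq[OF B v(1) _ v(2)] by blast
      moreover from this have "edg A v = edg B v" using in_cycle v(1) by blast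
      ultimately show ?thesis
        using span_vertex_sum(2)[OF a A B v(1)] edg_in[OF A v(1)] by auto
    next
      case False
      then show ?thesis using a unfolding mspan_def by simp
    qed
    then show ?thesis by (simp only: edge_weight_outside[OF False])
  qed
  moreover have "?x \<in> cycles \<rightarrow>\<^sub>E {0..1}" using r(1) by simp
  ultimately show ?thesis by blast
qed

end

context finite_multigraph
begin

lemma weight_surj:
  assumes "a \<in> matching_complex"
  shows "\<exists>p\<in>dimer_points. edge_weight p = a"
proof -
  obtain A B where AB: "A \<in> D" "B \<in> D" "a \<in> mspan A B"
    using assms unfolding matching_complex_def by blast
  interpret dimer_pair \<Gamma> A B by unfold_locales (use AB in auto)
  show ?thesis using span_weight[OF AB(3)] cycles_dimer unfolding dimer_points_def by blast
qed

section \<open>Points with the same weights\<close>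

text \<open>Connectedness of the circle, as induction over edges with a common end.\<close>

lemma cycle_connected:
  assumes s: "even_cycle \<Gamma> s" and e: "e \<in> s" "P e" and f: "f \<in> s"
    and step: "\<And>e f. e \<in> s \<Longrightarrow> f \<in> s \<Longrightarrow> ends \<Gamma> e \<inter> ends \<Gamma> f \<noteq> {} \<Longrightarrow> P e \<Longrightarrow> P f"
  shows "P f"
proof -
  obtain n :: nat and v g where n: "2 \<le> n" and g: "s = g ` {..<n}"
    "\<And>i. i < n \<Longrightarrow> ends \<Gamma> (g i) = {v i, v (Suc i mod n)}"
    using s unfolding even_cycle_def single_circle_def by blast
  obtain i where i: "i < n" "e = g i" using e(1) g(1) by blast
  have "P (g ((i + k) mod n))" for k
  proof (induction k)
    case 0
    then show ?case using e(2) i by simp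
  next
    case (Suc k)
    let ?j = "(i + k) mod n"
    have j: "?j < n" "Suc ?j mod n < n" "Suc ?j mod n = (i + Suc k) mod n"
      using n by (simp_all add: mod_Suc_eq)
    have "v (Suc ?j mod n) \<in> ends \<Gamma> (g ?j) \<inter> ends \<Gamma> (g (Suc ?j mod n))"
      using g(2)[OF j(1)] g(2)[OF j(2)] by simp
    then have "P (g (Suc ?j mod n))"
      using step[of "g ?j" "g (Suc ?j mod n)"] g(1) j(1,2) Suc by blast
    then show ?case using j(3) by simp
  qed
  moreover obtain j where j: "j < n" "f = g j" using f g(1) by blast
  \<comment> \<open>After \<open>n - i + j\<close> steps the index is \<open>n + j\<close>, which is
    \<open>j\<close> modulo \<open>n\<close>; the shift by \<open>n\<close> keeps the count a
    natural number when \<open>j < i\<close>.\<close>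
  ultimately have "P (g ((i + (n - i + j)) mod n))" by blast
  then show ?thesis using i(1) j by simp
qed

text \<open>Coordinates 0 and 1 can be removed by gluing, so they are excluded. Alternation is
  essential: at \<open>x s = 1/2\<close> all edges of \<open>s\<close> weigh 1/2 whatever
  \<open>A \<inter> s\<close> is. With it, \<open>A \<inter> s\<close> is known up to complement in
  \<open>s\<close>, that is, up to a flip.\<close>

definition normal_point :: "'e cube_point \<Rightarrow> bool" where
  "normal_point = (\<lambda>((A, S), x). ((A, S), x) \<in> topspace (cube_sum \<Gamma>) \<and> (\<forall>s\<in>S. 0 < x s \<and> x s < 1) \<and>
     (\<forall>s\<in>S. \<forall>e\<in>s. \<forall>f\<in>s. e \<noteq> f \<longrightarrow> ends \<Gamma> e \<inter> ends \<Gamma> f \<noteq> {} \<longrightarrow> (e \<in> A) \<noteq> (f \<in> A)))"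

lemma normal_pointD:
  assumes "normal_point ((A, S), x)"
  shows "(A, S) \<in> based_cubes \<Gamma>" "x \<in> S \<rightarrow>\<^sub>E {0..1}" "((A, S), x) \<in> topspace (cube_sum \<Gamma>)"
    "\<And>s. s \<in> S \<Longrightarrow> 0 < x s" "\<And>s. s \<in> S \<Longrightarrow> x s < 1"
    "\<And>s e f. s \<in> S \<Longrightarrow> e \<in> s \<Longrightarrow> f \<in> s \<Longrightarrow> e \<noteq> f \<Longrightarrow> ends \<Gamma> e \<inter> ends \<Gamma> f \<noteq> {} \<Longrightarrow> (e \<in> A) \<noteq> (f \<in> A)"
  using assms unfolding normal_point_def by (simp_all add: topspace_cube_sum)

text \<open>Two edges with a common end cannot both lie in the dimer covering \<open>A\<close>. Nor
  can both be missing from it, since flipping \<open>s\<close> would put both into another dimer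
  covering.\<close>

lemma dimer_cube_alternates:
  assumes c: "(A, S) \<in> dimer_cubes" and s: "s \<in> S" "e \<in> s" "f \<in> s" "e \<noteq> f"
    and v: "ends \<Gamma> e \<inter> ends \<Gamma> f \<noteq> {}"
  shows "(e \<in> A) \<noteq> (f \<in> A)"
proof -
  note b = dimer_cubesD(1)[OF c] and A = dimer_cubesD(3)[OF c]
  obtain v where v: "v \<in> ends \<Gamma> e" "v \<in> ends \<Gamma> f" using v by blast
  have "e \<in> E" using even_cycle_subset[OF based_cubesD(3)[OF b s(1)]] s(2) by blast
  then have "v \<in> V" using ends_subset v(1) by blast
  have B: "translate \<Gamma> {s} A \<in> D" using dimer_cubesD(2)[OF c, of "{s}"] s(1) by simp
  have tr: "g \<in> translate \<Gamma> {s} A \<longleftrightarrow> (g \<in> A) \<noteq> (g \<in> s)" for g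
    using translate_iff[OF b, of "{s}"] s(1) by simp
  have "\<not> (e \<in> X \<and> f \<in> X)" if "X \<in> D" for X
    using edg_eq[OF that \<open>v \<in> V\<close>] v s(4) by metis
  from this[OF A] this[OF B] show ?thesis using tr s(2,3) by blast
qed

lemma dimer_point_normal:
  assumes "p \<in> dimer_points"
  shows "\<exists>q. normal_point q \<and> (p, q) \<in> cube_equiv \<Gamma>"
proof -
  obtain A S x where p: "p = ((A, S), x)" and c: "(A, S) \<in> dimer_cubes" and x: "x \<in> S \<rightarrow>\<^sub>E {0..1}"
    using assms unfolding dimer_points_def by blast
  note b = dimer_cubesD(1)[OF c]
  \<comment> \<open>Coordinates equal to 1 are flipped to 0, and then all cycles with coordinate 0
    are dropped by passing to a face.\<close>
  define T where "T = {s \<in> S. x s = 1}"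
  define A' where "A' = translate \<Gamma> T A"
  define S' where "S' = {s \<in> S. 0 < x s \<and> x s < 1}"
  let ?y = "\<lambda>s\<in>S. if s \<in> T then 0 else x s" and ?z = "restrict x S'"
  have T: "T \<subseteq> S" unfolding T_def by blast
  have x01: "0 \<le> x s" "x s \<le> 1" if "s \<in> S" for s using x that by (auto simp: PiE_iff)
  have "A' \<subseteq> E" unfolding A'_def using dimer_subset dimer_cubesD(2)[OF c T] by blast
  then have b': "(A', S) \<in> based_cubes \<Gamma>" "(A', S') \<in> based_cubes \<Gamma>"
    using based_cubesD[OF b] unfolding S'_def
    by (auto simp: based_cubes_def power_group_def pairwise_def)
  have top: "((A, S), x) \<in> topspace (cube_sum \<Gamma>)" "((A', S), ?y) \<in> topspace (cube_sum \<Gamma>)"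
    "((A', S'), ?z) \<in> topspace (cube_sum \<Gamma>)"
    unfolding topspace_cube_sum using b b' x x01 by (auto simp: S'_def)
  have "cube_glue \<Gamma> ((A, S), x) ((A', S), ?y)"
    unfolding A'_def
  proof (rule cube_glue.flip)
    show "\<forall>t\<in>T. ?y t = 1 - x t" using T by (auto simp: T_def)
  qed (use top T in \<open>auto simp: A'_def\<close>)
  moreover have "cube_glue \<Gamma> ((A', S'), ?z) ((A', S), ?y)"
  proof (rule cube_glue.face)
    show "\<forall>s\<in>S'. ?z s = ?y s" by (auto simp: S'_def T_def)
    show "\<forall>s\<in>S - S'. ?y s = 0" using x01 by (force simp: S'_def T_def)
  qed (use top in \<open>auto simp: S'_def\<close>)
  ultimately have "equivclp (cube_glue \<Gamma>) ((A, S), x) ((A', S'), ?z)"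
    by (meson converse_r_into_equivclp equivclp_trans r_into_equivclp)
  then have "(p, ((A', S'), ?z)) \<in> cube_equiv \<Gamma>" using top p by (simp add: cube_equiv_def)
  moreover have "normal_point ((A', S'), ?z)"
    unfolding normal_point_def prod.case
  proof (intro conjI ballI impI)
    show "((A', S'), ?z) \<in> topspace (cube_sum \<Gamma>)" by (fact top(3))
    fix s assume s: "s \<in> S'"
    then show "0 < ?z s" "?z s < 1" by (simp_all add: S'_def)
    have sS: "s \<in> S" "s \<notin> T" using s by (auto simp: S'_def T_def)
    fix e f assume ef: "e \<in> s" "f \<in> s" "e \<noteq> f" "ends \<Gamma> e \<inter> ends \<Gamma> f \<noteq> {}"
    have "g \<in> A' \<longleftrightarrow> g \<in> A" if "g \<in> s" for g
    proof -
      have "g \<notin> \<Union>T" using based_cube_eq[OF b sS(1)] sS(2) that T by blast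
      then show ?thesis unfolding A'_def using translate_iff[OF b T] by blast
    qed
    then show "(e \<in> A') \<noteq> (f \<in> A')"
      using dimer_cube_alternates[OF c sS(1) ef] ef(1,2) by blast
  qed
  ultimately show ?thesis by blast
qed

lemma normal_point_fractional:
  assumes "normal_point ((A, S), x)"
  shows "e \<in> \<Union>S \<longleftrightarrow> 0 < edge_weight ((A, S), x) e \<and> edge_weight ((A, S), x) e < 1"
proof (cases "e \<in> \<Union>S")
  case True
  then obtain s where s: "s \<in> S" "e \<in> s" by blast
  then show ?thesis
    using edge_weight_cycle[OF normal_pointD(1)[OF assms] s, of x] normal_pointD(4,5)[OF assms s(1)] by auto
next
  case False
  then show ?thesis by (simp only: edge_weight_outside[OF False]) simp
qed

text \<open>All edges of \<open>s\<close> have fractional weight and hence lie on cycles of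
  \<open>S'\<close>. By independence, edges with a common end lie on the same one, so walking around
  \<open>s\<close> never leaves \<open>t\<close>.\<close>

lemma normal_point_cycles_subset:
  assumes p: "normal_point ((A, S), x)" and q: "normal_point ((A', S'), x')"
    and eq: "edge_weight ((A, S), x) = edge_weight ((A', S'), x')"
    and s: "s \<in> S" "e \<in> s" and t: "t \<in> S'" "e \<in> t"
  shows "s \<subseteq> t"
proof
  fix f assume f: "f \<in> s"
  show "f \<in> t"
  proof (rule cycle_connected[where P = "\<lambda>f. f \<in> t"])
    show "even_cycle \<Gamma> s" by (rule based_cubesD(3)[OF normal_pointD(1)[OF p] s(1)])
    fix e f assume *: "e \<in> s" "f \<in> s" "ends \<Gamma> e \<inter> ends \<Gamma> f \<noteq> {}" "e \<in> t"
    have "f \<in> \<Union>S'"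
      using normal_point_fractional[OF p, of f] normal_point_fractional[OF q, of f] eq s(1) *(2) by auto
    then obtain t' where t': "t' \<in> S'" "f \<in> t'" by blast
    then have "t = t'" using based_cube_eq_at_vertex[OF normal_pointD(1)[OF q] t(1) t'(1) *(4) t'(2)] *(3) by blast
    then show "f \<in> t" using t'(2) by simp
  qed (use s t f in auto)
qed

lemma normal_point_cycles:
  assumes p: "normal_point ((A, S), x)" and q: "normal_point ((A', S'), x')"
    and eq: "edge_weight ((A, S), x) = edge_weight ((A', S'), x')"
  shows "S \<subseteq> S'"
proof
  fix s assume s: "s \<in> S"
  obtain e where e: "e \<in> s"
    using even_cycle_nonempty[OF based_cubesD(3)[OF normal_pointD(1)[OF p] s]] by blast
  have "e \<in> \<Union>S'"
    using normal_point_fractional[OF p, of e] normal_point_fractional[OF q, of e] eq s e by auto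
  then obtain t where t: "t \<in> S'" "e \<in> t" by blast
  have "s \<subseteq> t" by (rule normal_point_cycles_subset[OF p q eq s e t])
  moreover have "t \<subseteq> s" by (rule normal_point_cycles_subset[OF q p eq[symmetric] t s e])
  ultimately show "s \<in> S'" using t(1) by simp
qed

lemma normal_point_unique:
  assumes p: "normal_point p" and q: "normal_point q" and eq: "edge_weight p = edge_weight q"
  shows "(p, q) \<in> cube_equiv \<Gamma>"
proof -
  obtain A S x where p': "p = ((A, S), x)" by (metis prod.exhaust)
  obtain A' S' x' where q': "q = ((A', S'), x')" by (metis prod.exhaust)
  note p = p[unfolded p'] and q = q[unfolded q'] and eq = eq[unfolded p' q']
  have S: "S' = S"
    using normal_point_cycles[OF p q eq] normal_point_cycles[OF q p eq[symmetric]] by blast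
  note q = q[unfolded S] and eq = eq[unfolded S]
  note b = normal_pointD(1)[OF p] and b' = normal_pointD(1)[OF q]
  \<comment> \<open>A single disagreement on a cycle suffices: since both bases alternate, it
    propagates around the cycle, and the bases are complementary there. Flipping exactly these
    cycles turns one point into the other.\<close>
  define T where "T = {s \<in> S. \<exists>e\<in>s. (e \<in> A) \<noteq> (e \<in> A')}"
  have T: "T \<subseteq> S" unfolding T_def by blast
  have differ: "(e \<in> A) \<noteq> (e \<in> A')" if s: "s \<in> T" "e \<in> s" for s e
  proof -
    obtain e0 where e0: "s \<in> S" "e0 \<in> s" "(e0 \<in> A) \<noteq> (e0 \<in> A')" using s(1) unfolding T_def by blast
    show ?thesis
    proof (rule cycle_connected[where P = "\<lambda>e. (e \<in> A) \<noteq> (e \<in> A')"])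
      show "even_cycle \<Gamma> s" by (rule based_cubesD(3)[OF b e0(1)])
      fix e f assume *: "e \<in> s" "f \<in> s" "ends \<Gamma> e \<inter> ends \<Gamma> f \<noteq> {}" "(e \<in> A) \<noteq> (e \<in> A')"
      show "(f \<in> A) \<noteq> (f \<in> A')"
        using normal_pointD(6)[OF p e0(1) *(1,2) _ *(3)] normal_pointD(6)[OF q e0(1) *(1,2) _ *(3)] *(4)
        by (cases "e = f") blast+
    qed (use e0 s in auto)
  qed
  have weights: "(if e \<in> A then 1 - x s else x s) = (if e \<in> A' then 1 - x' s else x' s)"
    if "s \<in> S" "e \<in> s" for s e
    using fun_cong[OF eq, of e] edge_weight_cycle[OF b that, of x] edge_weight_cycle[OF b' that, of x'] by simp
  have A': "translate \<Gamma> T A = A'"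
  proof -
    have "e \<in> translate \<Gamma> T A \<longleftrightarrow> e \<in> A'" for e
    proof (cases "e \<in> \<Union>S")
      case True
      then obtain s where s: "s \<in> S" "e \<in> s" by blast
      then have "e \<in> \<Union>T \<longleftrightarrow> s \<in> T" using based_cube_eq[OF b] T by blast
      moreover have "s \<notin> T \<Longrightarrow> e \<in> A \<longleftrightarrow> e \<in> A'" using s unfolding T_def by blast
      ultimately show ?thesis using translate_iff[OF b T, of e] differ[OF _ s(2)] by blast
    next
      case False
      have "(if e \<in> A then 1 else 0 :: real) = (if e \<in> A' then 1 else 0)"
        using fun_cong[OF eq, of e] unfolding edge_weight_outside[OF False] .
      then have "e \<in> A \<longleftrightarrow> e \<in> A'" by (simp split: if_splits)
      then show ?thesis using translate_iff[OF b T, of e] False T by blast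
    qed
    then show ?thesis by blast
  qed
  have "cube_glue \<Gamma> ((A, S), x) ((translate \<Gamma> T A, S), x')"
  proof (rule cube_glue.flip)
    show "\<forall>t\<in>T. x' t = 1 - x t"
    proof
      fix t assume t: "t \<in> T"
      obtain e where e: "e \<in> t"
        using even_cycle_nonempty[OF based_cubesD(3)[OF b]] t T by blast
      then show "x' t = 1 - x t"
        using weights[of t e] differ[OF t e] t T by (auto split: if_splits)
    qed
    show "\<forall>s\<in>S - T. x' s = x s"
    proof
      fix s assume s: "s \<in> S - T"
      then obtain e where e: "e \<in> s"
        using even_cycle_nonempty[OF based_cubesD(3)[OF b]] by blast
      then have "e \<in> A \<longleftrightarrow> e \<in> A'" using s unfolding T_def by blast
      then show "x' s = x s" using weights[of s e] s e by (auto split: if_splits)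
    qed
  qed (use normal_pointD(3)[OF p] normal_pointD(3)[OF q] T A' in simp_all)
  then show ?thesis
    using normal_pointD(3)[OF p] normal_pointD(3)[OF q] unfolding p' q' S A' cube_equiv_def by auto
qed

lemma dimer_point_inj:
  assumes "p \<in> dimer_points" "q \<in> dimer_points" "edge_weight p = edge_weight q"
  shows "cube_class \<Gamma> p = cube_class \<Gamma> q"
proof -
  obtain p' where p': "normal_point p'" "(p, p') \<in> cube_equiv \<Gamma>"
    using dimer_point_normal[OF assms(1)] by blast
  obtain q' where q': "normal_point q'" "(q, q') \<in> cube_equiv \<Gamma>"
    using dimer_point_normal[OF assms(2)] by blast
  have "edge_weight p' = edge_weight q'"
    using assms(3) edge_weight_equiv[OF p'(2)] edge_weight_equiv[OF q'(2)] by simp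
  then have "(p', q') \<in> cube_equiv \<Gamma>" by (rule normal_point_unique[OF p'(1) q'(1)])
  then show ?thesis
    using equiv_class_eq[OF equiv_cube_equiv] p'(2) q'(2) unfolding cube_class_def by metis
qed

text \<open>A continuous bijection from a compact space onto a Hausdorff space.\<close>

lemma homeomorphic_map_class_weight:
  "homeomorphic_map (dimer_complex \<Gamma>) (top_of_set matching_complex) class_weight"
proof (rule continuous_imp_homeomorphic_map)
  have weight: "class_weight (cube_class \<Gamma> p) = edge_weight p" if "p \<in> dimer_points" for p
    using class_weight dimer_points_subset that by blast
  show "compact_space (dimer_complex \<Gamma>)" by (rule compact_dimer_complex)
  have "Hausdorff_space (euclidean :: ('e \<Rightarrow> real) topology)"
    unfolding euclidean_product_topology[symmetric] by (simp add: Hausdorff_space_product_topology)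
  then show "Hausdorff_space (top_of_set (matching_complex :: ('e \<Rightarrow> real) set))"
    by (rule Hausdorff_space_subtopology)
  have "edge_weight p \<in> matching_complex" if p: "p \<in> dimer_points" for p
  proof -
    obtain A S x where p: "p = ((A, S), x)" "(A, S) \<in> dimer_cubes" "x \<in> S \<rightarrow>\<^sub>E {0..1}"
      using p unfolding dimer_points_def by blast
    show ?thesis
      using edge_weight_span[OF p(2,3)] span_subset[OF dimer_cubesD(3)[OF p(2)] dimer_cubesD(2)[OF p(2) order_refl]]
        p(1) by blast
  qed
  then have "edge_weight ` dimer_points = matching_complex"
    using weight_surj by blast
  moreover have "class_weight ` cube_class \<Gamma> ` dimer_points = edge_weight ` dimer_points"
    unfolding image_image using weight by (rule image_cong[OF HOL.refl])
  ultimately have image: "class_weight ` topspace (dimer_complex \<Gamma>) = matching_complex"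
    unfolding topspace_dimer_complex by simp
  then show "class_weight ` topspace (dimer_complex \<Gamma>) = topspace (top_of_set matching_complex)" by simp
  have "continuous_map (dimer_complex \<Gamma>) euclidean class_weight"
    unfolding dimer_complex_eq
    by (rule continuous_map_from_subtopology[OF continuous_map_class_weight])
  then show "continuous_map (dimer_complex \<Gamma>) (top_of_set matching_complex) class_weight"
    using image by (simp add: continuous_map_in_subtopology image_subset_iff_funcset[symmetric])
  show "inj_on class_weight (topspace (dimer_complex \<Gamma>))"
    unfolding topspace_dimer_complex
  proof (rule inj_onI, elim imageE)
    fix C C' p q
    assume "class_weight C = class_weight C'" "C = cube_class \<Gamma> p" "p \<in> dimer_points"
      "C' = cube_class \<Gamma> q" "q \<in> dimer_points"
    then show "C = C'" using weight dimer_point_inj by metis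
  qed
qed

lemma vertex_point:
  assumes "A \<in> D"
  shows "vertex_point \<Gamma> A \<in> topspace (dimer_complex \<Gamma>)" "class_weight (vertex_point \<Gamma> A) = indicator A"
proof -
  let ?p = "((A, {}), \<lambda>_. undefined) :: 'e cube_point"
  have b: "(A, {}) \<in> based_cubes \<Gamma>"
    using dimer_subset[OF assms] by (simp add: based_cubes_def power_group_def)
  have "translate \<Gamma> {} A = A" using translate_iff[OF b, of "{}"] by blast
  then have "cube_vertices \<Gamma> (A, {}) \<subseteq> D" using assms by (simp add: cube_vertices_def)
  then have p: "?p \<in> dimer_points" using b unfolding dimer_points_def dimer_cubes_def by simp
  then show "vertex_point \<Gamma> A \<in> topspace (dimer_complex \<Gamma>)"
    unfolding topspace_dimer_complex vertex_point_def by blast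
  have "class_weight (vertex_point \<Gamma> A) = edge_weight ?p"
    unfolding vertex_point_def using class_weight dimer_points_subset p by blast
  also have "edge_weight ?p = indicator A"
    by (rule ext) (simp add: edge_weight_def indicator_def)
  finally show "class_weight (vertex_point \<Gamma> A) = indicator A" .
qed

end

section \<open>The fundamental group\<close>

text \<open>The fundamental group is defined for abstract topologies, path homotopies for subsets of
  a topological type. The homeomorphism translates loops at \<open>a\<close> and their homotopies
  into \<open>K\<close>.\<close>

locale homeomorphic_subset =
  fixes X :: "'x topology" and K :: "'a::topological_space set"
    and F :: "'x \<Rightarrow> 'a" and G :: "'a \<Rightarrow> 'x" and a :: 'x
  assumes maps: "homeomorphic_maps X (top_of_set K) F G"
    and base: "a \<in> topspace X"
begin

lemma contF: "continuous_map X (top_of_set K) F" and contG: "continuous_map (top_of_set K) X G"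
  and GF: "x \<in> topspace X \<Longrightarrow> G (F x) = x" and FG: "z \<in> K \<Longrightarrow> F (G z) = z"
  using maps by (auto simp: homeomorphic_maps_def)

lemma loop_image:
  assumes "p \<in> loops X a"
  shows "path (F \<circ> p)" "path_image (F \<circ> p) \<subseteq> K"
    "pathstart (F \<circ> p) = F a" "pathfinish (F \<circ> p) = F a"
    "\<And>t. t \<in> {0..1} \<Longrightarrow> p t \<in> topspace X"
proof -
  have p: "continuous_map (top_of_set {0..1}) X p" "p 0 = a" "p 1 = a"
    using assms unfolding loops_def pathin_def by simp_all
  have "continuous_map (top_of_set {0..1}) (top_of_set K) (F \<circ> p)"
    by (rule continuous_map_compose[OF p(1) contF])
  then have "continuous_on {0..1} (F \<circ> p)" "(F \<circ> p) ` {0..1} \<subseteq> K"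
    unfolding continuous_map_in_subtopology image_subset_iff_funcset by simp_all
  then show "path (F \<circ> p)" "path_image (F \<circ> p) \<subseteq> K"
    unfolding path_def path_image_def by simp_all
  show "pathstart (F \<circ> p) = F a" "pathfinish (F \<circ> p) = F a"
    using p(2,3) by (simp_all add: pathstart_def pathfinish_def)
  show "p t \<in> topspace X" if "t \<in> {0..1}" for t
    using continuous_map_image_subset_topspace[OF p(1)] that by auto
qed

lemma loop_preimage:
  assumes "path q" "path_image q \<subseteq> K" "pathstart q = F a" "pathfinish q = F a"
  shows "G \<circ> q \<in> loops X a"
proof -
  have "continuous_map (top_of_set {0..1}) (top_of_set K) q"
    using assms(1,2) unfolding path_def path_image_def
    by (simp add: continuous_map_in_subtopology image_subset_iff_funcset)
  then have "continuous_map (top_of_set {0..1}) X (G \<circ> q)"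
    by (rule continuous_map_compose[OF _ contG])
  then show ?thesis
    using assms(3,4) GF[OF base] by (simp add: loops_def pathin_def pathstart_def pathfinish_def)
qed

lemma image_preimage:
  assumes "path q" "path_image q \<subseteq> K"
  shows "homotopic_paths K (F \<circ> (G \<circ> q)) q"
proof (rule homotopic_paths_sym[OF homotopic_paths_eq[OF assms]])
  fix t :: real assume "t \<in> {0..1}"
  then have "q t \<in> K" using assms(2) unfolding path_image_def by blast
  then show "q t = (F \<circ> (G \<circ> q)) t" using FG by simp
qed

lemma loop_homotopy_iff:
  assumes p: "p \<in> loops X a" and q: "q \<in> loops X a"
  shows "(p, q) \<in> loop_homotopy X a \<longleftrightarrow> homotopic_paths K (F \<circ> p) (F \<circ> q)"
proof
  assume "(p, q) \<in> loop_homotopy X a"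
  then have "homotopic_with (\<lambda>r. r 0 = a \<and> r 1 = a) (top_of_set {0..1}) X p q"
    by (simp add: loop_homotopy_def)
  then show "homotopic_paths K (F \<circ> p) (F \<circ> q)"
    unfolding homotopic_paths_def
    by (rule homotopic_with_compose_continuous_map_left[OF _ contF])
      (use loop_image[OF p] in \<open>simp add: pathstart_def pathfinish_def\<close>)
next
  assume "homotopic_paths K (F \<circ> p) (F \<circ> q)"
  then have "homotopic_with (\<lambda>r. r 0 = a \<and> r 1 = a) (top_of_set {0..1}) X (G \<circ> (F \<circ> p)) (G \<circ> (F \<circ> q))"
    unfolding homotopic_paths_def
    by (rule homotopic_with_compose_continuous_map_left[OF _ contG])
      (use loop_image[OF p] GF[OF base] in \<open>simp add: pathstart_def pathfinish_def\<close>)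
  \<comment> \<open>Loops are functions on all reals with arbitrary values outside the unit
    interval, so \<open>G \<circ> (F \<circ> p)\<close> equals \<open>p\<close> only on that
    interval.\<close>
  then have "homotopic_with (\<lambda>r. r 0 = a \<and> r 1 = a) (top_of_set {0..1}) X p q"
    by (rule homotopic_with_eq) (use loop_image(5)[OF p] loop_image(5)[OF q] GF in auto)
  then show "(p, q) \<in> loop_homotopy X a" using p q by (simp add: loop_homotopy_def)
qed

lemma equiv_loop_homotopy: "equiv (loops X a) (loop_homotopy X a)"
proof (rule equivI)
  show sub: "loop_homotopy X a \<subseteq> loops X a \<times> loops X a" unfolding loop_homotopy_def by blast
  show "refl_on (loops X a) (loop_homotopy X a)"
    using loop_homotopy_iff loop_image by (simp add: refl_on_def)
  show "sym (loop_homotopy X a)"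
  proof (rule symI)
    fix p q assume pq: "(p, q) \<in> loop_homotopy X a"
    then have l: "p \<in> loops X a" "q \<in> loops X a" using sub by blast+
    show "(q, p) \<in> loop_homotopy X a"
      using pq homotopic_paths_sym unfolding loop_homotopy_iff[OF l] loop_homotopy_iff[OF l(2,1)] by blast
  qed
  show "trans (loop_homotopy X a)"
  proof (rule transI)
    fix p q r assume pq: "(p, q) \<in> loop_homotopy X a" "(q, r) \<in> loop_homotopy X a"
    then have l: "p \<in> loops X a" "q \<in> loops X a" "r \<in> loops X a" using sub by blast+
    show "(p, r) \<in> loop_homotopy X a"
      using pq homotopic_paths_trans
      unfolding loop_homotopy_iff[OF l(1,2)] loop_homotopy_iff[OF l(2,3)] loop_homotopy_iff[OF l(1,3)]
      by blast
  qed
qed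

lemma image_path_concat: "F \<circ> path_concat p q = (F \<circ> p) +++ (F \<circ> q)"
  by (auto simp: path_concat_def joinpaths_def)

text \<open>Continuity is obtained by joining the images in \<open>K\<close> and mapping the result
  back.\<close>

lemma path_concat_loop:
  assumes p: "p \<in> loops X a" and q: "q \<in> loops X a"
  shows "path_concat p q \<in> loops X a"
proof -
  let ?r = "(F \<circ> p) +++ (F \<circ> q)"
  have "G \<circ> ?r \<in> loops X a"
    using loop_image(1-4)[OF p] loop_image(1-4)[OF q]
    by (intro loop_preimage) (simp_all add: path_image_join)
  moreover have "(G \<circ> ?r) t = path_concat p q t" if "t \<in> {0..1}" for t
    using GF loop_image(5)[OF p, of "2 * t"] loop_image(5)[OF q, of "2 * t - 1"] that
    by (simp add: path_concat_def joinpaths_def)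
  ultimately show ?thesis
    unfolding loops_def pathin_def by (auto intro: continuous_map_eq)
qed

lemma mult_fundamental_group:
  assumes "p \<in> loops X a" "q \<in> loops X a"
  shows "loop_homotopy X a `` {p} \<otimes>\<^bsub>fundamental_group X a\<^esub> loop_homotopy X a `` {q} =
    loop_homotopy X a `` {path_concat p q}"
proof -
  have sub: "loop_homotopy X a \<subseteq> loops X a \<times> loops X a" unfolding loop_homotopy_def by blast
  have "(\<lambda>p q. loop_homotopy X a `` {path_concat p q}) respects2 loop_homotopy X a"
  proof (rule congruent2I')
    fix p p' q q' assume "(p, p') \<in> loop_homotopy X a" "(q, q') \<in> loop_homotopy X a"
    then have l: "p \<in> loops X a" "p' \<in> loops X a" "q \<in> loops X a" "q' \<in> loops X a"
      and h: "homotopic_paths K (F \<circ> p) (F \<circ> p')" "homotopic_paths K (F \<circ> q) (F \<circ> q')"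
      using sub loop_homotopy_iff by blast+
    have "homotopic_paths K (F \<circ> path_concat p q) (F \<circ> path_concat p' q')"
      unfolding image_path_concat using loop_image[OF l(1)] loop_image[OF l(3)]
      by (intro homotopic_paths_join h) simp
    then have "(path_concat p q, path_concat p' q') \<in> loop_homotopy X a"
      using loop_homotopy_iff path_concat_loop l by blast
    then show "loop_homotopy X a `` {path_concat p q} = loop_homotopy X a `` {path_concat p' q'}"
      by (rule equiv_class_eq[OF equiv_loop_homotopy])
  qed
  from UN_equiv_class2[OF equiv_loop_homotopy equiv_loop_homotopy this assms]
  show ?thesis by (simp add: fundamental_group_def)
qed

end

section \<open>The isomorphism between the presented group and the fundamental group\<close>

context based_multigraph
begin

lemma presented_group_iso:
  "presented_group gens rels \<cong> fundamental_group (dimer_complex \<Gamma>) (vertex_point \<Gamma> A\<^sub>0)"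
proof -
  let ?X = "dimer_complex \<Gamma>" and ?a = "vertex_point \<Gamma> A\<^sub>0"
  let ?\<pi> = "fundamental_group ?X ?a" and ?H = "loop_homotopy ?X ?a"
  obtain f where maps: "homeomorphic_maps ?X (top_of_set matching_complex) class_weight f"
    using homeomorphic_map_class_weight unfolding homeomorphic_map_maps by blast
  interpret homeomorphic_subset ?X matching_complex class_weight f ?a
    using maps vertex_point(1)[OF A0] by unfold_locales
  have base_weight: "class_weight ?a = indicator A\<^sub>0" by (rule vertex_point(2)[OF A0])
  define \<phi> where "\<phi> w = ?H `` {f \<circ> word_path w}" for w
  have loop: "f \<circ> word_path w \<in> loops ?X ?a" if "w \<in> words gens" for w
    using word_path[OF that] base_weight by (intro loop_preimage) simp_all
  \<comment> \<open>One direction makes the map on classes of words well defined, the other makes it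
    injective.\<close>
  have \<phi>_eq: "\<phi> u = \<phi> v \<longleftrightarrow> cong u v" if "u \<in> words gens" "v \<in> words gens" for u v
  proof -
    have "\<phi> u = \<phi> v \<longleftrightarrow> (f \<circ> word_path u, f \<circ> word_path v) \<in> ?H"
      unfolding \<phi>_def using eq_equiv_class_iff[OF equiv_loop_homotopy] loop that by blast
    also have "\<dots> \<longleftrightarrow> (class_weight \<circ> (f \<circ> word_path u)) \<simeq> (class_weight \<circ> (f \<circ> word_path v))"
      by (rule loop_homotopy_iff[OF loop[OF that(1)] loop[OF that(2)]])
    also have "\<dots> \<longleftrightarrow> word_path u \<simeq> word_path v"
    proof -
      have uv: "class_weight \<circ> (f \<circ> word_path u) \<simeq> word_path u" "class_weight \<circ> (f \<circ> word_path v) \<simeq> word_path v"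
        using image_preimage word_path that by simp_all
      show ?thesis
        using homotopic_paths_trans[OF homotopic_paths_sym[OF uv(1)] homotopic_paths_trans[OF _ uv(2)]]
          homotopic_paths_trans[OF uv(1) homotopic_paths_trans[OF _ homotopic_paths_sym[OF uv(2)]]]
        by blast
    qed
    also have "\<dots> \<longleftrightarrow> cong u v"
      using cong_homotopic homotopic_cong that by blast
    finally show ?thesis .
  qed
  have \<phi>_append: "\<phi> (u @ v) = \<phi> u \<otimes>\<^bsub>?\<pi>\<^esub> \<phi> v" if w: "u \<in> words gens" "v \<in> words gens" for u v
  proof -
    let ?p = "f \<circ> word_path u" and ?q = "f \<circ> word_path v" and ?r = "f \<circ> word_path (u @ v)"
    have uv: "u @ v \<in> words gens" using w by simp
    have "class_weight \<circ> ?r \<simeq> word_path (u @ v)" by (rule image_preimage[OF word_path[OF uv]])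
    also have "word_path (u @ v) \<simeq> word_path u +++ word_path v"
      by (rule homotopic_paths_sym[OF word_path_append[OF w]])
    also have "word_path u +++ word_path v \<simeq> (class_weight \<circ> ?p) +++ (class_weight \<circ> ?q)"
      using image_preimage[OF word_path[OF w(1)]] image_preimage[OF word_path[OF w(2)]]
      by (intro homotopic_paths_join homotopic_paths_sym[of _ _ "word_path _"]) simp_all
    finally have "class_weight \<circ> ?r \<simeq> class_weight \<circ> path_concat ?p ?q"
      unfolding image_path_concat .
    then have "(?r, path_concat ?p ?q) \<in> ?H"
      using loop_homotopy_iff loop[OF uv] path_concat_loop loop w by blast
    then show ?thesis
      unfolding \<phi>_def mult_fundamental_group[OF loop[OF w(1)] loop[OF w(2)]]
      by (rule equiv_class_eq[OF equiv_loop_homotopy])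
  qed
  have \<phi>_surj: "\<exists>w\<in>words gens. C = \<phi> w" if "C \<in> carrier ?\<pi>" for C
  proof -
    obtain p where p: "p \<in> loops ?X ?a" "C = ?H `` {p}"
      using \<open>C \<in> carrier ?\<pi>\<close> by (auto simp: fundamental_group_def quotient_def)
    obtain w where w: "w \<in> words gens" "(class_weight \<circ> p) \<simeq> word_path w"
      using loop_reducible loop_image(1-4)[OF p(1)] base_weight by auto
    have "(class_weight \<circ> p) \<simeq> class_weight \<circ> (f \<circ> word_path w)"
      using w(2) image_preimage[OF word_path[OF w(1)]] homotopic_paths_trans homotopic_paths_sym by blast
    then have "(p, f \<circ> word_path w) \<in> ?H" using loop_homotopy_iff[OF p(1) loop[OF w(1)]] by blast
    then have "C = \<phi> w" unfolding p(2) \<phi>_def by (rule equiv_class_eq[OF equiv_loop_homotopy])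
    then show ?thesis using w(1) by blast
  qed
  \<comment> \<open>All words of a class have the same image under \<open>\<phi>\<close>, so the
    union is that image.\<close>
  define h where "h C = (\<Union>w\<in>C. \<phi> w)" for C
  have "\<phi> respects word_equiv gens rels"
  proof (rule congruentI)
    fix u v assume "(u, v) \<in> word_equiv gens rels"
    then have "cong u v" by (simp add: word_equiv_def)
    then show "\<phi> u = \<phi> v" using \<phi>_eq word_cong_words by blast
  qed
  then have h: "h (cls w) = \<phi> w" if "w \<in> words gens" for w
    unfolding h_def using UN_equiv_class[OF equiv_word_equiv] that by blast
  have carrier: "carrier P = cls ` words gens"
    by (auto simp: presented_group_def quotient_def)
  have "h \<in> iso P ?\<pi>"
    unfolding iso_def
  proof (intro CollectI conjI homI)
    fix C assume "C \<in> carrier P"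
    then obtain w where w: "w \<in> words gens" "C = cls w" unfolding carrier by blast
    then show "h C \<in> carrier ?\<pi>"
      using h loop by (simp add: fundamental_group_def \<phi>_def quotientI)
    fix C' assume "C' \<in> carrier P"
    then obtain w' where w': "w' \<in> words gens" "C' = cls w'" unfolding carrier by blast
    show "h (C \<otimes>\<^bsub>P\<^esub> C') = h C \<otimes>\<^bsub>?\<pi>\<^esub> h C'"
      using w w' h \<phi>_append by (simp add: mult_presented_group)
  next
    show "bij_betw h (carrier P) (carrier ?\<pi>)"
      unfolding bij_betw_def
    proof
      show "inj_on h (carrier P)"
      proof (rule inj_onI)
        fix C C' assume "C \<in> carrier P" "C' \<in> carrier P" "h C = h C'"
        then obtain u v where uv: "u \<in> words gens" "v \<in> words gens" "C = cls u" "C' = cls v"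
          unfolding carrier by blast
        then have "\<phi> u = \<phi> v" using \<open>h C = h C'\<close> h by simp
        then show "C = C'" using \<phi>_eq uv cls_eq by blast
      qed
      show "h ` carrier P = carrier ?\<pi>"
      proof
        show "h ` carrier P \<subseteq> carrier ?\<pi>"
          using h loop unfolding carrier by (auto simp: fundamental_group_def \<phi>_def quotientI)
        show "carrier ?\<pi> \<subseteq> h ` carrier P"
        proof
          fix C assume "C \<in> carrier ?\<pi>"
          then obtain w where w: "w \<in> words gens" "C = \<phi> w" using \<phi>_surj by blast
          show "C \<in> h ` carrier P"
            unfolding carrier w(2) h[OF w(1), symmetric] by (intro imageI w(1))
        qed
      qed
    qed
  qed
  then show ?thesis by (rule is_isoI)
qed

end

theorem theorem9p3:
  fixes \<Gamma> :: "('v, 'e) multigraph" and A\<^sub>0 :: "'e set"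
  assumes "finite_graph \<Gamma>"
    and "A\<^sub>0 \<in> dimer_coverings \<Gamma>"
  shows "fundamental_group (dimer_complex \<Gamma>) (vertex_point \<Gamma> A\<^sub>0) \<cong>
    presented_group (dimer_coverings \<Gamma> \<times> dimer_coverings \<Gamma>)
      ({(gen A C, gen A B @ gen B C) | A B C.
          A \<in> dimer_coverings \<Gamma> \<and> B \<in> dimer_coverings \<Gamma> \<and> C \<in> dimer_coverings \<Gamma> \<and>
          flat \<Gamma> A B C} \<union>
       {(gen A\<^sub>0 A, []) | A. A \<in> dimer_coverings \<Gamma>})"
proof -
  interpret based_multigraph \<Gamma> A\<^sub>0
    by unfold_locales (use assms in auto)
  \<comment> \<open>The isomorphism was built starting from the presented group, whose group axioms
    allow it to be inverted.\<close>
  show ?thesis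
    using group.iso_sym[OF group_presented_group presented_group_iso] unfolding rels_def .
qed

end
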